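(* Let $A_1,\dots,A_n\in\mathbb C\langle X_1,\dots,X_d\rangle$ be monomials, and let $x^1,\dots,x^n$ be $d$-tuples of semicircular variables, the whole family $(x^i_u)_{1\le i\le n,1\le u\le d}$ being jointly semicircular, such that for all $u,v\in[1,d]$ and $i,j\in[1,n]$, $\tau(x^i_ux^j_v)=\delta_{u=v}\,\kappa_{\{i,j\}}$, with $\kappa_{\{i,i\}}=1$. Let $x=(x_1,\dots,x_d)$ be the free semicircular system $x_u=l_u+l_u^*$ on the full Fock space. Put $\Delta_{\{i,j\}}=\sum_{l\ge1}\kappa_{\{i,j\}}^lP_l$. Then $$\tau\left(A_1(x^1)\cdots A_n(x^n)\right)=\sum_{K\in\mathcal K_n}\ \sum_{(k_{i,j})}\ \prod_{i\in\widehat K}\tau(A_i(x))\ \prod_{\{i,j\}\in K,\ i<j}T_{i,j},$$ where the second sum is over all integers $k_{i,j}$, $i\in[1,n]$, $j\in C_i^{**}(K)$, such that for every $i$ with $C_i^{**}(K)\ne\emptyset$, $0<k_{i,i^+}<k_{i,(i^+)^+}<\cdots<k_{i,(i^-)^-}<\deg A_i$ (successors and predecessors taken in $C_i(K)$). One sets $k_{i,i}=0$ and $k_{i,i^-}=\deg A_i$ whenever $C_i(K)\neq\{i\}$, and for $\{i,j\}\in K$, $i<j$, where $i^-$ and $j^-$ in the indices of $k_{i,j^-}$ (resp. $k_{j,i^-}$) denote predecessors in $C_i(K)$ (resp. $C_j(K)$), and $z^{(i)}_k$ is the index of the $k$-th letter of $A_i$ (monomials being evaluated in $x$): - if $j=i^-$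 in $C_i(K)$ and $i=j^-$ in $C_j(K)$: $T_{i,j}=\tau\left((A_i)_{(k_{i,j^-},k_{i,j}]}\,\Delta_{\{i,j\}}\,(A_j)_{(k_{j,i^-},k_{j,i}]}\right)$; - if $j\ne i^-$ in $C_i(K)$ and $i=j^-$ in $C_j(K)$: $T_{i,j}=\tau\left((A_i)_{(k_{i,j^-},k_{i,j})}\,l^*_{z^{(i)}_{k_{i,j}}}\Delta_{\{i,j\}}\,(A_j)_{(k_{j,i^-},k_{j,i}]}\right)$; - if $j=i^-$ in $C_i(K)$ and $i\ne j^-$ in $C_j(K)$: $T_{i,j}=\tau\left((A_i)_{(k_{i,j^-},k_{i,j}]}\,\Delta_{\{i,j\}}\,r_{z^{(j)}_{k_{j,i}}}(A_j)_{(k_{j,i^-},k_{j,i})}\right)$; - if $j\ne i^-$ in $C_i(K)$ and $i\ne j^-$ in $C_j(K)$: $T_{i,j}=\tau\left((A_i)_{(k_{i,j^-},k_{i,j})}\,l^*_{z^{(i)}_{k_{i,j}}}\Delta_{\{i,j\}}\,r_{z^{(j)}_{k_{j,i}}}(A_j)_{(k_{j,i^-},k_{j,i})}\right)$. Moreover, for all monomials $A=X_{z_1}\cdots X_{z_n}$ and $B=X_{z_{n+1}}\cdots X_{z_m}$, writing $A'=X_{z_1}\cdots X_{z_{n-1}}$ and $B'=X_{z_{n+1}}\cdots X_{z_{m-1}}$ (here $n$ and $m-n$ are the degrees of $A$ and $B$, at least $1$ where $A'$, resp. $B'$, occurs), and all $l\ge1$, $$\tau(A(x)P_lB(x))=\tau(B(x)P_lA(x)),$$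 $$\tau(A'(x)\,l_{z_n}^*P_l\,B(x))=\tau(B(x)\,P_lr_{z_n}A'(x)),$$ $$\tau(A(x)\,P_lr_{z_m}B'(x))=\tau(B'(x)\,l_{z_m}^*P_l\,A(x)),$$ $$\tau(A'(x)\,l_{z_n}^*P_lr_{z_m}B'(x))=\tau(B'(x)\,l_{z_m}^*P_lr_{z_n}A'(x)).$$
   Context: **Fock space.** Let $\mathcal H$ be a $d$-dimensional Hilbert space with orthonormal basis $e_1,\dots,e_d$ and $\mathcal F=\bigoplus_{l\ge0}\mathcal H^{\otimes l}$ its full Fock space with vacuum vector $\Omega$. $l_u$ and $r_u$ are the left and right creation operators: $l_u\Omega=r_u\Omega=e_u$, $l_u(\zeta_1\otimes\cdots\otimes\zeta_m)=e_u\otimes\zeta_1\otimes\cdots\otimes\zeta_m$, $r_u(\zeta_1\otimes\cdots\otimes\zeta_m)=\zeta_1\otimes\cdots\otimes\zeta_m\otimes e_u$. $P_l$ is the orthogonal projection of $\mathcal F$ onto $\mathcal H^{\otimes l}$. On $B(\mathcal F)$, $\tau(T)=\langle T\Omega,\Omega\rangle$; $x_u=l_u+l_u^*$ form a free semicircular system. For the tuples $x^i$, $\tau$ is the trace of the $\mathcal C^*$-probability space they live in. Jointly semicircular means that for any members $y_1,\dots,y_k$ of the family, $\tau(y_1\cdots y_k)=\sum_{\pi\in NCP(k)}\prod_{(p,q)\in\pi}\tau(y_py_q)$, where $NCP(k)$ is the set of non-crossing pair partitions of $[1,k]$. **Monomial pieces.** $[1,n]=\{1,\dots,n\}$. For $A=X_{z_1}\cdots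 X_{z_r}$: $A_{(u,v]}=X_{z_{u+1}}\cdots X_{z_v}$ and $A_{(u,v)}=X_{z_{u+1}}\cdots X_{z_{v-1}}$ (empty products are $1$). **Configurations.** Order $[1,n]$ cyclically (the successor of $n$ is $1$). For $k\ne l$, the circular interval $[k,l]$ consists of the elements met when going from $k$ to $l$ by taking successors, both ends included. A configuration $K$ is a set of unordered pairs $\{i,j\}$, $i\neq j$ in $[1,n]$, such that for all $\{i,j\},\{k,l\}\in K$ either $i,j\in[k,l]$ or $i,j\in[l,k]$ (circular intervals). $\mathcal K_n$ is the set of configurations, and $\widehat K$ is the set of $i\in[1,n]$ belonging to no pair of $K$. For $i\in[1,n]$, list $\{j:\{i,j\}\in K\}\cup\{i\}$ in the cyclic order starting at $i$: $i=k_1,k_2,\dots,k_m$. $C_i(K)$ is this set with the reversed cyclic order $(k_m,k_{m-1},\dots,k_2,k_1)$: in $C_i(K)$ the successor of $k_r$ is $k_r^+=k_{r-1}$ (with $k_1^+=k_m$) and its predecessor is $k_r^-=k_{r+1}$ (with $k_m^-=k_1$). Thus for $m\geq 2$, $i^+=k_m$ and $i^-=k_2$. $C_i^{**}(K)=C_i(K)\setminus\{i,i^-\}$, ordered as $(k_m,k_{m-1},\dots,k_3)$, which is empty if $m\le2$. *)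

theory Defs
  imports "HOL-Analysis.Analysis"
begin

class complex_vector = real_vector +
  fixes scaleC :: "complex \<Rightarrow> 'a \<Rightarrow> 'a" (infixr "*\<^sub>C" 75)
  assumes scaleC_add_right: "c *\<^sub>C (x + y) = c *\<^sub>C x + c *\<^sub>C y"
    and scaleC_add_left: "(b + c) *\<^sub>C x = b *\<^sub>C x + c *\<^sub>C x"
    and scaleC_scaleC: "b *\<^sub>C c *\<^sub>C x = (b * c) *\<^sub>C x"
    and scaleC_of_real: "complex_of_real r *\<^sub>C x = r *\<^sub>R x"

class cstar_algebra = complex_vector + real_normed_algebra_1 + banach +
  fixes star :: "'a \<Rightarrow> 'a"
  assumes scaleC_mult_left: "(c *\<^sub>C x) * y = c *\<^sub>C (x * y)"
    and scaleC_mult_right: "x * (c *\<^sub>C y) = c *\<^sub>C (x * y)"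
    and norm_scaleC: "norm (c *\<^sub>C x) = cmod c * norm x"
    and star_star: "star (star x) = x"
    and star_add: "star (x + y) = star x + star y"
    and star_scaleC: "star (c *\<^sub>C x) = cnj c *\<^sub>C star x"
    and star_mult: "star (x * y) = star y * star x"
    and norm_star_mult: "norm (star x * x) = (norm x)\<^sup>2"

definition tracial_state :: "('a::cstar_algebra \<Rightarrow> complex) \<Rightarrow> bool" where
  "tracial_state \<tau> \<longleftrightarrow>
     (\<forall>x y. \<tau> (x + y) = \<tau> x + \<tau> y) \<and> (\<forall>c x. \<tau> (c *\<^sub>C x) = c * \<tau> x) \<and>
     \<tau> 1 = 1 \<and> (\<forall>x. \<tau> (star x * x) \<in> \<real>\<^sub>\<ge>\<^sub>0) \<and> (\<forall>x y. \<tau> (x * y) = \<tau> (y * x))"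

definition NCP :: "nat \<Rightarrow> nat set set set" where
  "NCP k = {\<pi>. partition_on {1..k} \<pi> \<and> (\<forall>B\<in>\<pi>. card B = 2) \<and>
     \<not> (\<exists>B\<in>\<pi>. \<exists>B'\<in>\<pi>. \<exists>p\<in>B. \<exists>q\<in>B. \<exists>p'\<in>B'. \<exists>q'\<in>B'. p < p' \<and> p' < q \<and> q < q')}"

lemma finite_NCP: "finite (NCP k)"
  by (rule finite_subset[of _ "Pow (Pow {1..k})"]) (auto simp: NCP_def partition_on_def)

text \<open>
  Semicircular variables are self-adjoint.  A block \<open>B\<close> of a pair partition is \<open>{Min B, Max B}\<close>.
\<close>

definition jointly_semicircular :: "('a::cstar_algebra \<Rightarrow> complex) \<Rightarrow> 'a set \<Rightarrow> bool" where
  "jointly_semicircular \<tau> S \<longleftrightarrow>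
     (\<forall>a\<in>S. star a = a) \<and>
     (\<forall>k. \<forall>y :: nat \<Rightarrow> 'a. (\<forall>p\<in>{1..k}. y p \<in> S) \<longrightarrow>
        \<tau> (prod_list (map y [1..<Suc k])) =
          (\<Sum>\<pi>\<in>NCP k. \<Prod>B\<in>\<pi>. \<tau> (y (Min B) * y (Max B))))"

text \<open>
  The Hilbert space with orthonormal basis indexed by the finite type \<open>'d\<close> is \<open>\<complex>\<^sup>d\<close>, and its
  full Fock space is realised as the square-summable families of complex numbers indexed by words
  over \<open>'d\<close>: the word \<open>[u\<^sub>1, \<dots>, u\<^sub>m]\<close> stands for the basis vector
  \<open>e\<^sub>u\<^sub>1 \<otimes> \<dots> \<otimes> e\<^sub>u\<^sub>m\<close>, and the empty word for the vacuum.
\<close>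

typedef (overloaded) 'd fock =
  "{f :: 'd list \<Rightarrow> complex. (\<lambda>w. (cmod (f w))\<^sup>2) summable_on UNIV}"
  morphisms coord Abs_fock
  by (rule exI[of _ "\<lambda>_. 0"]) simp

setup_lifting type_definition_fock

lemma fock_eqI: "(\<And>w. coord f w = coord g w) \<Longrightarrow> f = g"
  by (rule coord_inject[THEN iffD1], rule ext)

lemma coord_Abs:
  "(\<lambda>w. (cmod (h w))\<^sup>2) summable_on UNIV \<Longrightarrow> coord (Abs_fock h) w = h w"
  by (simp add: Abs_fock_inverse)

lemma coord_summable: "(\<lambda>w. (cmod (coord f w))\<^sup>2) summable_on UNIV"
  using coord[of f] by simp

lemma sqsum_add:
  assumes "(\<lambda>w. (cmod (f w))\<^sup>2) summable_on UNIV" "(\<lambda>w. (cmod (g w))\<^sup>2) summable_on UNIV"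
  shows "(\<lambda>w. (cmod (f w + g w))\<^sup>2) summable_on UNIV"
proof (rule summable_on_comparison_test)
  show "(\<lambda>w. 2 * (cmod (f w))\<^sup>2 + 2 * (cmod (g w))\<^sup>2) summable_on UNIV"
    by (intro summable_on_add summable_on_cmult_right assms)
  fix w
  have "(cmod (f w + g w))\<^sup>2 \<le> (cmod (f w) + cmod (g w))\<^sup>2"
    by (simp add: norm_triangle_ineq power_mono)
  also have "\<dots> \<le> 2 * (cmod (f w))\<^sup>2 + 2 * (cmod (g w))\<^sup>2"
    using sum_squares_bound[of "cmod (f w)" "cmod (g w)"] by (simp add: power2_sum)
  finally show "(cmod (f w + g w))\<^sup>2 \<le> 2 * (cmod (f w))\<^sup>2 + 2 * (cmod (g w))\<^sup>2" .
qed auto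

lemma sqsum_scale:
  assumes "(\<lambda>w. (cmod (f w))\<^sup>2) summable_on UNIV"
  shows "(\<lambda>w. (cmod (c * f w))\<^sup>2) summable_on UNIV"
  using summable_on_cmult_right[OF assms, of "(cmod c)\<^sup>2"]
  by (simp add: norm_mult power_mult_distrib)

lemma sqsum_mono:
  assumes "(\<lambda>w. (cmod (f w))\<^sup>2) summable_on UNIV" "\<And>w. cmod (g w) \<le> cmod (f w)"
  shows "(\<lambda>w. (cmod (g w))\<^sup>2) summable_on UNIV"
  by (rule summable_on_comparison_test[OF assms(1)]) (auto intro!: power_mono assms(2))

lemma sqsum_inj:
  assumes "(\<lambda>w. (cmod (f w))\<^sup>2) summable_on UNIV" "inj \<phi>"
    "\<And>w. g (\<phi> w) = f w" "\<And>w. w \<notin> range \<phi> \<Longrightarrow> g w = 0"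
  shows "(\<lambda>w. (cmod (g w))\<^sup>2) summable_on UNIV"
proof -
  have "(\<lambda>w. (cmod (g w))\<^sup>2) summable_on range \<phi>"
    using assms(1,3) by (subst summable_on_reindex[OF assms(2)]) (simp add: o_def)
  then show ?thesis
    by (subst summable_on_cong_neutral[of "range \<phi>" UNIV _ "\<lambda>w. (cmod (g w))\<^sup>2"])
      (simp_all add: assms(4))
qed

instantiation fock :: (type) complex_vector
begin
lift_definition zero_fock :: "'a fock" is "\<lambda>_. 0" by simp
lift_definition plus_fock :: "'a fock \<Rightarrow> 'a fock \<Rightarrow> 'a fock" is "\<lambda>f g w. f w + g w"
  by (rule sqsum_add)
lift_definition uminus_fock :: "'a fock \<Rightarrow> 'a fock" is "\<lambda>f w. - f w" by simp
lift_definition minus_fock :: "'a fock \<Rightarrow> 'a fock \<Rightarrow> 'a fock" is "\<lambda>f g w. f w - g w"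
proof -
  fix f g :: "'a list \<Rightarrow> complex"
  assume "(\<lambda>w. (cmod (f w))\<^sup>2) summable_on UNIV" "(\<lambda>w. (cmod (g w))\<^sup>2) summable_on UNIV"
  then show "(\<lambda>w. (cmod (f w - g w))\<^sup>2) summable_on UNIV"
    using sqsum_add[of f "\<lambda>w. - g w"] by simp
qed
lift_definition scaleR_fock :: "real \<Rightarrow> 'a fock \<Rightarrow> 'a fock" is "\<lambda>r f w. complex_of_real r * f w"
  by (rule sqsum_scale)
lift_definition scaleC_fock :: "complex \<Rightarrow> 'a fock \<Rightarrow> 'a fock" is "\<lambda>c f w. c * f w"
  by (rule sqsum_scale)
instance
  by (standard; transfer; simp add: algebra_simps)
end

lemma coord_simps [simp]:
  "coord 0 w = 0" "coord (f + g) w = coord f w + coord g w"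
  "coord (- f) w = - coord f w" "coord (f - g) w = coord f w - coord g w"
  "coord (r *\<^sub>R f) w = complex_of_real r * coord f w" "coord (c *\<^sub>C f) w = c * coord f w"
  by (transfer; simp)+

lemma coord_sum: "coord (sum F A) w = (\<Sum>a\<in>A. coord (F a) w)"
  by (induction A rule: infinite_finite_induct) auto

definition cinner :: "'d fock \<Rightarrow> 'd fock \<Rightarrow> complex" where
  "cinner f g = (\<Sum>\<^sub>\<infinity>w. coord f w * cnj (coord g w))"

lemma cinner_summable: "(\<lambda>w. coord f w * cnj (coord g w)) summable_on UNIV"
proof -
  have "(\<lambda>w. norm (coord f w * cnj (coord g w))) summable_on UNIV"
  proof (rule summable_on_comparison_test)
    show "(\<lambda>w. (cmod (coord f w))\<^sup>2 + (cmod (coord g w))\<^sup>2) summable_on UNIV"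
      by (rule summable_on_add[OF coord_summable coord_summable])
    fix w
    show "norm (coord f w * cnj (coord g w)) \<le> (cmod (coord f w))\<^sup>2 + (cmod (coord g w))\<^sup>2"
      using sum_squares_bound[of "cmod (coord f w)" "cmod (coord g w)"]
        mult_nonneg_nonneg[OF norm_ge_zero[of "coord f w"] norm_ge_zero[of "coord g w"]]
      unfolding norm_mult complex_mod_cnj by linarith
  qed auto
  then show ?thesis by (rule abs_summable_summable)
qed

lemma cinner_add_left: "cinner (f + g) h = cinner f h + cinner g h"
  unfolding cinner_def
  by (simp add: distrib_right infsum_add cinner_summable)

lemma cinner_scaleC_left: "cinner (c *\<^sub>C f) h = c * cinner f h"
  unfolding cinner_def by (simp add: mult.assoc infsum_cmult_right')

lemma cinner_commute: "cinner g f = cnj (cinner f g)"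
  unfolding cinner_def by (subst infsum_cnj[symmetric]) (simp add: mult.commute)

lemma cinner_diff_left: "cinner (f - g) h = cinner f h - cinner g h"
  by (metis add_diff_cancel_right' cinner_add_left diff_add_cancel)

lemma cinner_diff_right: "cinner h (f - g) = cinner h f - cinner h g"
  by (metis cinner_commute cinner_diff_left complex_cnj_diff)

lemma cinner_self: "cinner f f = complex_of_real (\<Sum>\<^sub>\<infinity>w. (cmod (coord f w))\<^sup>2)"
  unfolding cinner_def
  using infsumI[OF has_sum_of_real[where 'a = complex, OF has_sum_infsum[OF coord_summable[of f]]]]
  by (simp only: complex_norm_square)

lemma cinner_self_eq_0: "cinner f f = 0 \<Longrightarrow> f = 0"
proof -
  assume "cinner f f = 0"
  then have "(\<Sum>\<^sub>\<infinity>w. (cmod (coord f w))\<^sup>2) = 0"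
    by (simp add: cinner_self)
  then have "(cmod (coord f w))\<^sup>2 = 0" for w
    using nonneg_infsum_le_0D[of "\<lambda>w. (cmod (coord f w))\<^sup>2" UNIV w]
    by (simp add: coord_summable)
  then show "f = 0" by (intro fock_eqI) simp
qed

instantiation fock :: (type) real_inner
begin
definition inner_fock :: "'a fock \<Rightarrow> 'a fock \<Rightarrow> real" where "inner_fock f g = Re (cinner f g)"
definition norm_fock :: "'a fock \<Rightarrow> real" where "norm_fock f = sqrt (inner f f)"
definition dist_fock :: "'a fock \<Rightarrow> 'a fock \<Rightarrow> real" where "dist_fock f g = norm (f - g)"
definition sgn_fock :: "'a fock \<Rightarrow> 'a fock" where "sgn_fock f = f /\<^sub>R norm f"
definition uniformity_fock :: "('a fock \<times> 'a fock) filter" where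
  "uniformity_fock = (INF e\<in>{0<..}. principal {(x, y). dist x y < e})"
definition open_fock :: "'a fock set \<Rightarrow> bool" where
  "open_fock U \<longleftrightarrow> (\<forall>x\<in>U. eventually (\<lambda>(x', y). x' = x \<longrightarrow> y \<in> U) uniformity)"
instance
proof
  fix f g h :: "'a fock" and r :: real and U :: "'a fock set"
  show "inner f g = inner g f"
    unfolding inner_fock_def by (subst cinner_commute) simp
  show "inner (f + g) h = inner f h + inner g h"
    by (simp add: inner_fock_def cinner_add_left)
  show "inner (r *\<^sub>R f) g = r * inner f g"
    by (simp add: inner_fock_def scaleC_of_real[symmetric] cinner_scaleC_left)
  show "0 \<le> inner f f"
    by (simp add: inner_fock_def cinner_self infsum_nonneg)
  show "inner f f = 0 \<longleftrightarrow> f = 0"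
  proof
    assume "inner f f = 0"
    then have "cinner f f = 0" by (simp add: inner_fock_def cinner_self)
    then show "f = 0" by (rule cinner_self_eq_0)
  qed (simp add: inner_fock_def cinner_def)
  show "dist f g = norm (f - g)" by (rule dist_fock_def)
  show "sgn f = f /\<^sub>R norm f" by (rule sgn_fock_def)
  show "(uniformity :: ('a fock \<times> 'a fock) filter) = (INF e\<in>{0<..}. principal {(x, y). dist x y < e})"
    by (rule uniformity_fock_def)
  show "open U \<longleftrightarrow> (\<forall>x\<in>U. \<forall>\<^sub>F (x', y) in uniformity. x' = x \<longrightarrow> y \<in> U)"
    by (rule open_fock_def)
  show "norm f = sqrt (inner f f)" by (rule norm_fock_def)
qed
end

lemma norm_fock_sq: "(norm f)\<^sup>2 = (\<Sum>\<^sub>\<infinity>w. (cmod (coord f w))\<^sup>2)" for f :: "'d fock"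
  by (simp add: power2_norm_eq_inner inner_fock_def cinner_self)

lift_definition basis_vec :: "'d list \<Rightarrow> 'd fock" is "\<lambda>v w. if w = v then 1 else 0"
  by (rule finite_nonzero_values_imp_summable_on) simp

lemma coord_basis_vec: "coord (basis_vec v) w = (if w = v then 1 else 0)"
  by transfer simp

lemma cinner_basis_vec_right: "cinner f (basis_vec v) = coord f v"
proof -
  have "cinner f (basis_vec v) = (\<Sum>\<^sub>\<infinity>w\<in>{v}. coord f w)"
    unfolding cinner_def by (rule infsum_cong_neutral) (auto simp: coord_basis_vec)
  then show ?thesis by simp
qed

definition vacuum :: "'d fock" ("\<Omega>") where "\<Omega> = basis_vec []"

lemma coord_le_norm: "cmod (coord f w) \<le> norm f"
proof -
  have "(\<Sum>\<^sub>\<infinity>v\<in>{w}. (cmod (coord f v))\<^sup>2) \<le> (\<Sum>\<^sub>\<infinity>v. (cmod (coord f v))\<^sup>2)"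
    by (rule infsum_mono_neutral) (auto simp: coord_summable)
  then have "(cmod (coord f w))\<^sup>2 \<le> (norm f)\<^sup>2" by (simp add: norm_fock_sq)
  then show ?thesis by (rule power2_le_imp_le) simp
qed

text \<open>The simple tensor \<open>\<zeta>\<^sub>1 \<otimes> \<dots> \<otimes> \<zeta>\<^sub>m\<close> of vectors of \<open>\<complex>\<^sup>d\<close>.\<close>

lift_definition tensor :: "(complex ^ 'd) list \<Rightarrow> ('d::finite) fock" is
  "\<lambda>\<zeta>s w. if length w = length \<zeta>s then \<Prod>i<length \<zeta>s. \<zeta>s ! i $ (w ! i) else 0"
proof -
  fix \<zeta>s :: "(complex ^ 'd) list"
  let ?g = "\<lambda>w. if length w = length \<zeta>s then \<Prod>i<length \<zeta>s. \<zeta>s ! i $ (w ! i) else 0"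
  have "{w \<in> UNIV. (cmod (?g w))\<^sup>2 \<noteq> 0} \<subseteq> {w :: 'd list. set w \<subseteq> UNIV \<and> length w = length \<zeta>s}"
    by auto
  then show "(\<lambda>w. (cmod (?g w))\<^sup>2) summable_on UNIV"
    by (intro finite_nonzero_values_imp_summable_on)
      (erule finite_subset, rule finite_lists_length_eq[OF finite])
qed

lemma coord_tensor:
  "coord (tensor \<zeta>s) w =
     (if length w = length \<zeta>s then \<Prod>i<length \<zeta>s. \<zeta>s ! i $ (w ! i) else 0)"
  by transfer simp

lemma tensor_Nil: "tensor [] = \<Omega>"
  by (rule fock_eqI) (simp add: coord_tensor vacuum_def coord_basis_vec)

lemma tensor_axis: "tensor (map (\<lambda>u. axis u 1) v) = basis_vec v"
proof (rule fock_eqI)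
  fix w
  show "coord (tensor (map (\<lambda>u. axis u 1) v)) w = coord (basis_vec v) w"
  proof (cases "w = v")
    case False
    show ?thesis
    proof (cases "length w = length v")
      case True
      then obtain i where "i < length v" "w ! i \<noteq> v ! i"
        using False nth_equalityI by metis
      then have "(\<Prod>i<length v. (axis (v ! i) 1 :: complex ^ 'a) $ (w ! i)) = 0"
        by (intro prod_zero) (auto simp: axis_def intro!: bexI[of _ i])
      then show ?thesis using True False by (simp add: coord_tensor coord_basis_vec)
    qed (use False in \<open>auto simp: coord_tensor coord_basis_vec\<close>)
  qed (simp add: coord_tensor coord_basis_vec axis_def)
qed

text \<open>
  Operators are maps \<open>'d fock \<Rightarrow> 'd fock\<close>, and their product is composition.
\<close>

lift_definition lcreate :: "'d \<Rightarrow> 'd fock \<Rightarrow> 'd fock" is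
  "\<lambda>u f w. if w \<noteq> [] \<and> hd w = u then f (tl w) else 0"
proof -
  fix u :: 'd and f :: "'d list \<Rightarrow> complex"
  assume "(\<lambda>w. (cmod (f w))\<^sup>2) summable_on UNIV"
  then show "(\<lambda>w. (cmod (if w \<noteq> [] \<and> hd w = u then f (tl w) else 0))\<^sup>2) summable_on UNIV"
    by (rule sqsum_inj[where \<phi> = "\<lambda>w. u # w"])
       (auto simp: image_iff, metis list.collapse)
qed

lift_definition rcreate :: "'d \<Rightarrow> 'd fock \<Rightarrow> 'd fock" is
  "\<lambda>u f w. if w \<noteq> [] \<and> last w = u then f (butlast w) else 0"
proof -
  fix u :: 'd and f :: "'d list \<Rightarrow> complex"
  assume "(\<lambda>w. (cmod (f w))\<^sup>2) summable_on UNIV"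
  then show "(\<lambda>w. (cmod (if w \<noteq> [] \<and> last w = u then f (butlast w) else 0))\<^sup>2) summable_on UNIV"
    by (rule sqsum_inj[where \<phi> = "\<lambda>w. w @ [u]"])
       (auto simp: image_iff inj_def, metis append_butlast_last_id)
qed

lemma coord_lcreate:
  "coord (lcreate u f) w = (if w \<noteq> [] \<and> hd w = u then coord f (tl w) else 0)"
  by transfer simp

lemma coord_rcreate:
  "coord (rcreate u f) w = (if w \<noteq> [] \<and> last w = u then coord f (butlast w) else 0)"
  by transfer simp

lemma lcreate_tensor: "lcreate u (tensor \<zeta>s) = tensor (axis u 1 # \<zeta>s)"
proof (rule fock_eqI)
  fix w
  show "coord (lcreate u (tensor \<zeta>s)) w = coord (tensor (axis u 1 # \<zeta>s)) w"
    by (cases w) (auto simp: coord_lcreate coord_tensor prod.lessThan_Suc_shift axis_def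
        simp del: prod.lessThan_Suc)
qed

lemma rcreate_tensor: "rcreate u (tensor \<zeta>s) = tensor (\<zeta>s @ [axis u 1])"
proof (rule fock_eqI)
  fix w
  show "coord (rcreate u (tensor \<zeta>s)) w = coord (tensor (\<zeta>s @ [axis u 1])) w"
    by (cases w rule: rev_cases)
       (auto simp: coord_rcreate coord_tensor axis_def nth_append intro!: prod.cong)
qed

lemma bounded_linear_fockI:
  fixes T :: "'d fock \<Rightarrow> 'd fock"
  assumes "\<And>f g. T (f + g) = T f + T g" "\<And>c f. T (c *\<^sub>C f) = c *\<^sub>C T f"
    "inj \<phi>" "\<And>f w. coord (T f) (\<phi> w) = coord f w" "\<And>f w. w \<notin> range \<phi> \<Longrightarrow> coord (T f) w = 0"
  shows "bounded_linear T"
proof (rule bounded_linear_intro[where K = 1])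
  show "T (r *\<^sub>R f) = r *\<^sub>R T f" for r f
    by (simp add: assms(2) flip: scaleC_of_real)
  fix f
  have "(norm (T f))\<^sup>2 = (\<Sum>\<^sub>\<infinity>w\<in>range \<phi>. (cmod (coord (T f) w))\<^sup>2)"
    unfolding norm_fock_sq by (rule infsum_cong_neutral) (auto simp: assms(5))
  also have "\<dots> = (norm f)\<^sup>2"
    by (simp add: norm_fock_sq infsum_reindex[OF assms(3)] o_def assms(4))
  finally show "norm (T f) \<le> norm f * 1" by simp
qed (rule assms(1))

lemma bounded_linear_lcreate: "bounded_linear (lcreate u)"
proof (rule bounded_linear_fockI[where \<phi> = "\<lambda>w. u # w"])
  fix f and w :: "'a list" assume "w \<notin> range ((#) u)"
  then show "coord (lcreate u f) w = 0"
    by (cases w) (auto simp: coord_lcreate)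
qed (auto intro!: fock_eqI simp: coord_lcreate)

lemma bounded_linear_rcreate: "bounded_linear (rcreate u)"
proof (rule bounded_linear_fockI[where \<phi> = "\<lambda>w. w @ [u]"])
  fix f and w :: "'a list" assume "w \<notin> range (\<lambda>w. w @ [u])"
  then show "coord (rcreate u f) w = 0"
    by (cases w rule: rev_cases) (auto simp: coord_rcreate)
qed (auto intro!: fock_eqI simp: coord_rcreate inj_def)

definition cadjoint :: "('d fock \<Rightarrow> 'd fock) \<Rightarrow> 'd fock \<Rightarrow> 'd fock" where
  "cadjoint T = (THE S. \<forall>f g. cinner (T f) g = cinner f (S g))"

lemma cadjointI:
  assumes "\<And>f g. cinner (T f) g = cinner f (S g)"
  shows "cadjoint T = S"
  unfolding cadjoint_def
proof (rule the_equality)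
  show "\<forall>f g. cinner (T f) g = cinner f (S g)" using assms by simp
next
  fix S' assume S': "\<forall>f g. cinner (T f) g = cinner f (S' g)"
  show "S' = S"
  proof
    fix g
    have "cinner (S' g - S g) (S' g - S g) = 0"
      using S' assms by (simp add: cinner_diff_right)
    then show "S' g = S g" using cinner_self_eq_0 by fastforce
  qed
qed

lemma coord_cadjoint_lcreate: "coord (cadjoint (lcreate u) f) w = coord f (u # w)"
proof -
  have sq: "(\<lambda>w. (cmod (coord g (u # w)))\<^sup>2) summable_on UNIV" for g
  proof -
    have "(\<lambda>w. (cmod (coord g w))\<^sup>2) summable_on range ((#) u)"
      using coord_summable summable_on_subset_banach by blast
    then show ?thesis by (subst (asm) summable_on_reindex) (auto simp: o_def)
  qed
  have "cadjoint (lcreate u) = (\<lambda>g. Abs_fock (\<lambda>w. coord g (u # w)))"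
  proof (rule cadjointI)
    fix f g
    have "cinner (lcreate u f) g
        = (\<Sum>\<^sub>\<infinity>w\<in>range ((#) u). coord (lcreate u f) w * cnj (coord g w))"
      unfolding cinner_def
      by (rule infsum_cong_neutral) (auto simp: coord_lcreate image_iff, metis list.collapse)
    also have "\<dots> = (\<Sum>\<^sub>\<infinity>w. coord f w * cnj (coord g (u # w)))"
      by (subst infsum_reindex) (auto simp: o_def coord_lcreate)
    finally show "cinner (lcreate u f) g = cinner f (Abs_fock (\<lambda>w. coord g (u # w)))"
      by (simp add: cinner_def coord_Abs sq)
  qed
  then show ?thesis by (simp add: coord_Abs sq)
qed

definition tensor_power :: "nat \<Rightarrow> 'd fock set" where
  "tensor_power l = {f. \<forall>w. length w \<noteq> l \<longrightarrow> coord f w = 0}"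

definition ortho_proj :: "'d fock set \<Rightarrow> 'd fock \<Rightarrow> 'd fock" where
  "ortho_proj S f = (THE g. g \<in> S \<and> (\<forall>h\<in>S. cinner (f - g) h = 0))"

definition level_proj :: "nat \<Rightarrow> 'd fock \<Rightarrow> 'd fock" where
  "level_proj l = ortho_proj (tensor_power l)"

lemma coord_level_proj: "coord (level_proj l f) w = (if length w = l then coord f w else 0)"
proof -
  define g where "g = Abs_fock (\<lambda>w. if length w = l then coord f w else 0)"
  have g: "coord g w = (if length w = l then coord f w else 0)" for w
    unfolding g_def by (intro coord_Abs sqsum_mono[OF coord_summable[of f]]) auto
  have orth: "cinner (f - g) h = 0" if "h \<in> tensor_power l" for h
    unfolding cinner_def using that by (intro infsum_0) (auto simp: g tensor_power_def)
  have "level_proj l f = g"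
    unfolding level_proj_def ortho_proj_def
  proof (rule the_equality)
    show "g \<in> tensor_power l \<and> (\<forall>h\<in>tensor_power l. cinner (f - g) h = 0)"
      using orth by (auto simp: tensor_power_def g)
  next
    fix g' assume g': "g' \<in> tensor_power l \<and> (\<forall>h\<in>tensor_power l. cinner (f - g') h = 0)"
    then have "g - g' \<in> tensor_power l" by (auto simp: tensor_power_def g)
    then have "cinner (f - g') (g - g') - cinner (f - g) (g - g') = 0"
      using g' orth by simp
    then have "cinner (g - g') (g - g') = 0"
      by (simp flip: cinner_diff_left)
    then show "g' = g" using cinner_self_eq_0 by fastforce
  qed
  then show ?thesis by (simp add: g)
qed

text \<open>
  \<open>\<Sum>\<^bsub>l\<ge>1\<^esub> c\<^sup>l P\<^sub>l\<close>; the series converges in the strong operator topology when \<open>\<bar>c\<bar> \<le> 1\<close>.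
  Positivity of the state forces \<open>\<bar>c\<bar> \<le> 1\<close> for the covariances \<open>c\<close> to which it is applied.
\<close>

definition Delta :: "complex \<Rightarrow> 'd fock \<Rightarrow> 'd fock" where
  "Delta c f = (\<Sum>\<^sub>\<infinity>l\<in>{1..}. c ^ l *\<^sub>C level_proj l f)"

lemma tail_small:
  fixes p :: "'d list \<Rightarrow> real"
  assumes "p summable_on UNIV" "\<And>w. p w \<ge> 0" "e > 0"
  obtains X where "finite X" "\<And>Y. finite Y \<Longrightarrow> X \<subseteq> Y \<Longrightarrow> infsum p (UNIV - Y) < e"
proof -
  have "(sum p \<longlongrightarrow> infsum p UNIV) (finite_subsets_at_top UNIV)"
    using infsum_tendsto[OF assms(1)] .
  then have "\<forall>\<^sub>F X in finite_subsets_at_top UNIV. dist (sum p X) (infsum p UNIV) < e"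
    using assms(3) by (rule tendstoD)
  then obtain X where X: "finite X"
    "\<And>Y. finite Y \<Longrightarrow> X \<subseteq> Y \<Longrightarrow> dist (sum p Y) (infsum p UNIV) < e"
    unfolding eventually_finite_subsets_at_top by auto
  show thesis
  proof (rule that[OF X(1)])
    fix Y assume "finite Y" "X \<subseteq> Y"
    moreover have "infsum p UNIV = infsum p Y + infsum p (UNIV - Y)"
      using infsum_Un_disjoint[of p Y "UNIV - Y"] assms(1) summable_on_subset_banach
      by (metis Diff_disjoint Diff_partition subset_UNIV)
    ultimately show "infsum p (UNIV - Y) < e"
      using X(2)[of Y] by (auto simp: dist_real_def)
  qed
qed

lemma Delta_has_sum:
  assumes "cmod c \<le> 1"
  shows "((\<lambda>l. c ^ l *\<^sub>C level_proj l f) has_sum Delta c f) {1..}"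
    and "coord (Delta c f) w = (if w = [] then 0 else c ^ length w * coord f w)"
proof -
  define g where "g = Abs_fock (\<lambda>w. if w = [] then 0 else c ^ length w * coord f w)"
  have le: "cmod (c ^ k * z) \<le> cmod z" for k z
    using assms by (simp add: norm_mult norm_power mult_left_le_one_le power_le_one)
  have g: "coord g w = (if w = [] then 0 else c ^ length w * coord f w)" for w
    unfolding g_def by (intro coord_Abs sqsum_mono[OF coord_summable[of f]]) (auto simp: le)
  let ?p = "\<lambda>w. (cmod (coord f w))\<^sup>2"
  have "((\<lambda>l. c ^ l *\<^sub>C level_proj l f) has_sum g) {1..}"
    unfolding has_sum_def tendsto_iff eventually_finite_subsets_at_top
  proof (intro allI impI)
    fix e :: real assume "e > 0"
    obtain X where X: "finite X"
      "\<And>Y. finite Y \<Longrightarrow> X \<subseteq> Y \<Longrightarrow> infsum ?p (UNIV - Y) < e\<^sup>2"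
      using tail_small[of ?p "e\<^sup>2"] coord_summable[of f] \<open>e > 0\<close>
      by (metis zero_le_power2 zero_less_power)
    define L where "L = {1..} \<inter> length ` X"
    show "\<exists>X. finite X \<and> X \<subseteq> {1..} \<and> (\<forall>Y. finite Y \<and> X \<subseteq> Y \<and> Y \<subseteq> {1..} \<longrightarrow>
        dist (\<Sum>l\<in>Y. c ^ l *\<^sub>C level_proj l f) g < e)"
    proof (rule exI[of _ L], intro conjI allI impI)
      show "finite L" "L \<subseteq> {1..}" using X(1) by (auto simp: L_def)
      fix M assume M: "finite M \<and> L \<subseteq> M \<and> M \<subseteq> {1..}"
      let ?s = "\<Sum>l\<in>M. c ^ l *\<^sub>C level_proj l f"
      have s: "coord ?s w = (if length w \<in> M then c ^ length w * coord f w else 0)" for w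
      proof -
        have "coord ?s w = (\<Sum>l\<in>M. if l = length w then c ^ length w * coord f w else 0)"
          unfolding coord_sum by (intro sum.cong) (auto simp: coord_level_proj)
        then show ?thesis using M by simp
      qed
      have "(norm (?s - g))\<^sup>2 \<le> infsum ?p (UNIV - X)"
        unfolding norm_fock_sq
      proof (rule infsum_mono_neutral)
        show "(\<lambda>w. (cmod (coord (?s - g) w))\<^sup>2) summable_on UNIV" by (rule coord_summable)
        show "?p summable_on UNIV - X" using coord_summable summable_on_subset_banach by blast
      next
        fix w
        have "cmod (coord (?s - g) w) \<le> cmod (coord f w)"
          using le by (auto simp: s g)
        then show "(cmod (coord (?s - g) w))\<^sup>2 \<le> ?p w" by (simp add: power_mono)
      next
        fix w assume "w \<in> UNIV - (UNIV - X)"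
        then have "w = [] \<or> length w \<in> L" by (cases "w = []") (auto simp: L_def Suc_le_eq)
        moreover have "length w \<notin> M" if "w = []" using M that by auto
        ultimately show "(cmod (coord (?s - g) w))\<^sup>2 \<le> 0" using M by (auto simp: s g)
      qed auto
      also have "\<dots> < e\<^sup>2" using X by auto
      finally show "dist ?s g < e"
        using \<open>e > 0\<close> by (simp add: dist_norm power_less_imp_less_base)
    qed
  qed
  then have eq: "Delta c f = g" and hs: "((\<lambda>l. c ^ l *\<^sub>C level_proj l f) has_sum g) {1..}"
    unfolding Delta_def by (auto intro: infsumI)
  show "((\<lambda>l. c ^ l *\<^sub>C level_proj l f) has_sum Delta c f) {1..}" using hs eq by simp
  show "coord (Delta c f) w = (if w = [] then 0 else c ^ length w * coord f w)"
    by (simp add: eq g)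
qed

definition vac_state :: "('d fock \<Rightarrow> 'd fock) \<Rightarrow> complex" where
  "vac_state T = cinner (T \<Omega>) \<Omega>"

lemma vac_state_coord: "vac_state T = coord (T \<Omega>) []"
  by (simp add: vac_state_def vacuum_def cinner_basis_vec_right)

definition lannihilate :: "'d \<Rightarrow> 'd fock \<Rightarrow> 'd fock" where
  "lannihilate u = cadjoint (lcreate u)"

definition semicirc :: "'d \<Rightarrow> 'd fock \<Rightarrow> 'd fock" where
  "semicirc u f = lcreate u f + lannihilate u f"

text \<open>
  The monomial \<open>X\<^bsub>z\<^sub>1\<^esub> \<cdots> X\<^bsub>z\<^sub>r\<^esub>\<close> is the word \<open>[z\<^sub>1, \<dots>, z\<^sub>r]\<close>; its degree is the length of
  the word.  Letter positions are counted from 1.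
\<close>

type_synonym 'd monomial = "'d list"

definition letter :: "'d monomial \<Rightarrow> nat \<Rightarrow> 'd" where
  "letter A k = A ! (k - 1)"

definition piece_oc :: "'d monomial \<Rightarrow> nat \<Rightarrow> nat \<Rightarrow> 'd monomial" where
  "piece_oc A u v = map (letter A) [u + 1..<v + 1]"

definition piece_oo :: "'d monomial \<Rightarrow> nat \<Rightarrow> nat \<Rightarrow> 'd monomial" where
  "piece_oo A u v = map (letter A) [u + 1..<v]"

definition eval_alg :: "('d \<Rightarrow> 'a::monoid_mult) \<Rightarrow> 'd monomial \<Rightarrow> 'a" where
  "eval_alg x A = prod_list (map x A)"

definition eval_fock :: "'d monomial \<Rightarrow> 'd fock \<Rightarrow> 'd fock" where
  "eval_fock A = foldr (\<circ>) (map semicirc A) id"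

definition circ_interval :: "nat \<Rightarrow> nat \<Rightarrow> nat \<Rightarrow> nat set" where
  "circ_interval n k l = (if k \<le> l then {k..l} else {k..n} \<union> {1..l})"

definition configurations :: "nat \<Rightarrow> nat set set set" where
  "configurations n = {K. K \<subseteq> {{i, j} |i j. i \<in> {1..n} \<and> j \<in> {1..n} \<and> i \<noteq> j} \<and>
     (\<forall>i j k l. {i, j} \<in> K \<longrightarrow> {k, l} \<in> K \<longrightarrow>
        {i, j} \<subseteq> circ_interval n k l \<or> {i, j} \<subseteq> circ_interval n l k)}"

lemma finite_configurations: "finite (configurations n)"
  by (rule finite_subset[of _ "Pow (Pow {1..n})"]) (auto simp: configurations_def)

definition unpaired :: "nat \<Rightarrow> nat set set \<Rightarrow> nat set" where
  "unpaired n K = {i \<in> {1..n}. i \<notin> \<Union>K}"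

text \<open>
  Cyclically ordered finite sets are distinct lists in which the successor of an entry is the next
  entry, and the successor of the last entry is the first one.
\<close>

definition cyc_succ :: "'b list \<Rightarrow> 'b \<Rightarrow> 'b" where
  "cyc_succ c a = the (map_of (zip c (rotate1 c)) a)"

definition cyc_pred :: "'b list \<Rightarrow> 'b \<Rightarrow> 'b" where
  "cyc_pred c a = the (map_of (zip (rotate1 c) c) a)"

text \<open>
  \<open>[i..<n + 1] @ [1..<i]\<close> enumerates \<open>[1,n]\<close> in the cyclic order starting at \<open>i\<close>; the filtered
  list is \<open>k\<^sub>1, \<dots>, k\<^sub>m\<close>.
\<close>

definition cyc_C :: "nat \<Rightarrow> nat set set \<Rightarrow> nat \<Rightarrow> nat list" where
  "cyc_C n K i = rev (filter (\<lambda>j. j = i \<or> {i, j} \<in> K) ([i..<n + 1] @ [1..<i]))"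

definition C_succ :: "nat \<Rightarrow> nat set set \<Rightarrow> nat \<Rightarrow> nat \<Rightarrow> nat" where
  "C_succ n K i j = cyc_succ (cyc_C n K i) j"

definition C_pred :: "nat \<Rightarrow> nat set set \<Rightarrow> nat \<Rightarrow> nat \<Rightarrow> nat" where
  "C_pred n K i j = cyc_pred (cyc_C n K i) j"

definition cyc_Css :: "nat \<Rightarrow> nat set set \<Rightarrow> nat \<Rightarrow> nat list" where
  "cyc_Css n K i = filter (\<lambda>j. j \<noteq> i \<and> j \<noteq> C_pred n K i i) (cyc_C n K i)"

text \<open>
  The families \<open>(k\<^sub>i\<^sub>,\<^sub>j)\<close>, \<open>i \<in> [1,n]\<close>, \<open>j \<in> C\<^sub>i\<^sup>*\<^sup>*(K)\<close>: functions that are \<open>undefined\<close> off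
  these index pairs, so that each family is counted once.  The entries are positive, hence natural
  numbers.
\<close>

definition index_families ::
    "nat \<Rightarrow> nat set set \<Rightarrow> (nat \<Rightarrow> 'd monomial) \<Rightarrow> (nat \<times> nat \<Rightarrow> nat) set" where
  "index_families n K A =
     {k \<in> extensional {(i, j). i \<in> {1..n} \<and> j \<in> set (cyc_Css n K i)}.
        \<forall>i\<in>{1..n}. cyc_Css n K i \<noteq> [] \<longrightarrow>
          sorted_wrt (<) ([0] @ map (\<lambda>j. k (i, j)) (cyc_Css n K i) @ [length (A i)])}"

lemma finite_index_families: "finite (index_families n K A)"
proof (rule finite_subset)
  let ?I = "Sigma {1..n} (\<lambda>i. set (cyc_Css n K i))"
  show "index_families n K A \<subseteq> Pi\<^sub>E ?I (\<lambda>(i, j). {..length (A i)})"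
  proof
    fix k assume k: "k \<in> index_families n K A"
    have "k (i, j) \<le> length (A i)" if "i \<in> {1..n}" "j \<in> set (cyc_Css n K i)" for i j
      using k that unfolding index_families_def
      by (fastforce simp: sorted_wrt_append)
    moreover have "?I = {(i, j). i \<in> {1..n} \<and> j \<in> set (cyc_Css n K i)}" by auto
    ultimately show "k \<in> Pi\<^sub>E ?I (\<lambda>(i, j). {..length (A i)})"
      using k by (auto simp: PiE_def index_families_def)
  qed
  show "finite (Pi\<^sub>E ?I (\<lambda>(i, j). {..length (A i)}))"
    by (intro finite_PiE) auto
qed

definition extend_index ::
    "nat \<Rightarrow> nat set set \<Rightarrow> (nat \<Rightarrow> 'd monomial) \<Rightarrow> (nat \<times> nat \<Rightarrow> nat) \<Rightarrow> nat \<Rightarrow> nat \<Rightarrow> nat" where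
  "extend_index n K A k i j =
     (if cyc_C n K i \<noteq> [i] \<and> j = i then 0
      else if cyc_C n K i \<noteq> [i] \<and> j = C_pred n K i i then length (A i)
      else k (i, j))"

definition T_term ::
    "nat \<Rightarrow> nat set set \<Rightarrow> (nat \<Rightarrow> 'd monomial) \<Rightarrow> (nat set \<Rightarrow> complex) \<Rightarrow> (nat \<times> nat \<Rightarrow> nat) \<Rightarrow>
       nat \<Rightarrow> nat \<Rightarrow> complex" where
  "T_term n K A \<kappa> k' i j =
    (let k = extend_index n K A k';
         a = k i (C_pred n K i j); b = k i j;
         a' = k j (C_pred n K j i); b' = k j i;
         D = Delta (\<kappa> {i, j})
     in if j = C_pred n K i i \<and> i = C_pred n K j j then
          vac_state (eval_fock (piece_oc (A i) a b) \<circ> D \<circ> eval_fock (piece_oc (A j) a' b'))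
        else if j \<noteq> C_pred n K i i \<and> i = C_pred n K j j then
          vac_state (eval_fock (piece_oo (A i) a b) \<circ> lannihilate (letter (A i) b) \<circ> D \<circ>
            eval_fock (piece_oc (A j) a' b'))
        else if j = C_pred n K i i \<and> i \<noteq> C_pred n K j j then
          vac_state (eval_fock (piece_oc (A i) a b) \<circ> D \<circ> rcreate (letter (A j) b') \<circ>
            eval_fock (piece_oo (A j) a' b'))
        else
          vac_state (eval_fock (piece_oo (A i) a b) \<circ> lannihilate (letter (A i) b) \<circ> D \<circ>
            rcreate (letter (A j) b') \<circ> eval_fock (piece_oo (A j) a' b')))"

end

theory Submission
  imports Defs
begin

text \<open>The cuts have to make the decomposition of the \<open>i\<close>-th word into its factors
  \<open>v i j\<close> unique. Between the last letter of one factor and the first letter of the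
  next there may be letters of \<open>A i\<close> that are paired among themselves, so a cut placed
  freely in that gap would count the same pairing several times. Cutting right after the last letter
  of a factor removes this freedom, at the price that every piece of \<open>A i\<close> except the
  last one must end in an unpaired letter. This constraint is \<open>owick\<close>, and it is what
  replacing the last letter of a piece by \<open>lannihilate\<close> or \<open>rcreate\<close>
  expresses; the last piece simply runs to the end of \<open>A i\<close>.

  Each \<open>T_term\<close> then becomes a sum over words \<open>u\<close> of
  \<open>\<kappa> {i, j} ^ length u\<close> times an amplitude of a piece of \<open>A i\<close> and
  one of a piece of \<open>A j\<close>. The product over pairs can thus be regrouped by monomials,
  and the sum over the cuts factors. Reading \<open>Delta\<close> as a diagonal operator needs
  covariances of modulus at most 1, which positivity of the state provides.\<close>

text \<open>
  A noncrossing pairing is read off by a machine that scans the letters from left to right, and either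
  pushes the current letter on a stack or pairs it with the top of the stack.  Running the machine
  through one monomial \<open>A\<^sub>i\<close> pairs some of its letters among themselves, with weight 1, and leaves a
  word \<open>w\<close>; the number \<open>wick A\<^sub>i w\<close> of ways to do this is also the coordinate of \<open>A\<^sub>i(x)\<Omega>\<close> at
  \<open>e\<^sub>w\<close>.  The remaining pairs link different words, and are described by the words \<open>v i j\<close> of those
  letters of the \<open>i\<close>-th word that are paired with letters of the \<open>j\<close>-th one: \<open>v j i\<close> is the reversal
  of \<open>v i j\<close>, the \<open>i\<close>-th word is the concatenation of the \<open>v i j\<close> with \<open>j = i - 1, \<dots>, 1, n, \<dots>, i + 1\<close>,
  and no two links cross, that is, the pairs \<open>{i, j}\<close> with \<open>v i j \<noteq> []\<close> form a configuration \<open>K\<close>.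
  Both sides of the formula are the sum over all these \<open>v\<close> of the products of
  \<open>\<kappa>\<^bsub>{i,j}\<^esub>\<close> to the power \<open>length (v i j)\<close> and of \<open>wick A\<^sub>i\<close> at the \<open>i\<close>-th word.  For the right-hand
  side, the cut \<open>k\<^sub>i\<^sub>,\<^sub>j\<close> is the position in \<open>A\<^sub>i\<close> of the last letter of \<open>v i j\<close>.
\<close>

section \<open>Coordinates of monomials applied to the vacuum\<close>

fun wick :: "'d list \<Rightarrow> 'd list \<Rightarrow> complex" where
  "wick [] w = (if w = [] then 1 else 0)"
| "wick (a # A) w = (if w \<noteq> [] \<and> hd w = a then wick A (tl w) else 0) + wick A (a # w)"

lemma eval_fock_Nil [simp]: "eval_fock [] f = f"
  by (simp add: eval_fock_def)

lemma eval_fock_Cons [simp]: "eval_fock (a # A) f = semicirc a (eval_fock A f)"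
  by (simp add: eval_fock_def)

lemma eval_fock_append: "eval_fock (A @ B) f = eval_fock A (eval_fock B f)"
  by (induction A) auto

lemma coord_semicirc:
  "coord (semicirc a f) w = (if w \<noteq> [] \<and> hd w = a then coord f (tl w) else 0) + coord f (a # w)"
  by (simp add: semicirc_def lannihilate_def coord_lcreate coord_cadjoint_lcreate)

lemma coord_eval_fock_vacuum: "coord (eval_fock A \<Omega>) w = wick A w"
  by (induction A arbitrary: w) (auto simp: coord_semicirc vacuum_def coord_basis_vec)

lemma wick_eq_0: "length A < length w \<Longrightarrow> wick A w = 0"
  by (induction A arbitrary: w) auto

lemma wick_nonzero_length: "wick A w \<noteq> 0 \<Longrightarrow> length w \<le> length A"
  using wick_eq_0 not_le by blast

text \<open>The count is symmetric under reading from the right: the last letter either stays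
  unpaired, and then ends \<open>w\<close>, or is paired with the last unpaired letter of
  \<open>A\<close>. The defining recursion only sees the first letter, so this form is what
  inductions from the right rely on.\<close>

lemma wick_snoc:
  "wick (A @ [a]) w = (if w \<noteq> [] \<and> last w = a then wick A (butlast w) else 0) + wick A (w @ [a])"
proof (induction A arbitrary: w)
  case Nil
  then show ?case by (cases w rule: rev_cases) auto
next
  case (Cons x A)
  show ?case
  proof (cases w)
    case Nil
    then show ?thesis using Cons.IH[of "[x]"] by simp
  next
    case w: (Cons y w')
    show ?thesis
    proof (cases "w' = []")
      case True
      then show ?thesis using w Cons.IH[of "[]"] Cons.IH[of "[x, y]"] by simp
    next
      case False
      then show ?thesis using w Cons.IH[of w'] Cons.IH[of "x # w"] by (simp add: algebra_simps)
    qed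
  qed
qed

text \<open>Coefficients \<open>wick A w\<close> vanish for words longer than \<open>A\<close>.
  Truncating at a bound \<open>N\<close> of the degrees therefore loses nothing and keeps all sums
  over words finite.\<close>

definition words :: "nat \<Rightarrow> 'd list set" where
  "words N = {w. length w \<le> N}"

lemma finite_words [simp]: "finite (words N :: 'd::finite list set)"
  using finite_lists_length_le[of "UNIV :: 'd set" N] by (simp add: words_def)

lemma mem_words [simp]: "w \<in> words N \<longleftrightarrow> length w \<le> N"
  by (simp add: words_def)

text \<open>Adjointness of creation and annihilation on the truncated words. Prepending
  \<open>a\<close> to a word of length \<open>N\<close> leaves the truncation, which is why
  \<open>f\<close> has to vanish there.\<close>

lemma sum_words_Cons:
  fixes f :: "'d::finite list \<Rightarrow> complex"
  assumes "\<And>w. length w = N \<Longrightarrow> f w = 0"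
  shows "(\<Sum>w\<in>words N. if w \<noteq> [] \<and> hd w = a then f (tl w) * g w else 0) = (\<Sum>w\<in>words N. f w * g (a # w))"
proof -
  have "(\<Sum>w\<in>words N. if w \<noteq> [] \<and> hd w = a then f (tl w) * g w else 0)
      = (\<Sum>w\<in>{w\<in>words N. w \<noteq> [] \<and> hd w = a}. f (tl w) * g w)"
    by (rule sum.mono_neutral_cong_right) auto
  also have "\<dots> = (\<Sum>w\<in>{w\<in>words N. length w < N}. f w * g (a # w))"
    by (rule sum.reindex_bij_witness[of _ "(#) a" tl]) (auto simp: neq_Nil_conv)
  also have "\<dots> = (\<Sum>w\<in>words N. f w * g (a # w))"
    using assms by (intro sum.mono_neutral_left) auto
  finally show ?thesis .
qed

text \<open>The left-hand side is the inner product of \<open>eval_fock P f\<close> with the vacuum.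
  Self-adjointness of the letters moves \<open>P\<close> to the vacuum in reversed order, and
  reversing a monomial reverses the words in its coefficients; hence \<open>rev u\<close>.\<close>

lemma coord_eval_fock_Nil:
  fixes P :: "'d::finite list"
  assumes "length P \<le> N"
  shows "coord (eval_fock P f) [] = (\<Sum>u\<in>words N. wick P (rev u) * coord f u)"
  using assms
proof (induction P arbitrary: f rule: rev_induct)
  case Nil
  have "(\<Sum>u\<in>words N. wick [] (rev u) * coord f u) = (\<Sum>u\<in>words N. if u = [] then coord f u else 0)"
    by (intro sum.cong) auto
  also have "\<dots> = coord f []"
    by (subst sum.delta) auto
  finally show ?case by simp
next
  case (snoc a P)
  have "coord (eval_fock (P @ [a]) f) [] = (\<Sum>u\<in>words N. wick P (rev u) * coord (semicirc a f) u)"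
    using snoc by (simp add: eval_fock_append)
  also have "\<dots> = (\<Sum>u\<in>words N. if u \<noteq> [] \<and> hd u = a then coord f (tl u) * wick P (rev u) else 0)
       + (\<Sum>u\<in>words N. wick P (rev u) * coord f (a # u))"
    unfolding sum.distrib[symmetric]
    by (intro sum.cong) (auto simp: coord_semicirc distrib_left)
  also have "(\<Sum>u\<in>words N. wick P (rev u) * coord f (a # u)) =
      (\<Sum>u\<in>words N. if u \<noteq> [] \<and> hd u = a then wick P (rev (tl u)) * coord f u else 0)"
    using snoc.prems by (intro sum_words_Cons[symmetric]) (simp add: wick_eq_0)
  also have "(\<Sum>u\<in>words N. if u \<noteq> [] \<and> hd u = a then coord f (tl u) * wick P (rev u) else 0) =
     (\<Sum>u\<in>{w\<in>words N. w \<noteq> [] \<and> hd w = a}. coord f (tl u) * wick P (rev u))"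
    by (rule sum.mono_neutral_cong_right) auto
  also have "\<dots> = (\<Sum>w\<in>{w\<in>words N. length w < N}. wick P (rev w @ [a]) * coord f w)"
    by (rule sum.reindex_bij_witness[of _ "(#) a" tl]) (auto simp: neq_Nil_conv)
  also have "\<dots> = (\<Sum>w\<in>words N. wick P (rev w @ [a]) * coord f w)"
    using snoc.prems by (intro sum.mono_neutral_left) (auto dest: wick_nonzero_length)
  also have "(\<Sum>w\<in>words N. wick P (rev w @ [a]) * coord f w)
     + (\<Sum>u\<in>words N. if u \<noteq> [] \<and> hd u = a then wick P (rev (tl u)) * coord f u else 0)
     = (\<Sum>u\<in>words N. wick (P @ [a]) (rev u) * coord f u)"
    unfolding sum.distrib[symmetric]
    by (intro sum.cong) (auto simp: wick_snoc last_rev distrib_right butlast_rev)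
  finally show ?case .
qed

text \<open>The case of \<open>wick\<close> in which the last letter of \<open>P\<close> is left unpaired.\<close>

definition owick :: "'d list \<Rightarrow> 'd list \<Rightarrow> complex" where
  "owick P w = (if w \<noteq> [] \<and> last w = last P then wick (butlast P) (butlast w) else 0)"

lemma owick_Cons:
  "P \<noteq> [] \<Longrightarrow> v \<noteq> [] \<Longrightarrow>
    owick (a # P) v = (if hd v = a then owick P (tl v) else 0) + owick P (a # v)"
  by (cases v) (auto simp: owick_def)

text \<open>Here \<open>Suc b\<close> is the position in \<open>A\<close> of the last letter of
  \<open>v\<close>. Letters between it and the first letter of \<open>u\<close> are paired among
  themselves and counted with \<open>u\<close>, so every pairing has exactly one cut.\<close>

lemma wick_append:
  assumes "v \<noteq> []" "u \<noteq> []"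
  shows "wick A (v @ u) = (\<Sum>b<length A. owick (take (Suc b) A) v * wick (drop (Suc b) A) u)"
  using assms
proof (induction A arbitrary: v)
  case Nil
  then show ?case by simp
next
  case (Cons a A)
  \<comment> \<open>If the head letter \<open>a\<close> is all of \<open>v\<close>, the cut comes
    directly after it, which gives the term with \<open>owick [a] v\<close>; otherwise the cut lies
    inside \<open>A\<close>.\<close>
  have first: "(if hd v = a then wick A (tl v @ u) else 0) =
     owick [a] v * wick A u + (if hd v = a then
       (\<Sum>b<length A. owick (take (Suc b) A) (tl v) * wick (drop (Suc b) A) u) else 0)"
  proof (cases "tl v = []")
    case True
    then obtain x where "v = [x]" using Cons.prems by (cases v) auto
    then show ?thesis by (auto simp: owick_def)
  next
    case False
    moreover from this have "owick [a] v = 0" by (cases v) (auto simp: owick_def)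
    ultimately show ?thesis using Cons.IH[of "tl v"] Cons.prems by simp
  qed
  have "wick (a # A) (v @ u) = (if hd v = a then wick A (tl v @ u) else 0) + wick A ((a # v) @ u)"
    using Cons.prems by simp
  also have "\<dots> = owick [a] v * wick A u + ((if hd v = a then
       (\<Sum>b<length A. owick (take (Suc b) A) (tl v) * wick (drop (Suc b) A) u) else 0)
       + (\<Sum>b<length A. owick (take (Suc b) A) (a # v) * wick (drop (Suc b) A) u))"
    unfolding first using Cons.IH[of "a # v"] Cons.prems by simp
  also have "\<dots> = owick [a] v * wick A u +
      (\<Sum>b<length A. ((if hd v = a then owick (take (Suc b) A) (tl v) else 0) +
        owick (take (Suc b) A) (a # v)) * wick (drop (Suc b) A) u)"
    by (simp add: distrib_right sum.distrib)
  also have "\<dots> = owick [a] v * wick A u +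
      (\<Sum>b<length A. owick (a # take (Suc b) A) v * wick (drop (Suc b) A) u)"
    using Cons.prems by (intro arg_cong2[of _ _ _ _ "(+)"] sum.cong refl, subst owick_Cons) auto
  also have "\<dots> = (\<Sum>b<length (a # A). owick (take (Suc b) (a # A)) v * wick (drop (Suc b) (a # A)) u)"
    by (simp add: sum.lessThan_Suc_shift del: sum.lessThan_Suc)
  finally show ?case .
qed

section \<open>The stack machine\<close>

text \<open>The head of \<open>s\<close> is the top of the stack.\<close>

fun stk :: "('b \<Rightarrow> 'b \<Rightarrow> complex) \<Rightarrow> 'b list \<Rightarrow> 'b list \<Rightarrow> complex" where
  "stk c s [] = (if s = [] then 1 else 0)"
| "stk c s (y # ys) = stk c (y # s) ys + (case s of [] \<Rightarrow> 0 | b # s' \<Rightarrow> c b y * stk c s' ys)"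

text \<open>
  The word \<open>w\<close>, tagged with \<open>t\<close>, is run through the machine without pairing its letters with each other:
  an initial segment is paired with the top of the stack, and the rest is pushed.
\<close>

fun wpop :: "('b \<times> 'd \<Rightarrow> 'b \<times> 'd \<Rightarrow> complex) \<Rightarrow> 'b \<Rightarrow> (('b \<times> 'd) list \<Rightarrow> complex) \<Rightarrow>
    ('b \<times> 'd) list \<Rightarrow> 'd list \<Rightarrow> complex" where
  "wpop c t f s [] = f s"
| "wpop c t f s (a # w) = f (rev (map (Pair t) (a # w)) @ s) +
     (case s of [] \<Rightarrow> 0 | b # s' \<Rightarrow> c b (t, a) * wpop c t f s' w)"

text \<open>Passing from \<open>A\<close> to \<open>a # A\<close> applies a symmetric operator to
  the coefficients. Here it is transferred to the test function \<open>g\<close>, where it reads: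
  keep \<open>a\<close> in front of the word, or let it cancel an equal first letter.\<close>

lemma sum_wick_Cons:
  fixes A :: "'d::finite list"
  assumes "length A < N"
  shows "(\<Sum>w\<in>words N. wick (a # A) w * g w) =
    (\<Sum>w\<in>words N. wick A w * (g (a # w) + (case w of [] \<Rightarrow> 0 | b # w' \<Rightarrow> if b = a then g w' else 0)))"
proof -
  have "(\<Sum>w\<in>words N. wick (a # A) w * g w) =
     (\<Sum>w\<in>words N. if w \<noteq> [] \<and> hd w = a then wick A (tl w) * g w else 0) +
     (\<Sum>w\<in>words N. wick A (a # w) * g w)"
    unfolding sum.distrib[symmetric] by (intro sum.cong) (auto simp: distrib_right)
  also have "(\<Sum>w\<in>words N. if w \<noteq> [] \<and> hd w = a then wick A (tl w) * g w else 0) =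
      (\<Sum>w\<in>words N. wick A w * g (a # w))"
    using assms by (intro sum_words_Cons) (simp add: wick_eq_0)
  also have "(\<Sum>w\<in>words N. wick A (a # w) * g w) =
      (\<Sum>w\<in>words N. if w \<noteq> [] \<and> hd w = a then g (tl w) * wick A w else 0)"
  proof -
    have "(\<Sum>w\<in>words N. if w \<noteq> [] \<and> hd w = a then g (tl w) * wick A w else 0) =
       (\<Sum>u\<in>{w\<in>words N. w \<noteq> [] \<and> hd w = a}. g (tl u) * wick A u)"
      by (rule sum.mono_neutral_cong_right) auto
    also have "\<dots> = (\<Sum>w\<in>{w\<in>words N. length w < N}. g w * wick A (a # w))"
      by (rule sum.reindex_bij_witness[of _ "(#) a" tl]) (auto simp: neq_Nil_conv)
    also have "\<dots> = (\<Sum>w\<in>words N. g w * wick A (a # w))"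
      using assms by (intro sum.mono_neutral_left) (auto dest: wick_nonzero_length)
    finally show ?thesis by (simp add: mult.commute)
  qed
  finally show ?thesis
    unfolding sum.distrib[symmetric]
    by (rule trans) (rule sum.cong[OF refl], auto simp: distrib_left split: list.split)
qed

text \<open>Separates the pairings inside one monomial, of total number \<open>wick A w\<close>,
  from what its unpaired letters \<open>w\<close> do with the older stack.\<close>

lemma stk_wick:
  fixes A :: "'d::finite list"
  assumes "\<And>a b. c (t, a) (t, b) = (if a = b then 1 else 0)" "length A \<le> N"
  shows "stk c s (map (Pair t) A @ ys) = (\<Sum>w\<in>words N. wick A w * wpop c t (\<lambda>s. stk c s ys) s w)"
  using assms(2)
proof (induction A arbitrary: s)
  case Nil
  have "(\<Sum>w\<in>words N. wick [] w * wpop c t (\<lambda>s. stk c s ys) s w) =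
      (\<Sum>w\<in>words N. if w = [] then wpop c t (\<lambda>s. stk c s ys) s w else 0)"
    by (intro sum.cong) auto
  also have "\<dots> = stk c s ys"
    by (subst sum.delta) auto
  finally show ?case by simp
next
  case (Cons a A)
  let ?f = "\<lambda>s. stk c s ys"
  \<comment> \<open>A pushed \<open>(t, a)\<close> is either popped by the first letter of
    \<open>w\<close>, which is a pairing inside the monomial, or it stays, and then all of
    \<open>w\<close> is stacked above it. Both sides enumerate these cases together with the one
    where \<open>a\<close> pops the old top.\<close>
  have step: "wpop c t ?f ((t, a) # s) w + (case s of [] \<Rightarrow> 0 | b # s' \<Rightarrow> c b (t, a) * wpop c t ?f s' w) =
      wpop c t ?f s (a # w) + (case w of [] \<Rightarrow> 0 | b # w' \<Rightarrow> if b = a then wpop c t ?f s w' else 0)" for w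
    by (cases w) (auto simp: assms(1))
  have "stk c s (map (Pair t) (a # A) @ ys) = stk c ((t, a) # s) (map (Pair t) A @ ys) +
      (case s of [] \<Rightarrow> 0 | b # s' \<Rightarrow> c b (t, a) * stk c s' (map (Pair t) A @ ys))"
    by simp
  also have "\<dots> = (\<Sum>w\<in>words N. wick A w * (wpop c t ?f ((t, a) # s) w +
      (case s of [] \<Rightarrow> 0 | b # s' \<Rightarrow> c b (t, a) * wpop c t ?f s' w)))"
    using Cons by (cases s) (auto simp: distrib_left sum.distrib sum_distrib_left algebra_simps)
  also have "\<dots> = (\<Sum>w\<in>words N. wick (a # A) w * wpop c t ?f s w)"
    unfolding step using Cons.prems by (subst sum_wick_Cons) auto
  finally show ?case .
qed

section \<open>Noncrossing pairings and the stack machine\<close>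

definition noncrossing :: "nat set set \<Rightarrow> bool" where
  "noncrossing \<pi> \<longleftrightarrow>
     \<not> (\<exists>B\<in>\<pi>. \<exists>B'\<in>\<pi>. \<exists>p\<in>B. \<exists>q\<in>B. \<exists>p'\<in>B'. \<exists>q'\<in>B'. p < p' \<and> p' < q \<and> q < q')"

text \<open>
  For the elements of \<open>S\<close> below the scanning position, \<open>U\<close> is the set of those which are on the stack.
\<close>

definition ncp :: "nat set \<Rightarrow> nat set \<Rightarrow> nat set set set" where
  "ncp S U = {\<pi>. partition_on S \<pi> \<and> (\<forall>B\<in>\<pi>. card B = 2 \<and> \<not> B \<subseteq> U) \<and> noncrossing \<pi>}"

lemma noncrossingD:
  assumes "noncrossing \<pi>" "B \<in> \<pi>" "B' \<in> \<pi>" "p \<in> B" "q \<in> B" "p' \<in> B'" "q' \<in> B'" "p < p'" "p' < q"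
  shows "\<not> q < q'"
  using assms unfolding noncrossing_def by fast

lemma
  assumes "\<pi> \<in> ncp S U"
  shows ncp_partition: "partition_on S \<pi>"
    and ncp_card: "B \<in> \<pi> \<Longrightarrow> card B = 2"
    and ncp_not_subset: "B \<in> \<pi> \<Longrightarrow> \<not> B \<subseteq> U"
    and ncp_noncrossing: "noncrossing \<pi>"
  using assms unfolding ncp_def by auto

lemma ncpI:
  assumes "partition_on S \<pi>" "\<And>B. B \<in> \<pi> \<Longrightarrow> card B = 2" "\<And>B. B \<in> \<pi> \<Longrightarrow> \<not> B \<subseteq> U" "noncrossing \<pi>"
  shows "\<pi> \<in> ncp S U"
  using assms unfolding ncp_def by blast

lemma noncrossing_subset: "noncrossing \<pi> \<Longrightarrow> \<pi>' \<subseteq> \<pi> \<Longrightarrow> noncrossing \<pi>'"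
  unfolding noncrossing_def by (meson subsetD)

lemma ncp_restrict:
  assumes "\<pi> \<in> ncp S U" "\<And>B. B \<in> \<pi> \<Longrightarrow> \<not> B \<subseteq> U'"
  shows "\<pi> \<in> ncp S U'"
  using assms unfolding ncp_def by simp

lemma NCP_eq_ncp: "NCP k = ncp {1..k} {}"
proof -
  have "card B = 2 \<Longrightarrow> B \<noteq> {}" for B :: "nat set" by auto
  then show ?thesis unfolding NCP_def ncp_def noncrossing_def[symmetric] by auto
qed

lemma ncp_finite: "finite S \<Longrightarrow> finite (ncp S U)"
  by (rule finite_subset[of _ "Pow (Pow S)"]) (auto simp: ncp_def partition_on_def)

lemma ncp_self: "ncp S S = (if S = {} then {{}} else {})"
proof -
  have "\<not> partition_on S \<pi>" if "S \<noteq> {}" "\<forall>B\<in>\<pi>. \<not> B \<subseteq> S" for \<pi>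
    using that by (auto simp: partition_on_def)
  then show ?thesis by (cases "S = {}") (auto simp: ncp_def partition_on_empty noncrossing_def)
qed

lemma ncp_mono:
  assumes "U \<subseteq> U'"
  shows "ncp S U' \<subseteq> ncp S U"
proof
  fix \<pi> assume \<pi>: "\<pi> \<in> ncp S U'"
  show "\<pi> \<in> ncp S U"
  proof (rule ncp_restrict[OF \<pi>])
    show "\<not> B \<subseteq> U" if "B \<in> \<pi>" for B
      using ncp_not_subset[OF \<pi> that] assms by blast
  qed
qed

lemma card2_in:
  assumes "card B = 2" "a \<in> B"
  obtains b where "b \<noteq> a" "B = {a, b}"
proof -
  obtain x y where "B = {x, y}" "x \<noteq> y" using assms(1) by (auto simp: card_2_iff)
  then show thesis using assms(2) that[of y] that[of x] by (cases "a = x") (auto simp: insert_commute)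
qed

text \<open>A block inside \<open>insert t U\<close> contains \<open>t\<close>, since none lies
  inside \<open>U\<close>. If the partner of \<open>t\<close> were below the top \<open>m\<close>,
  then \<open>m\<close> would have to be paired beyond \<open>t\<close>, and the two blocks would
  cross.\<close>

lemma ncp_closing_block:
  fixes S :: "nat set"
  assumes \<pi>: "\<pi> \<in> ncp S U" "\<pi> \<notin> ncp S (insert t U)"
    and S: "t \<in> S" "U \<subseteq> S" "\<And>b. b \<in> U \<Longrightarrow> b < t" "\<And>b. b \<in> S \<Longrightarrow> b \<notin> U \<Longrightarrow> t \<le> b"
    and m: "m \<in> U" "\<And>b. b \<in> U \<Longrightarrow> b \<le> m"
  shows "{m, t} \<in> \<pi>"
proof -
  have part: "\<Union>\<pi> = S"
    using ncp_partition[OF \<pi>(1)] by (simp add: partition_on_def)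
  have disj: "B = B'" if "B \<in> \<pi>" "B' \<in> \<pi>" "x \<in> B" "x \<in> B'" for B B' x
    using ncp_partition[OF \<pi>(1)] that by (auto simp: partition_on_def disjoint_def)
  note crd = ncp_card[OF \<pi>(1)] ncp_not_subset[OF \<pi>(1)]
  obtain B where B: "B \<in> \<pi>" "B \<subseteq> insert t U"
    using ncp_restrict[OF \<pi>(1), of "insert t U"] \<pi>(2) by blast
  then have "t \<in> B" using crd by blast
  then obtain b where b: "b \<noteq> t" "B = {t, b}" by (rule card2_in[OF crd(1)[OF B(1)]])
  then have bU: "b \<in> U" using B by auto
  show ?thesis
  proof (cases "b = m")
    case True
    then show ?thesis using B b by (simp add: insert_commute)
  next
    case False
    then have bm: "b < m" using m(2)[OF bU] by simp
    obtain B' where B': "B' \<in> \<pi>" "m \<in> B'" using part m(1) S(2) by blast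
    obtain q where q: "q \<noteq> m" "B' = {m, q}" by (rule card2_in[OF crd(1)[OF B'(1)] B'(2)])
    then have "q \<notin> U" using crd(2)[OF B'(1)] m(1) by auto
    moreover have "q \<in> S" using part B'(1) q by auto
    moreover have "q \<noteq> t" using disj[OF B'(1) B(1), of t] q b False S(3)[OF m(1)] by auto
    ultimately have "t < q" using S(4)[of q] by simp
    then have False using noncrossingD[OF ncp_noncrossing[OF \<pi>(1)] B(1) B'(1), of b t m q] b q bm S(3)[OF m(1)] by auto
    then show ?thesis ..
  qed
qed

lemma partition_on_remove:
  assumes "partition_on S \<pi>" "B \<in> \<pi>"
  shows "partition_on (S - B) (\<pi> - {B})"
proof -
  have "disjnt B (\<Union>(\<pi> - {B}))"
    using partition_onD2[OF assms(1)] assms(2) unfolding disjoint_def disjnt_def by blast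
  moreover have "insert B (\<pi> - {B}) = \<pi>" using assms(2) by blast
  ultimately show ?thesis using partition_on_insert assms(1) by metis
qed

lemma ncp_remove_block:
  fixes S :: "nat set"
  assumes "\<pi> \<in> ncp S U" "{m, t} \<in> \<pi>"
  shows "\<pi> - {{m, t}} \<in> ncp (S - {m, t}) (U - {m})"
proof -
  have "partition_on (S - {m, t}) (\<pi> - {{m, t}})"
    by (rule partition_on_remove[OF ncp_partition[OF assms(1)] assms(2)])
  then show ?thesis
  proof (rule ncpI)
    fix B assume "B \<in> \<pi> - {{m, t}}"
    then show "card B = 2" "\<not> B \<subseteq> U - {m}"
      using ncp_card[OF assms(1), of B] ncp_not_subset[OF assms(1), of B] by auto
  next
    show "noncrossing (\<pi> - {{m, t}})"
      using ncp_noncrossing[OF assms(1)] noncrossing_subset by blast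
  qed
qed

text \<open>No element of \<open>S\<close> lies strictly between \<open>m\<close> and
  \<open>t\<close>, so the new block cannot cross any other.\<close>

lemma ncp_insert_block:
  fixes S :: "nat set"
  assumes \<pi>: "\<pi> \<in> ncp (S - {m, t}) (U - {m})"
    and S: "t \<in> S" "U \<subseteq> S" "\<And>b. b \<in> U \<Longrightarrow> b < t" "\<And>b. b \<in> S \<Longrightarrow> b \<notin> U \<Longrightarrow> t \<le> b"
    and m: "m \<in> U" "\<And>b. b \<in> U \<Longrightarrow> b \<le> m"
  shows "insert {m, t} \<pi> \<in> ncp S U" "insert {m, t} \<pi> \<notin> ncp S (insert t U)" "{m, t} \<notin> \<pi>"
proof -
  have mt: "m < t" "m \<in> S" using S m by auto
  note part = ncp_partition[OF \<pi>]
  have sub: "\<And>B. B \<in> \<pi> \<Longrightarrow> B \<subseteq> S - {m, t}" using part by (auto simp: partition_on_def)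
  show "{m, t} \<notin> \<pi>" using sub by blast
  have p': "partition_on S (insert {m, t} \<pi>)"
  proof (subst partition_on_insert)
    show "disjnt {m, t} (\<Union>\<pi>)" using sub unfolding disjnt_def by blast
    show "partition_on (S - {m, t}) \<pi> \<and> {m, t} \<subseteq> S \<and> {m, t} \<noteq> {}" using part mt S(1) by simp
  qed
  have c': "card B = 2 \<and> \<not> B \<subseteq> U" if "B \<in> insert {m, t} \<pi>" for B
    using that ncp_card[OF \<pi>, of B] ncp_not_subset[OF \<pi>, of B] sub[of B] mt S(3)[of t] by auto
  have gap: "\<not> (m < x \<and> x < t)" if "x \<in> S" for x
    using that S(4)[of x] m(2)[of x] by (meson leD)
  have nc': False if "B \<in> insert {m, t} \<pi>" "B' \<in> insert {m, t} \<pi>" "p \<in> B" "q \<in> B" "p' \<in> B'" "q' \<in> B'"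
      "p < p'" "p' < q" "q < q'" for B B' p q p' q'
  proof -
    have S: "p' \<in> S" "q \<in> S" using that sub mt \<open>t \<in> S\<close> by blast+
    have "B \<noteq> {m, t}"
    proof
      assume "B = {m, t}"
      then have "p = m" "q = t" using that(3,4,7,8) mt by auto
      then show False using gap[OF S(1)] that(7,8) by simp
    qed
    moreover have "B' \<noteq> {m, t}"
    proof
      assume "B' = {m, t}"
      then have "p' = m" "q' = t" using that(5,6,8,9) mt by auto
      then show False using gap[OF S(2)] that(8,9) by simp
    qed
    ultimately have "B \<in> \<pi>" "B' \<in> \<pi>" using that by blast+
    then show False using noncrossingD[OF ncp_noncrossing[OF \<pi>] _ _ that(3-8)] that(9) by blast
  qed
  have nc'': "noncrossing (insert {m, t} \<pi>)"
    unfolding noncrossing_def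
  proof
    assume "\<exists>B\<in>insert {m, t} \<pi>. \<exists>B'\<in>insert {m, t} \<pi>. \<exists>p\<in>B. \<exists>q\<in>B. \<exists>p'\<in>B'. \<exists>q'\<in>B'. p < p' \<and> p' < q \<and> q < q'"
    then show False by (elim bexE conjE) (rule nc')
  qed
  show "insert {m, t} \<pi> \<in> ncp S U"
    using p' c' nc'' by (intro ncpI) auto
  show "insert {m, t} \<pi> \<notin> ncp S (insert t U)"
    using m ncp_not_subset[of "insert {m, t} \<pi>" S "insert t U" "{m, t}"] by auto
qed

text \<open>The position \<open>t\<close> either opens a pair or closes one. In the first case the
  same partition is viewed with \<open>t\<close> on the stack; in the second the partner is the top
  of the stack, and deleting this block leaves a partition of the same kind with the top
  popped.\<close>

lemma sum_ncp_eq_stk: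
  fixes y :: "nat \<Rightarrow> 'b"
  assumes "sorted_wrt (>) s" "\<And>b. b \<in> set s \<Longrightarrow> b < t" "t \<le> Suc k"
  shows "(\<Sum>\<pi>\<in>ncp (set s \<union> {t..k}) (set s). \<Prod>B\<in>\<pi>. c (y (Min B)) (y (Max B))) =
    stk c (map y s) (map y [t..<Suc k])"
  using assms
proof (induction "Suc k - t" arbitrary: s t)
  case 0
  then have "t = Suc k" by simp
  then show ?case by (simp add: ncp_self)
next
  case (Suc d)
  let ?w = "\<lambda>\<pi>. \<Prod>B\<in>\<pi>. c (y (Min B)) (y (Max B))"
  have tk: "t \<le> k" using Suc.hyps by simp
  define S where "S = set s \<union> {t..k}"
  have Sfin: "finite S" by (simp add: S_def)
  have Sh: "t \<in> S" "set s \<subseteq> S" "\<And>b. b \<in> S \<Longrightarrow> b \<notin> set s \<Longrightarrow> t \<le> b"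
    using tk by (auto simp: S_def)
  have yt: "map y [t..<Suc k] = y t # map y [Suc t..<Suc k]" using tk by (simp add: upt_conv_Cons del: upt_Suc)
  have sub: "ncp S (insert t (set s)) \<subseteq> ncp S (set s)" by (rule ncp_mono) auto
  have e1: "sum ?w (ncp S (set s)) = sum ?w (ncp S (set s) - ncp S (insert t (set s))) + sum ?w (ncp S (insert t (set s)))"
    by (rule sum.subset_diff[OF sub ncp_finite[OF Sfin]])
  have e2: "sum ?w (ncp S (insert t (set s))) = stk c (map y (t # s)) (map y [Suc t..<Suc k])"
  proof -
    have "S = set (t # s) \<union> {Suc t..k}" using tk by (auto simp: S_def)
    moreover have "sorted_wrt (>) (t # s)" "\<And>b. b \<in> set (t # s) \<Longrightarrow> b < Suc t"
      using Suc.prems by (auto simp: less_Suc_eq)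
    moreover have "d = Suc k - Suc t" using Suc.hyps(2) tk by simp
    ultimately show ?thesis using Suc.hyps(1)[of "Suc t" "t # s"] tk
      by (simp del: upt_Suc)
  qed
  \<comment> \<open>The difference collects the partitions in which \<open>t\<close> closes a
    pair.\<close>
  have e3: "sum ?w (ncp S (set s) - ncp S (insert t (set s))) =
    (case map y s of [] \<Rightarrow> 0 | b # s' \<Rightarrow> c b (y t) * stk c s' (map y [Suc t..<Suc k]))"
  proof (cases s)
    case Nil
    have ncard: "card B = 2 \<Longrightarrow> \<not> B \<subseteq> {t}" for B
      using card_mono[of "{t}" B] by auto
    then have "\<pi> \<in> ncp S {t}" if "\<pi> \<in> ncp S {}" for \<pi>
      by (rule ncp_restrict[OF that]) (metis ncp_card[OF that] ncard)
    then have e: "ncp S (set s) - ncp S (insert t (set s)) = {}"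
      using Nil by auto
    show ?thesis unfolding e using Nil by simp
  next
    case (Cons m s')
    have m: "m \<in> set s" "\<And>b. b \<in> set s \<Longrightarrow> b \<le> m" "m < t" "m \<notin> set s'"
      using Cons Suc.prems by (auto simp: less_imp_le)
    have S': "S - {m, t} = set s' \<union> {Suc t..k}" "set s - {m} = set s'"
    proof -
      have "t \<notin> set s'" "m \<notin> {Suc t..k}" using m(3) Cons Suc.prems(2)[of t] by auto
      then show "S - {m, t} = set s' \<union> {Suc t..k}" "set s - {m} = set s'"
        using m(4) Cons tk by (auto simp: S_def)
    qed
    have "sum ?w (ncp S (set s) - ncp S (insert t (set s))) =
        (\<Sum>\<pi>\<in>ncp (S - {m, t}) (set s - {m}). c (y m) (y t) * ?w \<pi>)"
    proof (rule sum.reindex_bij_witness[of _ "insert {m, t}" "\<lambda>\<pi>. \<pi> - {{m, t}}"])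
      fix \<pi> assume \<pi>: "\<pi> \<in> ncp S (set s) - ncp S (insert t (set s))"
      then have mt: "{m, t} \<in> \<pi>"
        using ncp_closing_block[of \<pi> S "set s" t m] Sh m Suc.prems(2) by auto
      show "insert {m, t} (\<pi> - {{m, t}}) = \<pi>" using mt by auto
      show "\<pi> - {{m, t}} \<in> ncp (S - {m, t}) (set s - {m})"
        using ncp_remove_block[of \<pi> S "set s" m t] \<pi> mt by blast
      have "finite \<pi>" using \<pi> Sfin finite_elements[of S \<pi>] ncp_partition by blast
      then have "?w \<pi> = c (y (Min {m, t})) (y (Max {m, t})) * ?w (\<pi> - {{m, t}})"
        using mt by (rule prod.remove)
      moreover have "Min {m, t} = m" "Max {m, t} = t" using m by auto
      ultimately show "c (y m) (y t) * ?w (\<pi> - {{m, t}}) = ?w \<pi>" by simp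
    next
      fix \<pi> assume \<pi>: "\<pi> \<in> ncp (S - {m, t}) (set s - {m})"
      note ins = ncp_insert_block[OF \<pi> Sh(1,2) Suc.prems(2) Sh(3) m(1,2)]
      show "insert {m, t} \<pi> - {{m, t}} = \<pi>" using ins(3) by auto
      show "insert {m, t} \<pi> \<in> ncp S (set s) - ncp S (insert t (set s))" using ins by blast
    qed
    also have "\<dots> = c (y m) (y t) * sum ?w (ncp (set s' \<union> {Suc t..k}) (set s'))"
      unfolding S' sum_distrib_left ..
    also have "sum ?w (ncp (set s' \<union> {Suc t..k}) (set s')) = stk c (map y s') (map y [Suc t..<Suc k])"
    proof -
      have "sorted_wrt (>) s'" "\<And>b. b \<in> set s' \<Longrightarrow> b < Suc t"
        using Suc.prems Cons by (auto simp: less_Suc_eq)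
      moreover have "d = Suc k - Suc t" using Suc.hyps(2) tk by simp
      ultimately show ?thesis using Suc.hyps(1)[of "Suc t" s'] tk by simp
    qed
    finally show ?thesis using Cons by simp
  qed
  show ?case
    unfolding yt S_def[symmetric] e1 e2 e3 by (simp only: stk.simps list.map add.commute)
qed

lemma sum_NCP_eq_stk:
  "(\<Sum>\<pi>\<in>NCP k. \<Prod>B\<in>\<pi>. c (y (Min B)) (y (Max B))) = stk c [] (map y [1..<Suc k])"
  using sum_ncp_eq_stk[of "[]" 1 k c y] by (simp add: NCP_eq_ncp del: upt_Suc)

section \<open>Links between words\<close>

definition cyc_after :: "nat \<Rightarrow> nat \<Rightarrow> nat list" where
  "cyc_after n i = rev [1..<i] @ rev [i + 1..<n + 1]"

definition cat :: "nat \<Rightarrow> (nat \<Rightarrow> nat \<Rightarrow> 'd list) \<Rightarrow> nat \<Rightarrow> 'd list" where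
  "cat n v i = concat (map (v i) (cyc_after n i))"

definition linking :: "nat \<Rightarrow> (nat \<Rightarrow> nat \<Rightarrow> 'd list) \<Rightarrow> bool" where
  "linking n v \<longleftrightarrow> (\<forall>i j. v i j \<noteq> [] \<longrightarrow> i \<in> {1..n} \<and> j \<in> {1..n} \<and> i \<noteq> j) \<and>
     (\<forall>i j. v j i = rev (v i j)) \<and>
     (\<forall>a b c d. a < b \<longrightarrow> b < c \<longrightarrow> c < d \<longrightarrow> v a c = [] \<or> v b d = [])"

text \<open>
  The links left to be made when the words \<open>w 1, \<dots>, w (t - 1)\<close> are on the stack and not to be linked
  with each other.
\<close>

definition links :: "nat \<Rightarrow> nat \<Rightarrow> (nat \<Rightarrow> 'd list) \<Rightarrow> (nat \<Rightarrow> nat \<Rightarrow> 'd list) set" where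
  "links n t w = {v. linking n v \<and> (\<forall>i j. v i j \<noteq> [] \<longrightarrow> t \<le> i \<or> t \<le> j) \<and> (\<forall>i\<in>{1..n}. cat n v i = w i)}"

text \<open>Unlinked pairs contribute the factor 1. Taking the product over all pairs keeps its
  index set independent of \<open>v\<close>.\<close>

definition link_weight :: "nat \<Rightarrow> (nat set \<Rightarrow> complex) \<Rightarrow> (nat \<Rightarrow> nat \<Rightarrow> 'd list) \<Rightarrow> complex" where
  "link_weight n \<kappa> v = (\<Prod>(i, j)\<in>{(i, j). i \<in> {1..n} \<and> j \<in> {1..n} \<and> i < j}. \<kappa> {i, j} ^ length (v i j))"

lemma linking_rev: "linking n v \<Longrightarrow> v j i = rev (v i j)"
  unfolding linking_def by blast

lemma linking_support: "linking n v \<Longrightarrow> v i j \<noteq> [] \<Longrightarrow> i \<in> {1..n} \<and> j \<in> {1..n} \<and> i \<noteq> j"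
  unfolding linking_def by blast

lemma linking_noncrossing: "linking n v \<Longrightarrow> a < b \<Longrightarrow> b < c \<Longrightarrow> c < d \<Longrightarrow> v a c = [] \<or> v b d = []"
  unfolding linking_def by blast

lemma linking_sym: "linking n v \<Longrightarrow> v j i = [] \<longleftrightarrow> v i j = []"
  using linking_rev[of n v j i] by simp

lemma set_cyc_after: "i \<in> {1..n} \<Longrightarrow> set (cyc_after n i) = {1..n} - {i}"
  by (auto simp: cyc_after_def)

lemma length_le_cat:
  assumes "j \<in> {1..n}" "i \<in> {1..n}" "i \<noteq> j"
  shows "length (v i j) \<le> length (cat n v i)"
proof -
  have "j \<in> set (cyc_after n i)" using assms by (simp add: set_cyc_after)
  then have "length (v i j) \<in> set (map length (map (v i) (cyc_after n i)))" by simp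
  then show ?thesis unfolding cat_def length_concat by (rule member_le_sum_list) auto
qed

lemma cat_Nil_iff:
  assumes "linking n v" "i \<in> {1..n}"
  shows "cat n v i = [] \<longleftrightarrow> (\<forall>j. v i j = [])"
proof -
  have "v i j = []" if "j \<notin> {1..n} - {i}" for j using that linking_support[OF assms(1), of i j] by blast
  moreover have "cat n v i = [] \<longleftrightarrow> (\<forall>j\<in>{1..n} - {i}. v i j = [])"
    unfolding cat_def set_cyc_after[OF assms(2), symmetric] by simp
  ultimately show ?thesis by blast
qed

lemma cat_cyc_split:
  assumes "1 \<le> j" "j < t"
  shows "cyc_after n t = rev [j + 1..<t] @ j # rev [1..<j] @ rev [t + 1..<n + 1]"
proof -
  have "[1..<t] = [1..<j] @ j # [j + 1..<t]"
    using assms upt_add_eq_append[of 1 j "t - j"] by (simp add: upt_conv_Cons)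
  then show ?thesis by (simp add: cyc_after_def)
qed

text \<open>This and \<open>cat_last\<close> say where a new pair of letters is attached. When
  nothing strictly between \<open>j\<close> and \<open>t\<close> is linked to either, the first
  letter of word \<open>t\<close> and the last letter of word \<open>j\<close> face each other, and
  the latter is what the machine has on top of its stack.\<close>

lemma cat_first:
  assumes "1 \<le> j" "j < t" "\<And>i. j < i \<Longrightarrow> i < t \<Longrightarrow> v t i = []"
  shows "cat n v t = v t j @ concat (map (v t) (rev [1..<j] @ rev [t + 1..<n + 1]))"
proof -
  have "concat (map (v t) (rev [j + 1..<t])) = []" using assms(3) by auto
  then show ?thesis unfolding cat_def cat_cyc_split[OF assms(1,2)] by simp
qed

lemma cat_last:
  assumes "1 \<le> j" "j < t" "t \<le> n" "\<And>i. j < i \<Longrightarrow> i < t \<Longrightarrow> v j i = []"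
  shows "cat n v j = concat (map (v j) (rev [1..<j] @ rev [t + 1..<n + 1])) @ v j t"
proof -
  have "[j + 1..<n + 1] = [j + 1..<t] @ t # [t + 1..<n + 1]"
    using assms upt_add_eq_append[of "j + 1" t "n + 1 - t"] by (simp add: upt_conv_Cons del: upt_Suc)
  moreover have "concat (map (v j) (rev [j + 1..<t])) = []" using assms(4) by auto
  ultimately show ?thesis unfolding cat_def cyc_after_def by simp
qed

lemma finite_bounded_families:
  "finite {v :: nat \<Rightarrow> nat \<Rightarrow> 'd::finite list.
     (\<forall>i j. v i j \<noteq> [] \<longrightarrow> i \<in> {1..n} \<and> j \<in> {1..n}) \<and> (\<forall>i j. length (v i j) \<le> N)}" (is "finite ?F")
proof (rule finite_imageD)
  let ?I = "{1..n} \<times> {1..n}"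
  let ?r = "\<lambda>v :: nat \<Rightarrow> nat \<Rightarrow> 'd list. restrict (\<lambda>(i, j). v i j) ?I"
  have "?r ` ?F \<subseteq> Pi\<^sub>E ?I (\<lambda>_. words N)"
  proof (rule image_subsetI)
    fix v :: "nat \<Rightarrow> nat \<Rightarrow> 'd list" assume "v \<in> ?F"
    then have "length (v i j) \<le> N" for i j by blast
    then show "?r v \<in> Pi\<^sub>E ?I (\<lambda>_. words N)" by (intro restrict_PiE_iff[THEN iffD2]) auto
  qed
  then show "finite (?r ` ?F)" by (rule finite_subset) (auto intro!: finite_PiE)
  show "inj_on ?r ?F"
  proof (rule inj_onI, intro ext)
    fix v v' i j assume v: "v \<in> ?F" "v' \<in> ?F" "?r v = ?r v'"
    show "v i j = v' i j"
    proof (cases "(i, j) \<in> ?I")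
      case True
      then show ?thesis using fun_cong[OF v(3), of "(i, j)"] by simp
    next
      case False
      then have "v i j = []" "v' i j = []" using v(1,2) by blast+
      then show ?thesis by simp
    qed
  qed
qed

lemma finite_links: "finite (links n t w :: (nat \<Rightarrow> nat \<Rightarrow> 'd::finite list) set)"
proof (rule finite_subset[OF _ finite_bounded_families])
  define N where "N = (\<Sum>i\<in>{1..n}. length (w i))"
  show "links n t w \<subseteq> {v :: nat \<Rightarrow> nat \<Rightarrow> 'd list.
      (\<forall>i j. v i j \<noteq> [] \<longrightarrow> i \<in> {1..n} \<and> j \<in> {1..n}) \<and> (\<forall>i j. length (v i j) \<le> N)}"
  proof (intro subsetI CollectI conjI allI)
    fix v :: "nat \<Rightarrow> nat \<Rightarrow> 'd list" and i j assume v: "v \<in> links n t w"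
    then have l: "linking n v" by (simp add: links_def)
    then show "v i j \<noteq> [] \<longrightarrow> i \<in> {1..n} \<and> j \<in> {1..n}"
      using linking_support by blast
    show "length (v i j) \<le> N"
    proof (cases "v i j = []")
      case False
      then have ij: "i \<in> {1..n}" "j \<in> {1..n}" "i \<noteq> j" using linking_support[OF l] by auto
      then have "length (v i j) \<le> length (w i)"
        using length_le_cat[of j n i v] v by (simp add: links_def)
      also have "\<dots> \<le> N" unfolding N_def using ij by (intro member_le_sum) auto
      finally show ?thesis .
    qed simp
  qed
qed

lemma links_Suc: "links n (Suc t) w = {v \<in> links n t w. \<forall>i<t. v t i = []}"
proof (intro set_eqI iffI)
  fix v assume v: "v \<in> links n (Suc t) w"
  have "v t i = []" if "i < t" for i
    using v that unfolding links_def by (metis (mono_tags, lifting) mem_Collect_eq not_less_eq_eq order.refl less_imp_le_nat)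
  moreover have "v \<in> links n t w" using v unfolding links_def by (fastforce dest: Suc_leD)
  ultimately show "v \<in> {v \<in> links n t w. \<forall>i<t. v t i = []}" by blast
next
  fix v assume v: "v \<in> {v \<in> links n t w. \<forall>i<t. v t i = []}"
  then have l: "linking n v" by (simp add: links_def)
  have "Suc t \<le> i \<or> Suc t \<le> j" if ij: "v i j \<noteq> []" for i j
  proof (rule ccontr)
    assume "\<not> ?thesis"
    then have le: "i \<le> t" "j \<le> t" by auto
    have "i \<noteq> j" using linking_support[OF l ij] by blast
    moreover have "t \<le> i \<or> t \<le> j" using v ij by (simp add: links_def)
    ultimately have "i = t \<and> j < t \<or> j = t \<and> i < t" using le by auto
    then show False using v ij linking_sym[OF l] by auto
  qed
  then show "v \<in> links n (Suc t) w" using v by (simp add: links_def)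
qed

lemma links_no_link:
  assumes "1 \<le> t" "t \<le> n" "w t = [] \<or> (\<forall>i\<in>{1..<t}. w i = [])"
  shows "links n (Suc t) w = links n t w"
proof -
  have "v t i = []" if v: "v \<in> links n t w" and "i < t" for v i
  proof (rule ccontr)
    assume ne: "v t i \<noteq> []"
    have l: "linking n v" and c: "\<forall>i\<in>{1..n}. cat n v i = w i" using v by (auto simp: links_def)
    have i: "i \<in> {1..n}" using linking_support[OF l ne] by blast
    have "w t \<noteq> []" using cat_Nil_iff[OF l, of t] c ne assms(1,2) by (metis atLeastAtMost_iff)
    moreover have "w i \<noteq> []" using cat_Nil_iff[OF l i] c ne linking_sym[OF l, of t i] i by metis
    ultimately show False using assms(3) \<open>i < t\<close> i by auto
  qed
  then show ?thesis unfolding links_Suc by blast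
qed

section \<open>Adding or removing one pair of linked letters\<close>

definition upd_link :: "(nat \<Rightarrow> nat \<Rightarrow> 'd list) \<Rightarrow> nat \<Rightarrow> nat \<Rightarrow> 'd list \<Rightarrow> nat \<Rightarrow> nat \<Rightarrow> 'd list" where
  "upd_link v t j x = (\<lambda>p q. if p = t \<and> q = j then x else if p = j \<and> q = t then rev x else v p q)"

lemma link_weight_upd:
  assumes "j < t" "j \<in> {1..n}" "t \<in> {1..n}" "length (v j t) = Suc (length x)"
  shows "link_weight n \<kappa> v = \<kappa> {j, t} * link_weight n \<kappa> (upd_link v t j x)"
proof -
  let ?I = "{(i, j). i \<in> {1..n} \<and> j \<in> {1..n} \<and> i < j}"
  have fin: "finite ?I" by (rule finite_subset[of _ "{1..n} \<times> {1..n}"]) auto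
  have mem: "(j, t) \<in> ?I" using assms by simp
  have "(\<Prod>(i, k)\<in>?I - {(j, t)}. \<kappa> {i, k} ^ length (v i k)) =
      (\<Prod>(i, k)\<in>?I - {(j, t)}. \<kappa> {i, k} ^ length (upd_link v t j x i k))"
  proof (rule prod.cong[OF refl])
    fix e assume e: "e \<in> ?I - {(j, t)}"
    obtain i k where ik: "e = (i, k)" by (cases e)
    then have "upd_link v t j x i k = v i k" using e assms(1) by (auto simp: upd_link_def)
    then show "(case e of (i, k) \<Rightarrow> \<kappa> {i, k} ^ length (v i k)) =
        (case e of (i, k) \<Rightarrow> \<kappa> {i, k} ^ length (upd_link v t j x i k))" using ik by simp
  qed
  then show ?thesis
    unfolding link_weight_def prod.remove[OF fin mem]
    using assms by (simp add: upd_link_def)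
qed

text \<open>A link crossing the one between \<open>j\<close> and \<open>t\<close> would have an end
  strictly between them, where \<open>gap\<close> allows none.\<close>

lemma linking_upd:
  assumes l: "linking n v" and jt: "1 \<le> j" "j < t" "t \<le> n"
    and gap: "\<And>i q. j < i \<Longrightarrow> i < t \<Longrightarrow> v i q = []"
  shows "linking n (upd_link v t j x)"
proof -
  have sup: "v p q \<noteq> [] \<or> (p = t \<and> q = j) \<or> (p = j \<and> q = t)" if "upd_link v t j x p q \<noteq> []" for p q
    using that by (auto simp: upd_link_def split: if_splits)
  have gap': "v q i = []" if "j < i" "i < t" for i q
    using gap[OF that, of q] linking_sym[OF l] by blast
  show ?thesis
    unfolding linking_def
  proof (intro conjI allI impI)
    fix p q assume "upd_link v t j x p q \<noteq> []"
    then have "p \<in> {1..n} \<and> q \<in> {1..n} \<and> p \<noteq> q" using sup[of p q] linking_support[OF l, of p q] jt by auto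
    then show "p \<in> {1..n}" "q \<in> {1..n}" "p \<noteq> q" by auto
  next
    fix p q show "upd_link v t j x q p = rev (upd_link v t j x p q)"
      using jt linking_rev[OF l, of q p] by (auto simp: upd_link_def)
  next
    fix a b c d :: nat assume o: "a < b" "b < c" "c < d"
    show "upd_link v t j x a c = [] \<or> upd_link v t j x b d = []"
    proof (rule ccontr)
      assume "\<not> ?thesis"
      then have ac: "v a c \<noteq> [] \<or> (a = j \<and> c = t)" and bd: "v b d \<noteq> [] \<or> (b = j \<and> d = t)"
        using sup[of a c] sup[of b d] o jt by auto
      consider "a = j" "c = t" | "b = j" "d = t" | "v a c \<noteq> []" "v b d \<noteq> []" using ac bd by blast
      then show False
      proof cases
        case 1
        then have "v b d = []" using gap[of b d] o by blast
        then show False using bd 1 o by simp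
      next
        case 2
        then have "v a c = []" using gap'[of c a] o by blast
        then show False using ac 2 o by simp
      next
        case 3
        then show False using linking_noncrossing[OF l o] by blast
      qed
    qed
  qed
qed

text \<open>The letters of word \<open>j\<close> may not be linked among the words below
  \<open>t\<close>. If none were linked to \<open>t\<close>, they would be linked beyond
  \<open>t\<close>, across the link from \<open>t\<close> to some \<open>i < j\<close>.\<close>

lemma links_first:
  assumes v: "v \<in> links n t w" and jt: "1 \<le> j" "j < t" "t \<le> n" and wj: "w j \<noteq> []"
    and gap: "\<And>i. j < i \<Longrightarrow> i < t \<Longrightarrow> w i = []" and ne: "i < t" "v t i \<noteq> []"
  shows "v t j \<noteq> []"
proof (rule ccontr)
  assume vtj: "\<not> v t j \<noteq> []"
  have l: "linking n v" and e: "\<And>p q. v p q \<noteq> [] \<Longrightarrow> t \<le> p \<or> t \<le> q"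
    and c: "\<And>i. i \<in> {1..n} \<Longrightarrow> cat n v i = w i" using v by (auto simp: links_def)
  have i: "i \<in> {1..n}" using linking_support[OF l ne(2)] by blast
  have "w i \<noteq> []" using cat_Nil_iff[OF l i] c[OF i] ne linking_sym[OF l, of t i] by auto
  then have "i < j" using gap[of i] ne vtj by (metis linorder_neqE_nat)
  obtain k where k: "v j k \<noteq> []" using cat_Nil_iff[OF l, of j] c[of j] wj jt by auto
  have "k \<noteq> t" using k vtj linking_sym[OF l, of t j] by auto
  moreover have "t \<le> k" using e[OF k] jt by auto
  ultimately have "t < k" by simp
  moreover have "v i t \<noteq> []" using ne linking_sym[OF l, of t i] by auto
  ultimately show False using k linking_noncrossing[OF l \<open>i < j\<close> jt(2)] by blast
qed

text \<open>Either \<open>t\<close> has no link to an earlier word, or, by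
  \<open>links_first\<close>, its nearest nonempty predecessor \<open>j\<close> is linked to it. In
  the second case the last letter of \<open>w j\<close> is linked to the first letter of
  \<open>w t\<close>, and this pair can be removed.\<close>

lemma sum_links_step:
  fixes w :: "nat \<Rightarrow> 'd::finite list"
  assumes jt: "1 \<le> j" "j < t" "t \<le> n" and wj: "w j \<noteq> []" and wt: "w t \<noteq> []"
    and gap: "\<And>i. j < i \<Longrightarrow> i < t \<Longrightarrow> w i = []"
  shows "sum (link_weight n \<kappa>) (links n t w) = sum (link_weight n \<kappa>) (links n (Suc t) w) +
    (if last (w j) = hd (w t) then
       \<kappa> {j, t} * sum (link_weight n \<kappa>) (links n t (w(j := butlast (w j), t := tl (w t)))) else 0)"
proof -
  let ?w' = "w(j := butlast (w j), t := tl (w t))"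
  let ?a = "hd (w t)"
  define B where "B = links n t w - links n (Suc t) w"
  have split: "sum (link_weight n \<kappa>) (links n t w) = sum (link_weight n \<kappa>) B + sum (link_weight n \<kappa>) (links n (Suc t) w)"
    unfolding B_def by (rule sum.subset_diff) (auto simp: links_Suc finite_links)
  have vgap: "v i q = []" if "linking n v" "\<And>i. i \<in> {1..n} \<Longrightarrow> i \<notin> {j, t} \<Longrightarrow> cat n v i = w i" "j < i" "i < t" for v i q
    using cat_Nil_iff[OF that(1), of i] that gap[of i] jt by auto
  have cats: "cat n v t = v t j @ concat (map (v t) (rev [1..<j] @ rev [t + 1..<n + 1]))"
      "cat n v j = concat (map (v j) (rev [1..<j] @ rev [t + 1..<n + 1])) @ v j t"
      "cat n (upd_link v t j x) t = x @ concat (map (v t) (rev [1..<j] @ rev [t + 1..<n + 1]))"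
      "cat n (upd_link v t j x) j = concat (map (v j) (rev [1..<j] @ rev [t + 1..<n + 1])) @ rev x"
      "\<And>i. i \<notin> {j, t} \<Longrightarrow> cat n (upd_link v t j x) i = cat n v i"
    if l: "linking n v" and g: "\<And>i q. j < i \<Longrightarrow> i < t \<Longrightarrow> v i q = []" for v x
  proof -
    have g': "v q i = []" if "j < i" "i < t" for i q
      using g[OF that, of q] linking_sym[OF l] by blast
    show "cat n v t = v t j @ concat (map (v t) (rev [1..<j] @ rev [t + 1..<n + 1]))"
      by (rule cat_first[OF jt(1,2) g'])
    show "cat n v j = concat (map (v j) (rev [1..<j] @ rev [t + 1..<n + 1])) @ v j t"
      by (rule cat_last[OF jt g'])
    have m1: "map (upd_link v t j x t) (rev [1..<j] @ rev [t + 1..<n + 1]) = map (v t) (rev [1..<j] @ rev [t + 1..<n + 1])"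
      using jt by (intro map_cong) (auto simp: upd_link_def)
    have m2: "map (upd_link v t j x j) (rev [1..<j] @ rev [t + 1..<n + 1]) = map (v j) (rev [1..<j] @ rev [t + 1..<n + 1])"
      using jt by (intro map_cong) (auto simp: upd_link_def)
    have "cat n (upd_link v t j x) t = upd_link v t j x t j @ concat (map (upd_link v t j x t) (rev [1..<j] @ rev [t + 1..<n + 1]))"
      using g' jt by (intro cat_first) (auto simp: upd_link_def)
    then show "cat n (upd_link v t j x) t = x @ concat (map (v t) (rev [1..<j] @ rev [t + 1..<n + 1]))"
      unfolding m1 by (simp add: upd_link_def)
    have "cat n (upd_link v t j x) j = concat (map (upd_link v t j x j) (rev [1..<j] @ rev [t + 1..<n + 1])) @ upd_link v t j x j t"
      using g' jt by (intro cat_last) (auto simp: upd_link_def)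
    then show "cat n (upd_link v t j x) j = concat (map (v j) (rev [1..<j] @ rev [t + 1..<n + 1])) @ rev x"
      unfolding m2 using jt by (simp add: upd_link_def)
    show "cat n (upd_link v t j x) i = cat n v i" if "i \<notin> {j, t}" for i
      unfolding cat_def using that by (intro arg_cong[of _ _ concat] map_cong) (auto simp: upd_link_def)
  qed
  \<comment> \<open>The new pair is the outermost choice in \<open>cat\<close> on both sides: it
    goes to the front of \<open>v t j\<close> and hence to the end of \<open>v j t\<close>. The map
    in \<open>peel\<close> below undoes this.\<close>
  have grow: "upd_link v t j (?a # v t j) \<in> B \<and> v \<in> links n t ?w' \<and> linking n v"
    if v: "v \<in> links n t ?w'" and la: "last (w j) = ?a" for v
  proof -
    have l: "linking n v" and e: "\<And>p q. v p q \<noteq> [] \<Longrightarrow> t \<le> p \<or> t \<le> q"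
      and c: "\<And>i. i \<in> {1..n} \<Longrightarrow> cat n v i = ?w' i" using v by (auto simp: links_def)
    have g: "v i q = []" if "j < i" "i < t" for i q
      by (rule vgap[OF l _ that]) (simp add: c)
    have "cat n (upd_link v t j (?a # v t j)) t = ?a # cat n v t"
      using cats(3)[OF l g] cats(1)[OF l g] by simp
    moreover have "cat n (upd_link v t j (?a # v t j)) j = cat n v j @ [?a]"
      using cats(4)[OF l g] cats(2)[OF l g] linking_rev[OF l, of j t] by simp
    moreover have "butlast (w j) @ [?a] = w j" using la wj by (metis append_butlast_last_id)
    ultimately have "cat n (upd_link v t j (?a # v t j)) i = w i" if "i \<in> {1..n}" for i
      using that cats(5)[OF l g, of i "?a # v t j"] c[of i] wt wj jt la
      by (cases "i = t"; cases "i = j") auto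
    moreover have "linking n (upd_link v t j (?a # v t j))"
      by (rule linking_upd[OF l jt]) (rule g)
    moreover have "t \<le> p \<or> t \<le> q" if "upd_link v t j (?a # v t j) p q \<noteq> []" for p q
      using that e[of p q] by (auto simp: upd_link_def split: if_splits)
    ultimately have "upd_link v t j (?a # v t j) \<in> links n t w"
      unfolding links_def by blast
    moreover have "upd_link v t j (?a # v t j) t j \<noteq> []" by (simp add: upd_link_def)
    ultimately show ?thesis using v l jt unfolding B_def links_Suc by blast
  qed
  have peel: "upd_link v t j (tl (v t j)) \<in> links n t ?w' \<and> last (w j) = ?a \<and> v t j = ?a # tl (v t j) \<and> linking n v"
    if vB: "v \<in> B" for v
  proof -
    have v: "v \<in> links n t w" using vB by (simp add: B_def)
    then have l: "linking n v" and e: "\<And>p q. v p q \<noteq> [] \<Longrightarrow> t \<le> p \<or> t \<le> q"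
      and c: "\<And>i. i \<in> {1..n} \<Longrightarrow> cat n v i = w i" by (auto simp: links_def)
    have g: "v i q = []" if "j < i" "i < t" for i q
      by (rule vgap[OF l _ that]) (simp add: c)
    obtain i where "i < t" "v t i \<noteq> []" using vB unfolding B_def links_Suc by blast
    then have ne: "v t j \<noteq> []" using links_first[OF v jt wj gap] by blast
    then obtain b x where bx: "v t j = b # x" by (cases "v t j") auto
    then have vjt: "v j t = rev x @ [b]" using linking_rev[OF l, of j t] by simp
    have ct: "w t = b # cat n (upd_link v t j x) t"
      using cats(1,3)[OF l g] bx c[of t] jt by simp
    have cj: "w j = cat n (upd_link v t j x) j @ [b]"
      using cats(2,4)[OF l g] vjt c[of j] jt by simp
    have "linking n (upd_link v t j x)"
      by (rule linking_upd[OF l jt]) (rule g)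
    moreover have "cat n (upd_link v t j x) i = ?w' i" if "i \<in> {1..n}" for i
      using that cats(5)[OF l g, of i x] c[of i] ct cj jt
      by (cases "i = t"; cases "i = j") auto
    moreover have "t \<le> p \<or> t \<le> q" if "upd_link v t j x p q \<noteq> []" for p q
      using that e[of p q] by (auto simp: upd_link_def split: if_splits)
    ultimately have "upd_link v t j x \<in> links n t ?w'" unfolding links_def by blast
    then show ?thesis using bx ct cj l by simp
  qed
  have "sum (link_weight n \<kappa>) B = (if last (w j) = ?a then
       \<kappa> {j, t} * sum (link_weight n \<kappa>) (links n t ?w') else 0)"
  proof (cases "last (w j) = ?a")
    case False
    then have "B = {}" using peel by blast
    then show ?thesis using False by simp
  next
    case True
    have "sum (link_weight n \<kappa>) B = (\<Sum>v\<in>links n t ?w'. \<kappa> {j, t} * link_weight n \<kappa> v)"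
    proof (rule sum.reindex_bij_witness[where i = "\<lambda>v. upd_link v t j (?a # v t j)"
          and j = "\<lambda>v. upd_link v t j (tl (v t j))"])
      fix v assume v: "v \<in> B"
      note f = peel[OF v]
      then have vtj: "v t j = ?a # tl (v t j)" and l: "linking n v" by blast+
      have vjt: "v j t = rev (v t j)" using linking_rev[OF l] by blast
      show "upd_link (upd_link v t j (tl (v t j))) t j (?a # upd_link v t j (tl (v t j)) t j) = v"
        using vtj vjt by (intro ext) (auto simp: upd_link_def)
      show "upd_link v t j (tl (v t j)) \<in> links n t ?w'" using f by blast
      have "length (v j t) = Suc (length (tl (v t j)))"
        by (subst vjt, subst vtj) simp
      then show "\<kappa> {j, t} * link_weight n \<kappa> (upd_link v t j (tl (v t j))) = link_weight n \<kappa> v"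
        using jt by (intro link_weight_upd[symmetric]) auto
    next
      fix v assume v: "v \<in> links n t ?w'"
      note b = grow[OF v True]
      then have l: "linking n v" by blast
      have vjt: "v j t = rev (v t j)" using linking_rev[OF l] by blast
      show "upd_link (upd_link v t j (?a # v t j)) t j (tl (upd_link v t j (?a # v t j) t j)) = v"
        using vjt by (intro ext) (auto simp: upd_link_def)
      show "upd_link v t j (?a # v t j) \<in> B" using b by blast
    qed
    then show ?thesis using True by (simp add: sum_distrib_left)
  qed
  then show ?thesis using split by simp
qed

lemma sum_links_end:
  "sum (link_weight n \<kappa>) (links n (Suc n) w) = (if \<forall>i\<in>{1..n}. w i = [] then 1 else 0)"
proof -
  have v0: "v = (\<lambda>_ _. [])" if "v \<in> links n (Suc n) w" for v
  proof (intro ext, rule ccontr)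
    fix i j assume "v i j \<noteq> []"
    moreover have "linking n v" using that by (simp add: links_def)
    ultimately have "i \<in> {1..n} \<and> j \<in> {1..n}" using linking_support[of n v i j] by blast
    moreover have "Suc n \<le> i \<or> Suc n \<le> j"
      using that \<open>v i j \<noteq> []\<close> unfolding links_def by blast
    ultimately have "Suc n \<le> i \<or> Suc n \<le> j" "i \<in> {1..n} \<and> j \<in> {1..n}" by blast+
    then show False by auto
  qed
  have c0: "cat n (\<lambda>_ _. []) i = []" for i by (simp add: cat_def)
  have "links n (Suc n) w = (if \<forall>i\<in>{1..n}. w i = [] then {\<lambda>_ _. []} else {})"
  proof (cases "\<forall>i\<in>{1..n}. w i = []")
    case True
    then have "(\<lambda>_ _. []) \<in> links n (Suc n) w" by (simp add: links_def linking_def c0)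
    then have "links n (Suc n) w = {\<lambda>_ _. []}" using v0 by blast
    then show ?thesis using True by simp
  next
    case False
    have "v \<notin> links n (Suc n) w" for v
    proof
      assume v: "v \<in> links n (Suc n) w"
      then have "(\<lambda>_ _. []) \<in> links n (Suc n) w" unfolding v0[OF v] .
      then have "\<forall>i\<in>{1..n}. w i = []" by (simp add: links_def c0)
      then show False using False by blast
    qed
    then show ?thesis using False by auto
  qed
  then show ?thesis by (simp add: link_weight_def)
qed

section \<open>The machine on tagged words as a sum over linkings\<close>

lemma sum_PiE_insert:
  assumes "a \<notin> X"
  shows "sum f (Pi\<^sub>E (insert a X) B) = (\<Sum>y\<in>B a. \<Sum>g\<in>Pi\<^sub>E X B. f (g(a := y)))"
  unfolding PiE_insert_eq sum.reindex[OF inj_combinator[OF assms]] sum.cartesian_product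
  by (simp add: case_prod_unfold o_def)

definition stack :: "nat \<Rightarrow> (nat \<Rightarrow> 'd list) \<Rightarrow> (nat \<times> 'd) list" where
  "stack t w = rev (concat (map (\<lambda>i. map (Pair i) (w i)) [1..<t]))"

definition cov :: "(nat set \<Rightarrow> complex) \<Rightarrow> nat \<times> 'd \<Rightarrow> nat \<times> 'd \<Rightarrow> complex" where
  "cov \<kappa> p q = (if snd p = snd q then \<kappa> {fst p, fst q} else 0)"

lemma stack_Suc: "1 \<le> t \<Longrightarrow> stack (Suc t) w = rev (map (Pair t) (w t)) @ stack t w"
  by (simp add: stack_def)

lemma stack_cong: "(\<And>i. i < t \<Longrightarrow> w i = w' i) \<Longrightarrow> stack t w = stack t w'"
  unfolding stack_def by (intro arg_cong[of _ _ rev] arg_cong[of _ _ concat] map_cong) auto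

lemma stack_Nil_iff: "stack t w = [] \<longleftrightarrow> (\<forall>i\<in>{1..<t}. w i = [])"
  by (simp add: stack_def)

lemma stack_top:
  assumes "1 \<le> j" "j < t" "\<And>i. j < i \<Longrightarrow> i < t \<Longrightarrow> w i = []" "w j \<noteq> []"
  shows "stack t w = (j, last (w j)) # stack t (w(j := butlast (w j), t := x))"
proof -
  have split: "[1..<t] = [1..<j] @ j # [j + 1..<t]"
    using assms upt_add_eq_append[of 1 j "t - j"] by (simp add: upt_conv_Cons)
  let ?f = "\<lambda>w i. map (Pair i) (w i)" and ?w = "w(j := butlast (w j), t := x)"
  have e: "concat (map (?f w) [j + 1..<t]) = []" "concat (map (?f ?w) [j + 1..<t]) = []"
    using assms by auto
  have m: "map (?f ?w) [1..<j] = map (?f w) [1..<j]" using assms by (intro map_cong) auto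
  have "?f w j = map (Pair j) (butlast (w j) @ [last (w j)])" using assms(4) by simp
  then have "?f w j = ?f ?w j @ [(j, last (w j))]" using assms(2) by simp
  then show ?thesis unfolding stack_def split map_append list.map concat_append concat.simps e m by simp
qed

text \<open>Linking the first letter of \<open>w t\<close> to the top of the stack shortens
  \<open>w t\<close> and an earlier word at once, so the induction on \<open>w t\<close> generalizes
  all of \<open>w\<close>. The two branches of \<open>wpop\<close>, push the rest or link one more
  letter, are the two terms of \<open>sum_links_step\<close>. \<open>X\<close> and \<open>p\<close>
  carry along a sum over the choices \<open>g\<close> of the words after \<open>t\<close>.\<close>

lemma wpop_stack:
  fixes \<kappa> :: "nat set \<Rightarrow> complex" and w :: "nat \<Rightarrow> 'd::finite list" and t :: nat
  defines "m \<equiv> \<lambda>w g i. if i \<le> t then w i else g i"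
  assumes t: "1 \<le> t" "t \<le> n"
    and f: "\<And>w. f (stack (Suc t) w) = (\<Sum>g\<in>X. p g * sum (link_weight n \<kappa>) (links n (Suc t) (m w g)))"
  shows "wpop (cov \<kappa>) t f (stack t w) (w t) = (\<Sum>g\<in>X. p g * sum (link_weight n \<kappa>) (links n t (m w g)))"
proof (induction "w t" arbitrary: w)
  case Nil
  have "wpop (cov \<kappa>) t f (stack t w) (w t) = f (stack (Suc t) w)"
    using t by (simp add: stack_Suc Nil[symmetric])
  moreover have "links n (Suc t) (m w g) = links n t (m w g)" for g
    using t Nil by (intro links_no_link) (auto simp: m_def)
  ultimately show ?case by (simp add: f)
next
  case (Cons a u)
  have "wpop (cov \<kappa>) t f (stack t w) (w t) = f (stack (Suc t) w) +
     (case stack t w of [] \<Rightarrow> 0 | b # s' \<Rightarrow> cov \<kappa> b (t, a) * wpop (cov \<kappa>) t f s' u)"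
    using t by (simp add: stack_Suc Cons(2)[symmetric])
  moreover have "(\<Sum>g\<in>X. p g * sum (link_weight n \<kappa>) (links n t (m w g))) = f (stack (Suc t) w) +
     (case stack t w of [] \<Rightarrow> 0 | b # s' \<Rightarrow> cov \<kappa> b (t, a) * wpop (cov \<kappa>) t f s' u)"
  proof (cases "stack t w = []")
    case True
    then have "links n (Suc t) (m w g) = links n t (m w g)" for g
      using t by (intro links_no_link) (auto simp: m_def stack_Nil_iff)
    then show ?thesis using True by (simp add: f)
  next
    case False
    \<comment> \<open>The nearest earlier word that still has letters; its last letter is the top of
      the stack.\<close>
    define j where "j = Max {i \<in> {1..<t}. w i \<noteq> []}"
    have ne: "{i \<in> {1..<t}. w i \<noteq> []} \<noteq> {}" using False by (auto simp: stack_Nil_iff)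
    have "j \<in> {i \<in> {1..<t}. w i \<noteq> []}" unfolding j_def using ne by (intro Max_in) auto
    then have j: "1 \<le> j" "j < t" "w j \<noteq> []" by auto
    have gap: "w i = []" if "j < i" "i < t" for i
    proof (rule ccontr)
      assume "w i \<noteq> []"
      then have "i \<le> j" unfolding j_def using that j by (intro Max_ge) auto
      then show False using that by simp
    qed
    define w' where "w' = w(j := butlast (w j), t := tl (w t))"
    have w't: "w' t = u" by (simp add: w'_def Cons(2)[symmetric])
    have st: "stack t w = (j, last (w j)) # stack t w'"
      unfolding w'_def using j gap by (intro stack_top)
    have IH: "wpop (cov \<kappa>) t f (stack t w') u =
        (\<Sum>g\<in>X. p g * sum (link_weight n \<kappa>) (links n t (m w' g)))"
      using Cons(1)[of w'] w't by simp
    have step: "sum (link_weight n \<kappa>) (links n t (m w g)) = sum (link_weight n \<kappa>) (links n (Suc t) (m w g)) +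
       cov \<kappa> (j, last (w j)) (t, a) * sum (link_weight n \<kappa>) (links n t (m w' g))" for g
    proof -
      have "(m w g)(j := butlast (m w g j), t := tl (m w g t)) = m w' g"
        using j by (auto simp: m_def w'_def)
      moreover have "hd (m w g t) = a" "m w g t \<noteq> []" "m w g j = w j"
        using j by (auto simp: m_def Cons(2)[symmetric])
      ultimately show ?thesis
        using sum_links_step[OF j(1,2) t(2), of "m w g" \<kappa>] j gap
        by (simp add: cov_def m_def)
    qed
    show ?thesis
      unfolding step st by (simp add: f IH distrib_left sum.distrib sum_distrib_left mult.left_commute)
  qed
  ultimately show ?case by simp
qed

text \<open>Backward induction on \<open>t\<close>: \<open>stk_wick\<close> sums out the pairings
  inside \<open>A t\<close>, and \<open>wpop_stack\<close> turns the behaviour of the remaining word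
  towards the stack into links to earlier words. At \<open>t = Suc n\<close> no letter is left to
  scan, so all words must have been used up.\<close>

lemma stk_stack:
  fixes A :: "nat \<Rightarrow> 'd::finite list"
  assumes "\<And>i. i \<in> {1..n} \<Longrightarrow> \<kappa> {i} = 1" "\<And>i. i \<in> {1..n} \<Longrightarrow> length (A i) \<le> N"
    and "1 \<le> t" "t \<le> Suc n"
  shows "stk (cov \<kappa>) (stack t w) (concat (map (\<lambda>i. map (Pair i) (A i)) [t..<Suc n])) =
    (\<Sum>g\<in>Pi\<^sub>E {t..n} (\<lambda>_. words N). (\<Prod>i\<in>{t..n}. wick (A i) (g i)) *
       sum (link_weight n \<kappa>) (links n t (\<lambda>i. if i < t then w i else g i)))"
  using assms(3,4)
proof (induction "Suc n - t" arbitrary: t w)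
  case 0
  then have t: "t = Suc n" by simp
  show ?case unfolding t by (simp add: sum_links_end stack_Nil_iff del: upt_Suc)
next
  case (Suc d)
  then have t: "1 \<le> t" "t \<le> n" by auto
  let ?ys = "concat (map (\<lambda>i. map (Pair i) (A i)) [Suc t..<Suc n])"
  let ?L = "\<lambda>t w. sum (link_weight n \<kappa>) (links n t w)"
  let ?p = "\<lambda>g. \<Prod>i\<in>{Suc t..n}. wick (A i) (g i)"
  have ys: "concat (map (\<lambda>i. map (Pair i) (A i)) [t..<Suc n]) = map (Pair t) (A t) @ ?ys"
    using t by (simp add: upt_conv_Cons del: upt_Suc)
  have ins: "{t..n} = insert t {Suc t..n}" using t by auto
  have inner: "wpop (cov \<kappa>) t (\<lambda>s. stk (cov \<kappa>) s ?ys) (stack t w) u =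
      (\<Sum>g\<in>Pi\<^sub>E {Suc t..n} (\<lambda>_. words N). ?p g * ?L t (\<lambda>i. if i < t then w i else (g(t := u)) i))" for u
  proof -
    have IH: "stk (cov \<kappa>) (stack (Suc t) w) ?ys = (\<Sum>g\<in>Pi\<^sub>E {Suc t..n} (\<lambda>_. words N). ?p g *
        ?L (Suc t) (\<lambda>i. if i \<le> t then w i else g i))" for w
      using Suc(1)[of "Suc t" w] Suc(2) t by (simp add: less_Suc_eq_le del: upt_Suc)
    have "wpop (cov \<kappa>) t (\<lambda>s. stk (cov \<kappa>) s ?ys) (stack t (w(t := u))) ((w(t := u)) t) =
      (\<Sum>g\<in>Pi\<^sub>E {Suc t..n} (\<lambda>_. words N). ?p g * ?L t (\<lambda>i. if i \<le> t then (w(t := u)) i else g i))"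
      by (rule wpop_stack[OF t IH])
    moreover have "stack t (w(t := u)) = stack t w" by (rule stack_cong) auto
    moreover have "(\<lambda>i. if i \<le> t then (w(t := u)) i else g i) = (\<lambda>i. if i < t then w i else (g(t := u)) i)" for g
      by auto
    ultimately show ?thesis by simp
  qed
  have "stk (cov \<kappa>) (stack t w) (concat (map (\<lambda>i. map (Pair i) (A i)) [t..<Suc n])) =
      (\<Sum>u\<in>words N. wick (A t) u * wpop (cov \<kappa>) t (\<lambda>s. stk (cov \<kappa>) s ?ys) (stack t w) u)"
    unfolding ys using assms(1)[of t] assms(2)[of t] t
    by (intro stk_wick) (auto simp: cov_def)
  also have "\<dots> = (\<Sum>u\<in>words N. \<Sum>g\<in>Pi\<^sub>E {Suc t..n} (\<lambda>_. words N).
      (\<Prod>i\<in>{t..n}. wick (A i) ((g(t := u)) i)) * ?L t (\<lambda>i. if i < t then w i else (g(t := u)) i))"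
    unfolding inner sum_distrib_left ins by (intro sum.cong refl) (simp add: mult.assoc)
  also have "\<dots> = (\<Sum>g\<in>Pi\<^sub>E {t..n} (\<lambda>_. words N). (\<Prod>i\<in>{t..n}. wick (A i) (g i)) *
       ?L t (\<lambda>i. if i < t then w i else g i))"
    unfolding ins by (subst sum_PiE_insert) auto
  finally show ?case .
qed

text \<open>The length bound only serves finiteness: linkings that produce a word longer than its
  monomial have a vanishing \<open>wick\<close> factor.\<close>

definition linkings :: "nat \<Rightarrow> nat \<Rightarrow> (nat \<Rightarrow> nat \<Rightarrow> 'd list) set" where
  "linkings n N = {v. linking n v \<and> (\<forall>i j. length (v i j) \<le> N)}"

lemma finite_linkings: "finite (linkings n N :: (nat \<Rightarrow> nat \<Rightarrow> 'd::finite list) set)"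
proof (rule finite_subset[OF _ finite_bounded_families[of n N]], intro subsetI CollectI conjI allI impI)
  fix v :: "nat \<Rightarrow> nat \<Rightarrow> 'd list" and i j assume v: "v \<in> linkings n N"
  show "length (v i j) \<le> N" using v by (simp add: linkings_def)
  assume "v i j \<noteq> []"
  then have "i \<in> {1..n} \<and> j \<in> {1..n} \<and> i \<noteq> j"
    using v linking_support unfolding linkings_def by blast
  then show "i \<in> {1..n}" "j \<in> {1..n}" by auto
qed

text \<open>The words \<open>g\<close> summed over in \<open>stk_stack\<close> are determined by the
  linking through \<open>cat\<close>, so the double sum collapses to one over \<open>v\<close>.
  Linkings with some word longer than \<open>N\<close> are then added, with contribution 0.\<close>

lemma stk_eq_sum_linkings:
  fixes A :: "nat \<Rightarrow> 'd::finite list"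
  assumes "\<And>i. i \<in> {1..n} \<Longrightarrow> \<kappa> {i} = 1" "\<And>i. i \<in> {1..n} \<Longrightarrow> length (A i) \<le> N"
  shows "stk (cov \<kappa>) [] (concat (map (\<lambda>i. map (Pair i) (A i)) [1..<Suc n])) =
    (\<Sum>v\<in>linkings n N. link_weight n \<kappa> v * (\<Prod>i\<in>{1..n}. wick (A i) (cat n v i)))"
proof -
  let ?P = "Pi\<^sub>E {1..n} (\<lambda>_. words N) :: (nat \<Rightarrow> 'd list) set"
  let ?V = "{v. linking n v \<and> (\<forall>i\<in>{1..n}. length (cat n v i) \<le> N)} :: (nat \<Rightarrow> nat \<Rightarrow> 'd list) set"
  have L: "links n 1 (\<lambda>i. if i < 1 then [] else g i) = {v. linking n v \<and> (\<forall>i\<in>{1..n}. cat n v i = g i)}"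
    for g :: "nat \<Rightarrow> 'd list"
  proof -
    have "\<forall>i j. v i j \<noteq> [] \<longrightarrow> 1 \<le> i \<or> 1 \<le> j" if "linking n v" for v :: "nat \<Rightarrow> nat \<Rightarrow> 'd list"
      using linking_support[OF that] by fastforce
    moreover have "(\<forall>i\<in>{1..n}. cat n v i = (if i < 1 then [] else g i)) \<longleftrightarrow> (\<forall>i\<in>{1..n}. cat n v i = g i)" for v
      by (intro ball_cong) auto
    ultimately show ?thesis unfolding links_def by blast
  qed
  have "stk (cov \<kappa>) [] (concat (map (\<lambda>i. map (Pair i) (A i)) [1..<Suc n])) =
     stk (cov \<kappa>) (stack 1 (\<lambda>_. [])) (concat (map (\<lambda>i. map (Pair i) (A i)) [1..<Suc n]))"
    by (simp add: stack_def del: upt_Suc)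
  also have "\<dots> = (\<Sum>g\<in>?P. (\<Prod>i\<in>{1..n}. wick (A i) (g i)) *
       sum (link_weight n \<kappa>) (links n 1 (\<lambda>i. if i < 1 then [] else g i)))"
    by (rule stk_stack) (use assms in auto)
  also have "\<dots> = (\<Sum>g\<in>?P. \<Sum>v\<in>links n 1 (\<lambda>i. if i < 1 then [] else g i).
       link_weight n \<kappa> v * (\<Prod>i\<in>{1..n}. wick (A i) (cat n v i)))"
  proof (rule sum.cong[OF refl], unfold sum_distrib_left, rule sum.cong[OF refl])
    fix g :: "nat \<Rightarrow> 'd list" and v assume "v \<in> links n 1 (\<lambda>i. if i < 1 then [] else g i)"
    then have "(\<Prod>i\<in>{1..n}. wick (A i) (cat n v i)) = (\<Prod>i\<in>{1..n}. wick (A i) (g i))"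
      unfolding L by (intro prod.cong) auto
    then show "(\<Prod>i\<in>{1..n}. wick (A i) (g i)) * link_weight n \<kappa> v =
        link_weight n \<kappa> v * (\<Prod>i\<in>{1..n}. wick (A i) (cat n v i))" by simp
  qed
  also have "\<dots> = (\<Sum>(g, v)\<in>Sigma ?P (\<lambda>g. links n 1 (\<lambda>i. if i < 1 then [] else g i)).
       link_weight n \<kappa> v * (\<Prod>i\<in>{1..n}. wick (A i) (cat n v i)))"
    by (rule sum.Sigma) (auto intro!: finite_PiE finite_links)
  also have "\<dots> = (\<Sum>v\<in>?V. link_weight n \<kappa> v * (\<Prod>i\<in>{1..n}. wick (A i) (cat n v i)))"
  proof (rule sum.reindex_bij_witness[where i = "\<lambda>v. (restrict (cat n v) {1..n}, v)" and j = snd])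
    fix x assume "x \<in> Sigma ?P (\<lambda>g. links n 1 (\<lambda>i. if i < 1 then [] else g i))"
    then have "x \<in> Sigma ?P (\<lambda>g. {v. linking n v \<and> (\<forall>i\<in>{1..n}. cat n v i = g i)})"
      unfolding L .
    then obtain g v where x: "x = (g, v)" "g \<in> ?P" "linking n v" "\<forall>i\<in>{1..n}. cat n v i = g i"
      by blast
    have "restrict (cat n v) {1..n} = restrict g {1..n}"
      using x(4) by (intro restrict_ext) blast
    also have "\<dots> = g" using x(2) by (simp add: PiE_restrict)
    finally show "(restrict (cat n (snd x)) {1..n}, snd x) = x" using x(1) by simp
    have "length (cat n v i) \<le> N" if "i \<in> {1..n}" for i
      using bspec[OF x(4) that] PiE_mem[OF x(2) that] by simp
    then show "snd x \<in> ?V" using x(1,3) by simp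
  next
    fix v assume v: "v \<in> ?V"
    then have "restrict (cat n v) {1..n} \<in> ?P" by (intro restrict_PiE_iff[THEN iffD2]) simp
    then show "(restrict (cat n v) {1..n}, v) \<in> Sigma ?P (\<lambda>g. links n 1 (\<lambda>i. if i < 1 then [] else g i))"
      using v unfolding L by simp
  qed auto
  also have "\<dots> = (\<Sum>v\<in>linkings n N. link_weight n \<kappa> v * (\<Prod>i\<in>{1..n}. wick (A i) (cat n v i)))"
  proof (rule sum.mono_neutral_left[OF finite_linkings])
    show "?V \<subseteq> linkings n N"
    proof
      fix v assume v: "v \<in> ?V"
      have "length (v i j) \<le> N" for i j
      proof (cases "v i j = []")
        case False
        then have "i \<in> {1..n} \<and> j \<in> {1..n} \<and> i \<noteq> j" using linking_support v by blast
        then show ?thesis using length_le_cat[of j n i v] v by force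
      qed simp
      then show "v \<in> linkings n N" using v by (simp add: linkings_def)
    qed
    show "\<forall>v\<in>linkings n N - ?V. link_weight n \<kappa> v * (\<Prod>i\<in>{1..n}. wick (A i) (cat n v i)) = 0"
    proof
      fix v assume "v \<in> linkings n N - ?V"
      then obtain i where i: "i \<in> {1..n}" "N < length (cat n v i)" unfolding linkings_def by force
      then have "wick (A i) (cat n v i) = 0" using assms(2)[OF i(1)] by (intro wick_eq_0) simp
      then have "(\<Prod>i\<in>{1..n}. wick (A i) (cat n v i)) = 0" using i(1) by (intro prod_zero) auto
      then show "link_weight n \<kappa> v * (\<Prod>i\<in>{1..n}. wick (A i) (cat n v i)) = 0" by simp
    qed
  qed
  finally show ?thesis .
qed

section \<open>Moments of the semicircular family as runs of the machine\<close>

lemma prod_list_eq_stk: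
  fixes \<tau> :: "'a::cstar_algebra \<Rightarrow> complex" and A :: "nat \<Rightarrow> 'd list"
  assumes semi: "jointly_semicircular \<tau> {x i u |i u. i \<in> {1..n}}"
    and cov: "\<And>u v i j. i \<in> {1..n} \<Longrightarrow> j \<in> {1..n} \<Longrightarrow>
           \<tau> (x i u * x j v) = (if u = v then \<kappa> {i, j} else 0)"
  shows "\<tau> (prod_list (map (\<lambda>i. eval_alg (x i) (A i)) [1..<n + 1])) =
    stk (cov \<kappa>) [] (concat (map (\<lambda>i. map (Pair i) (A i)) [1..<Suc n]))"
proof -
  define L where "L = concat (map (\<lambda>i. map (Pair i) (A i)) [1..<Suc n])"
  define k where "k = length L"
  \<comment> \<open>The \<open>p\<close>-th letter of the whole product, tagged by its monomial.
    Positions start at 1 to agree with the ground set of \<open>NCP\<close>.\<close>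
  define z where "z p = L ! (p - 1)" for p
  define y where "y p = x (fst (z p)) (snd (z p))" for p
  have zL: "map z [1..<Suc k] = L"
    unfolding z_def k_def by (intro nth_equalityI) (auto simp del: upt_Suc)
  have setL: "fst p \<in> {1..n}" if "p \<in> set L" for p using that by (auto simp: L_def simp del: upt_Suc)
  have z: "fst (z p) \<in> {1..n}" if "p \<in> {1..k}" for p
    using that setL[of "z p"] unfolding z_def k_def by auto
  have prod: "prod_list (map (\<lambda>i. eval_alg (x i) (A i)) is) =
     prod_list (map (\<lambda>p. x (fst p) (snd p)) (concat (map (\<lambda>i. map (Pair i) (A i)) is)))" for "is"
    by (induction "is") (auto simp: eval_alg_def o_def)
  have "map y [1..<Suc k] = map (\<lambda>p. x (fst p) (snd p)) L"
    unfolding zL[symmetric] y_def by (simp add: o_def del: upt_Suc)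
  then have "\<tau> (prod_list (map (\<lambda>i. eval_alg (x i) (A i)) [1..<n + 1])) = \<tau> (prod_list (map y [1..<Suc k]))"
    unfolding prod L_def by simp
  also have "\<dots> = (\<Sum>\<pi>\<in>NCP k. \<Prod>B\<in>\<pi>. \<tau> (y (Min B) * y (Max B)))"
  proof -
    have "\<forall>p\<in>{1..k}. y p \<in> {x i u |i u. i \<in> {1..n}}" using z unfolding y_def by blast
    then show ?thesis using semi unfolding jointly_semicircular_def by blast
  qed
  also have "\<dots> = (\<Sum>\<pi>\<in>NCP k. \<Prod>B\<in>\<pi>. cov \<kappa> (z (Min B)) (z (Max B)))"
  proof (intro sum.cong prod.cong refl)
    fix \<pi> B assume "\<pi> \<in> NCP k" and B\<pi>: "B \<in> \<pi>"
    then have \<pi>: "\<pi> \<in> ncp {1..k} {}" by (simp only: NCP_eq_ncp)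
    have B: "B \<subseteq> {1..k}" "card B = 2"
      using partition_onD1[OF ncp_partition[OF \<pi>]] ncp_card[OF \<pi> B\<pi>] B\<pi> by auto
    then have "finite B" "B \<noteq> {}" by (auto intro: finite_subset)
    then have "Min B \<in> {1..k}" "Max B \<in> {1..k}" using B(1) Min_in Max_in by blast+
    then show "\<tau> (y (Min B) * y (Max B)) = cov \<kappa> (z (Min B)) (z (Max B))"
      unfolding y_def cov_def by (subst cov[OF z z]) simp_all
  qed
  also have "\<dots> = stk (cov \<kappa>) [] L"
    unfolding sum_NCP_eq_stk zL ..
  finally show ?thesis unfolding L_def .
qed

section \<open>Vacuum expectations with projections\<close>

lemma coord_rcreate_eval_fock: "coord (rcreate (last Q) (eval_fock (butlast Q) \<Omega>)) u = owick Q u"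
  by (simp add: coord_rcreate coord_eval_fock_vacuum owick_def)

lemma vac_state_eval_fock_comp:
  fixes P :: "'d::finite list"
  assumes "length P \<le> N"
  shows "vac_state (eval_fock P \<circ> T) = (\<Sum>u\<in>words N. wick P (rev u) * coord (T \<Omega>) u)"
  using coord_eval_fock_Nil[OF assms] by (simp add: vac_state_coord)

text \<open>Keeping only the annihilation part of the last letter of \<open>P\<close> forces that
  letter to contract with the vector on its right, that is, to stay unpaired inside
  \<open>P\<close>.\<close>

lemma vac_state_butlast_comp:
  fixes P :: "'d::finite list"
  assumes "length P \<le> N" "P \<noteq> []"
  shows "vac_state (eval_fock (butlast P) \<circ> lannihilate (last P) \<circ> T) =
    (\<Sum>u\<in>words N. owick P (rev u) * coord (T \<Omega>) u)"
proof -
  have "vac_state (eval_fock (butlast P) \<circ> lannihilate (last P) \<circ> T) =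
      (\<Sum>u\<in>words N. wick (butlast P) (rev u) * coord (T \<Omega>) (last P # u))"
    using assms(1) coord_eval_fock_Nil[of "butlast P" N]
    by (simp add: vac_state_coord lannihilate_def coord_cadjoint_lcreate)
  also have "\<dots> = (\<Sum>u\<in>words N. if u \<noteq> [] \<and> hd u = last P then
      wick (butlast P) (rev (tl u)) * coord (T \<Omega>) u else 0)"
  proof (rule sum_words_Cons[symmetric])
    fix w :: "'d list" assume "length w = N"
    then show "wick (butlast P) (rev w) = 0"
      using assms by (intro wick_eq_0) (cases P, auto)
  qed
  also have "\<dots> = (\<Sum>u\<in>words N. owick P (rev u) * coord (T \<Omega>) u)"
    by (intro sum.cong) (auto simp: owick_def last_rev butlast_rev)
  finally show ?thesis .
qed

lemma sum_level_swap:
  "(\<Sum>u\<in>words N. X (rev u) * (if length u = l then Y u else 0)) =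
   (\<Sum>u\<in>words N. Y (rev u) * (if length u = l then X u else (0 :: complex)))"
  by (rule sum.reindex_bij_witness[of _ rev rev]) auto

text \<open>Both sides are sums over the words of length \<open>l\<close> of two coefficients, one
  at the word and one at its reversal; the substitution \<open>u\<close> to \<open>rev u\<close>
  exchanges the two operators. An operator with \<open>lannihilate\<close> on the left and one with
  \<open>rcreate\<close> on the right have the same coefficient \<open>owick\<close>.\<close>

lemma trace_identities:
  fixes A B :: "'d::finite monomial"
  shows "vac_state (eval_fock A \<circ> level_proj l \<circ> eval_fock B) =
           vac_state (eval_fock B \<circ> level_proj l \<circ> eval_fock A)"
    and "A \<noteq> [] \<Longrightarrow>
      vac_state (eval_fock (butlast A) \<circ> lannihilate (last A) \<circ> level_proj l \<circ> eval_fock B) =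
      vac_state (eval_fock B \<circ> level_proj l \<circ> rcreate (last A) \<circ> eval_fock (butlast A))"
    and "A \<noteq> [] \<Longrightarrow> B \<noteq> [] \<Longrightarrow>
      vac_state (eval_fock (butlast A) \<circ> lannihilate (last A) \<circ> level_proj l \<circ>
        rcreate (last B) \<circ> eval_fock (butlast B)) =
      vac_state (eval_fock (butlast B) \<circ> lannihilate (last B) \<circ> level_proj l \<circ>
        rcreate (last A) \<circ> eval_fock (butlast A))"
proof -
  define N where "N = length A + length B"
  have N: "length A \<le> N" "length B \<le> N" by (auto simp: N_def)
  note swap = sum_level_swap[of _ l _ N]
  show "vac_state (eval_fock A \<circ> level_proj l \<circ> eval_fock B) =
           vac_state (eval_fock B \<circ> level_proj l \<circ> eval_fock A)"
    unfolding comp_assoc vac_state_eval_fock_comp[OF N(1)] vac_state_eval_fock_comp[OF N(2)]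
    using swap[of "wick A" "wick B"] by (simp add: coord_level_proj coord_eval_fock_vacuum cong: if_cong)
  show "vac_state (eval_fock (butlast A) \<circ> lannihilate (last A) \<circ> level_proj l \<circ> eval_fock B) =
      vac_state (eval_fock B \<circ> level_proj l \<circ> rcreate (last A) \<circ> eval_fock (butlast A))"
    if "A \<noteq> []"
    unfolding comp_assoc vac_state_butlast_comp[OF N(1) that, unfolded comp_assoc] vac_state_eval_fock_comp[OF N(2)]
    using swap[of "owick A" "wick B"]
    by (simp add: coord_level_proj coord_eval_fock_vacuum coord_rcreate_eval_fock cong: if_cong)
  show "vac_state (eval_fock (butlast A) \<circ> lannihilate (last A) \<circ> level_proj l \<circ>
        rcreate (last B) \<circ> eval_fock (butlast B)) =
      vac_state (eval_fock (butlast B) \<circ> lannihilate (last B) \<circ> level_proj l \<circ>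
        rcreate (last A) \<circ> eval_fock (butlast A))" if "A \<noteq> []" "B \<noteq> []"
    unfolding comp_assoc vac_state_butlast_comp[OF N(1) that(1), unfolded comp_assoc]
      vac_state_butlast_comp[OF N(2) that(2), unfolded comp_assoc]
    using swap[of "owick A" "owick B"]
    by (simp add: coord_level_proj coord_rcreate_eval_fock cong: if_cong)
qed

section \<open>The four kinds of factors as one sum over words\<close>

lemma piece_oc_snoc:
  "a < b \<Longrightarrow> piece_oc A a b = piece_oo A a b @ [letter A b]"
  by (simp add: piece_oc_def piece_oo_def)

lemma length_piece_oc: "length (piece_oc A a b) = b - a"
  by (simp add: piece_oc_def del: upt_Suc)

lemma piece_oc_eq: "b \<le> length A \<Longrightarrow> piece_oc A a b = take (b - a) (drop a A)"
  by (intro nth_equalityI) (auto simp: piece_oc_def letter_def simp del: upt_Suc)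

text \<open>The share of \<open>A i\<close> in the factor for the pair \<open>i\<close>,
  \<open>j\<close>. The case distinction singles out the last piece of \<open>A i\<close>, which
  need not end in an unpaired letter; deciding it separately for \<open>i\<close> and for
  \<open>j\<close> produces the four cases of \<open>T_term\<close>.\<close>

definition piece_amp ::
    "nat \<Rightarrow> nat set set \<Rightarrow> (nat \<Rightarrow> 'd monomial) \<Rightarrow> (nat \<times> nat \<Rightarrow> nat) \<Rightarrow> nat \<Rightarrow> nat \<Rightarrow> 'd list \<Rightarrow> complex" where
  "piece_amp n K A k' i j u =
    (let k = extend_index n K A k'; P = piece_oc (A i) (k i (C_pred n K i j)) (k i j)
     in if j = C_pred n K i i then wick P u else owick P u)"

text \<open>\<open>Delta\<close> is diagonal in the word basis with eigenvalue
  \<open>\<kappa> {i, j} ^ length u\<close>, and its series starts at level 1, which removes the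
  empty word. The word \<open>u\<close> plays the part of \<open>v j i\<close>, its reversal that of
  \<open>v i j\<close>. The strict inequalities make a piece treated by \<open>owick\<close>
  nonempty, so that its last letter is the one at the cut.\<close>

lemma T_term_eq_sum:
  fixes A :: "nat \<Rightarrow> 'd::finite monomial" and n :: nat and K :: "nat set set" and k :: "nat \<times> nat \<Rightarrow> nat"
  defines "E \<equiv> extend_index n K A k"
  assumes \<kappa>: "cmod (\<kappa> {i, j}) \<le> 1"
    and N: "E i j \<le> N" "E j i \<le> N"
    and lt: "j \<noteq> C_pred n K i i \<Longrightarrow> E i (C_pred n K i j) < E i j"
      "i \<noteq> C_pred n K j j \<Longrightarrow> E j (C_pred n K j i) < E j i"
  shows "T_term n K A \<kappa> k i j = (\<Sum>u\<in>words N - {[]}.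
    \<kappa> {i, j} ^ length u * (piece_amp n K A k i j (rev u) * piece_amp n K A k j i u))"
proof -
  define P where "P = piece_oc (A i) (E i (C_pred n K i j)) (E i j)"
  define Q where "Q = piece_oc (A j) (E j (C_pred n K j i)) (E j i)"
  have len: "length P \<le> N" "length Q \<le> N"
    using N by (auto simp: P_def Q_def length_piece_oc)
  define p where "p \<longleftrightarrow> j = C_pred n K i i"
  define q where "q \<longleftrightarrow> i = C_pred n K j j"
  have P: "piece_oo (A i) (E i (C_pred n K i j)) (E i j) = butlast P" "letter (A i) (E i j) = last P" "P \<noteq> []"
    if "\<not> p"
    using piece_oc_snoc[OF lt(1)[OF that[unfolded p_def]], of "A i"] by (simp_all add: P_def)
  have Q: "piece_oo (A j) (E j (C_pred n K j i)) (E j i) = butlast Q" "letter (A j) (E j i) = last Q" "Q \<noteq> []"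
    if "\<not> q"
    using piece_oc_snoc[OF lt(2)[OF that[unfolded q_def]], of "A j"] by (simp_all add: Q_def)
  have Delta: "coord (Delta (\<kappa> {i, j}) f) w = (if w = [] then 0 else \<kappa> {i, j} ^ length w * coord f w)" for f w
    by (rule Delta_has_sum(2)[OF \<kappa>])
  have amp: "piece_amp n K A k i j u = (if p then wick P u else owick P u)"
    "piece_amp n K A k j i u = (if q then wick Q u else owick Q u)" for u
    unfolding piece_amp_def Let_def E_def[symmetric] P_def[symmetric] Q_def[symmetric] p_def q_def by simp_all
  have sum: "(\<Sum>u\<in>words N. X (rev u) * (if u = [] then 0 else \<kappa> {i, j} ^ length u * Y u)) =
      (\<Sum>u\<in>words N - {[]}. \<kappa> {i, j} ^ length u * (X (rev u) * Y u))" for X Y :: "'d list \<Rightarrow> complex"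
    by (rule sum.mono_neutral_cong_right) auto
  have T: "T_term n K A \<kappa> k i j = (if p \<and> q then
          vac_state (eval_fock P \<circ> (Delta (\<kappa> {i, j}) \<circ> eval_fock Q))
        else if \<not> p \<and> q then
          vac_state (eval_fock (butlast P) \<circ> lannihilate (last P) \<circ> (Delta (\<kappa> {i, j}) \<circ> eval_fock Q))
        else if p \<and> \<not> q then
          vac_state (eval_fock P \<circ> (Delta (\<kappa> {i, j}) \<circ> rcreate (last Q) \<circ> eval_fock (butlast Q)))
        else
          vac_state (eval_fock (butlast P) \<circ> lannihilate (last P) \<circ>
            (Delta (\<kappa> {i, j}) \<circ> rcreate (last Q) \<circ> eval_fock (butlast Q))))"
    unfolding T_term_def Let_def E_def[symmetric] P_def[symmetric] Q_def[symmetric] p_def[symmetric] q_def[symmetric]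
    by (cases p; cases q) (simp_all add: P(1,2) Q(1,2) comp_assoc)
  show ?thesis
    unfolding T amp comp_assoc
    by (cases "p"; cases "q")
      (simp_all add: vac_state_eval_fock_comp[OF len(1)] vac_state_butlast_comp[OF len(1) P(3), unfolded comp_assoc]
        Delta coord_eval_fock_vacuum coord_rcreate_eval_fock sum cong: if_cong)
qed

section \<open>Cutting a monomial\<close>

text \<open>What \<open>cyc_C\<close> lists before its final entry \<open>i\<close>. When it is
  nonempty, its head is the successor of \<open>i\<close>, its last entry the predecessor of
  \<open>i\<close>, and dropping that last entry leaves \<open>cyc_Css\<close>.\<close>

definition nbrs :: "nat \<Rightarrow> nat set set \<Rightarrow> nat \<Rightarrow> nat list" where
  "nbrs n K i = filter (\<lambda>j. {i, j} \<in> K) (cyc_after n i)"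

lemma distinct_nbrs: "distinct (nbrs n K i)"
  by (auto simp: nbrs_def cyc_after_def)

lemma set_nbrs: "i \<in> {1..n} \<Longrightarrow> set (nbrs n K i) = {j \<in> {1..n} - {i}. {i, j} \<in> K}"
  by (auto simp: nbrs_def set_cyc_after)

lemma cyc_C_eq:
  assumes "i \<in> {1..n}"
  shows "cyc_C n K i = nbrs n K i @ [i]"
proof -
  have "[i..<n + 1] = i # [i + 1..<n + 1]" using assms by (simp add: upt_conv_Cons del: upt_Suc)
  then have "cyc_C n K i = filter (\<lambda>j. j = i \<or> {i, j} \<in> K) (cyc_after n i) @ [i]"
    by (simp add: cyc_C_def cyc_after_def rev_filter del: upt_Suc)
  also have "filter (\<lambda>j. j = i \<or> {i, j} \<in> K) (cyc_after n i) = nbrs n K i"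
    unfolding nbrs_def using set_cyc_after[OF assms] by (intro filter_cong) auto
  finally show ?thesis .
qed

lemma cyc_pred_nth:
  assumes "distinct c" "r < length c"
  shows "cyc_pred c (c ! (Suc r mod length c)) = c ! r"
proof -
  have "map_of (zip (rotate1 c) c) (rotate1 c ! r) = Some (c ! r)"
    using assms by (intro map_of_zip_nth) auto
  then show ?thesis using assms by (simp add: cyc_pred_def nth_rotate1)
qed

lemma distinct_cyc_C: "i \<in> {1..n} \<Longrightarrow> distinct (nbrs n K i @ [i])"
  using distinct_nbrs[of n K i] set_nbrs[of i n K] by simp

lemma C_pred_self:
  assumes "i \<in> {1..n}" "nbrs n K i \<noteq> []"
  shows "C_pred n K i i = last (nbrs n K i)"
proof -
  let ?D = "nbrs n K i"
  have "length ?D - 1 < length (?D @ [i])" by simp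
  from cyc_pred_nth[OF distinct_cyc_C[OF assms(1)] this]
  show ?thesis using assms
    by (simp add: C_pred_def cyc_C_eq last_conv_nth nth_append)
qed

lemma C_pred_nth:
  assumes "i \<in> {1..n}" "r < length (nbrs n K i)"
  shows "C_pred n K i (nbrs n K i ! r) = (if r = 0 then i else nbrs n K i ! (r - 1))"
proof (cases r)
  case 0
  have "length (nbrs n K i) < length (nbrs n K i @ [i])" by simp
  from cyc_pred_nth[OF distinct_cyc_C[OF assms(1)] this]
  show ?thesis using assms 0 by (simp add: C_pred_def cyc_C_eq nth_append)
next
  case (Suc s)
  then have "s < length (nbrs n K i @ [i])" using assms by simp
  from cyc_pred_nth[OF distinct_cyc_C[OF assms(1)] this]
  show ?thesis using assms Suc by (simp add: C_pred_def cyc_C_eq nth_append)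
qed

lemma cyc_Css_eq:
  assumes "i \<in> {1..n}"
  shows "cyc_Css n K i = butlast (nbrs n K i)"
proof (cases "nbrs n K i" rule: rev_cases)
  case Nil
  then show ?thesis using assms by (simp add: cyc_Css_def cyc_C_eq)
next
  case (snoc D j)
  have i: "i \<notin> set (nbrs n K i)" using set_nbrs[OF assms] by simp
  have "j \<notin> set D" using distinct_nbrs[of n K i] snoc by simp
  have p: "C_pred n K i i = j" using C_pred_self[OF assms, of K] snoc by simp
  have "filter (\<lambda>k. k \<noteq> i \<and> k \<noteq> j) D = D"
    using i \<open>j \<notin> set D\<close> snoc by (intro filter_True) auto
  then show ?thesis unfolding cyc_Css_def p cyc_C_eq[OF assms] snoc by simp
qed

lemma extend_index_eq:
  assumes "i \<in> {1..n}" "nbrs n K i \<noteq> []"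
  shows "extend_index n K A k i j = (if j = i then 0 else if j = last (nbrs n K i) then length (A i) else k (i, j))"
  using assms by (simp add: extend_index_def cyc_C_eq C_pred_self)

text \<open>The cut positions of a single monomial. The lower end \<open>a\<close> is a parameter
  because it moves to the latest cut in the recursion. An empty \<open>E\<close> imposes no
  inequality, so a monomial with one neighbour may have degree 0.\<close>

definition cuts :: "nat \<Rightarrow> nat list \<Rightarrow> nat \<Rightarrow> (nat \<Rightarrow> nat) set" where
  "cuts a E m = {f \<in> extensional (set E). E \<noteq> [] \<longrightarrow> sorted_wrt (<) ([a] @ map f E @ [m])}"

lemma finite_cuts: "finite (cuts a E m)"
proof (rule finite_subset)
  show "cuts a E m \<subseteq> Pi\<^sub>E (set E) (\<lambda>_. {..m})"
  proof (intro subsetI PiE_I)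
    fix f j assume f: "f \<in> cuts a E m"
    show "f j \<in> {..m}" if "j \<in> set E"
      using f that by (cases "E = []") (auto simp: cuts_def sorted_wrt_append less_imp_le)
    show "f j = undefined" if "j \<notin> set E"
      using f that by (simp add: cuts_def extensional_def)
  qed
qed (auto intro: finite_PiE)

fun cutprod :: "'d list \<Rightarrow> (nat \<Rightarrow> nat) \<Rightarrow> (nat \<Rightarrow> 'd list) \<Rightarrow> nat \<Rightarrow> nat list \<Rightarrow> complex" where
  "cutprod A f v a [] = 1"
| "cutprod A f v a [j] = wick (piece_oc A a (length A)) (v j)"
| "cutprod A f v a (j # j' # D) = owick (piece_oc A a (f j)) (v j) * cutprod A f v (f j) (j' # D)"

lemma cutprod_cong:
  "(\<And>j. j \<in> set (butlast D) \<Longrightarrow> f j = f' j) \<Longrightarrow> cutprod A f v a D = cutprod A f' v a D"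
  by (induction A f v a D rule: cutprod.induct) auto

lemma sum_cuts_Cons:
  assumes "j \<notin> set E"
  shows "sum F (cuts a (j # E) m) = (\<Sum>b\<in>{a<..<m}. \<Sum>f\<in>cuts b E m. F (f(j := b)))"
proof -
  have "(\<Sum>b\<in>{a<..<m}. \<Sum>f\<in>cuts b E m. F (f(j := b))) =
      (\<Sum>(b, f)\<in>Sigma {a<..<m} (\<lambda>b. cuts b E m). F (f(j := b)))"
    by (rule sum.Sigma) (auto simp: finite_cuts)
  also have "\<dots> = sum F (cuts a (j # E) m)"
  proof (rule sum.reindex_bij_witness[where j = "\<lambda>(b, f). f(j := b)" and i = "\<lambda>f. (f j, f(j := undefined))"])
    fix x assume "x \<in> Sigma {a<..<m} (\<lambda>b. cuts b E m)"
    then obtain b f where x: "x = (b, f)" "a < b" "b < m" "f \<in> cuts b E m" by auto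
    have fj: "f j = undefined" using x(4) assms by (auto simp: cuts_def extensional_def)
    show "(\<lambda>f. (f j, f(j := undefined))) (case x of (b, f) \<Rightarrow> f(j := b)) = x"
      using x(1) fj by auto
    have m: "map (f(j := b)) E = map f E" using assms by (intro map_cong) auto
    show "(case x of (b, f) \<Rightarrow> f(j := b)) \<in> cuts a (j # E) m"
      using x assms by (cases "E = []") (auto simp: cuts_def extensional_def m simp del: map_eq_conv)
  next
    fix f assume f: "f \<in> cuts a (j # E) m"
    show "(case (f j, f(j := undefined)) of (b, f) \<Rightarrow> f(j := b)) = f" by simp
    have m: "map (f(j := undefined)) E = map f E" using assms by (intro map_cong) auto
    show "(f j, f(j := undefined)) \<in> Sigma {a<..<m} (\<lambda>b. cuts b E m)"
      using f assms by (auto simp: cuts_def extensional_def m simp del: map_eq_conv)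
  qed auto
  finally show ?thesis by simp
qed

text \<open>Repeated use of \<open>wick_append\<close>: the factors of the word are split off one by
  one, and \<open>f j\<close> is the position of the last letter of the factor
  \<open>v j\<close>.\<close>

lemma sum_cutprod:
  assumes "distinct D" "D \<noteq> []" "\<And>j. j \<in> set D \<Longrightarrow> v j \<noteq> []" "a \<le> length A"
  shows "(\<Sum>f\<in>cuts a (butlast D) (length A). cutprod A f v a D) = wick (drop a A) (concat (map v D))"
  using assms
proof (induction D arbitrary: a rule: induct_list012)
  case 1
  then show ?case by simp
next
  case (2 j)
  have "cuts a [] (length A) = {\<lambda>_. undefined}" by (auto simp: cuts_def)
  then show ?case by (simp add: piece_oc_eq)
next
  case (3 j j' D)
  let ?D = "j' # D" and ?m = "length A"
  let ?u = "concat (map v ?D)"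
  have ne: "v j \<noteq> []" "?u \<noteq> []" using 3 by auto
  have j: "j \<notin> set (butlast ?D)" using 3 by (auto dest: in_set_butlastD)
  have "(\<Sum>f\<in>cuts a (butlast (j # ?D)) ?m. cutprod A f v a (j # ?D)) =
      (\<Sum>b\<in>{a<..<?m}. \<Sum>f\<in>cuts b (butlast ?D) ?m. cutprod A (f(j := b)) v a (j # ?D))"
    using sum_cuts_Cons[OF j, of "\<lambda>f. cutprod A f v a (j # ?D)"] by simp
  also have "\<dots> = (\<Sum>b\<in>{a<..<?m}. owick (piece_oc A a b) (v j) * wick (drop b A) ?u)"
  proof (rule sum.cong[OF refl])
    fix b assume b: "b \<in> {a<..<?m}"
    have c: "cutprod A (f(j := b)) v b ?D = cutprod A f v b ?D" for f
      using j by (intro cutprod_cong) auto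
    have "(\<Sum>f\<in>cuts b (butlast ?D) ?m. cutprod A f v b ?D) = wick (drop b A) ?u"
      using 3 b by (intro "3.IH"(2)) auto
    then show "(\<Sum>f\<in>cuts b (butlast ?D) ?m. cutprod A (f(j := b)) v a (j # ?D)) =
       owick (piece_oc A a b) (v j) * wick (drop b A) ?u"
      using c by (simp add: sum_distrib_left[symmetric])
  qed
  \<comment> \<open>A cut at the very end leaves nothing for the nonempty remaining word, so adding
    \<open>b = length A\<close> changes nothing; it completes the range needed by
    \<open>wick_append\<close>.\<close>
  also have "\<dots> = (\<Sum>b\<in>{a<..?m}. owick (piece_oc A a b) (v j) * wick (drop b A) ?u)"
  proof (rule sum.mono_neutral_left)
    show "\<forall>b\<in>{a<..?m} - {a<..<?m}. owick (piece_oc A a b) (v j) * wick (drop b A) ?u = 0"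
    proof
      fix b assume "b \<in> {a<..?m} - {a<..<?m}"
      then have "drop b A = []" by auto
      then show "owick (piece_oc A a b) (v j) * wick (drop b A) ?u = 0"
        using ne(2) by (simp only: wick.simps if_False mult_zero_right)
    qed
  qed auto
  \<comment> \<open>Cuts are positions in \<open>A\<close> counted from 1, while \<open>r\<close>
    counts from 0 in \<open>drop a A\<close>; hence \<open>b = a + Suc r\<close>.\<close>
  also have "\<dots> = (\<Sum>r<length (drop a A). owick (take (Suc r) (drop a A)) (v j) * wick (drop (Suc r) (drop a A)) ?u)"
    by (rule sum.reindex_bij_witness[where i = "\<lambda>r. a + Suc r" and j = "\<lambda>b. b - Suc a"])
      (auto simp: piece_oc_eq Suc_diff_Suc)
  also have "\<dots> = wick (drop a A) (v j @ ?u)"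
    by (rule wick_append[OF ne, symmetric])
  finally show ?case by simp
qed

lemma cutprod_nth:
  "D \<noteq> [] \<Longrightarrow> cutprod A f v a D = (\<Prod>r<length D.
    let l = (if r = 0 then a else f (D ! (r - 1))) in
    if Suc r = length D then wick (piece_oc A l (length A)) (v (D ! r))
    else owick (piece_oc A l (f (D ! r))) (v (D ! r)))"
proof (induction A f v a D rule: cutprod.induct)
  case (3 A f v a j j' D)
  show ?case
    unfolding cutprod.simps 3(1)[OF list.simps(3)]
    by (subst (2) length_Cons, subst prod.lessThan_Suc_shift)
      (auto simp: Let_def nth_Cons' intro!: prod.cong)
qed auto

lemma prod_piece_amp:
  assumes "i \<in> {1..n}" "nbrs n K i \<noteq> []"
  shows "(\<Prod>j\<in>set (nbrs n K i). piece_amp n K A k i j (v j)) =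
    cutprod (A i) (\<lambda>j\<in>set (butlast (nbrs n K i)). k (i, j)) v 0 (nbrs n K i)"
proof -
  let ?D = "nbrs n K i"
  have i: "i \<notin> set ?D" using set_nbrs[OF assms(1)] by simp
  have dist: "distinct ?D" by (rule distinct_nbrs)
  have lst: "?D ! r = last ?D \<longleftrightarrow> Suc r = length ?D" if "r < length ?D" for r
    using that dist assms(2) by (auto simp: last_conv_nth nth_eq_iff_index_eq)
  have E: "extend_index n K A k i (?D ! r) = (if Suc r = length ?D then length (A i) else k (i, ?D ! r))"
    if "r < length ?D" for r
  proof -
    have "?D ! r \<noteq> i" using that i nth_mem by metis
    then show ?thesis using that by (simp add: extend_index_eq[OF assms] lst)
  qed
  have E0: "extend_index n K A k i i = 0" by (simp add: extend_index_eq[OF assms])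
  have "cutprod (A i) (\<lambda>j\<in>set (butlast ?D). k (i, j)) v 0 ?D = cutprod (A i) (\<lambda>j. k (i, j)) v 0 ?D"
    by (rule cutprod_cong) simp
  also have "\<dots> = (\<Prod>r<length ?D. piece_amp n K A k i (?D ! r) (v (?D ! r)))"
    unfolding cutprod_nth[OF assms(2)]
  proof (rule prod.cong[OF refl])
    fix r assume "r \<in> {..<length ?D}"
    then have r: "r < length ?D" by simp
    have "extend_index n K A k i (C_pred n K i (?D ! r)) = (if r = 0 then 0 else k (i, ?D ! (r - 1)))"
      using r E[of "r - 1"] by (simp add: C_pred_nth[OF assms(1) r] E0)
    then show "(let l = (if r = 0 then 0 else k (i, ?D ! (r - 1))) in
        if Suc r = length ?D then wick (piece_oc (A i) l (length (A i))) (v (?D ! r))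
        else owick (piece_oc (A i) l (k (i, ?D ! r))) (v (?D ! r))) =
        piece_amp n K A k i (?D ! r) (v (?D ! r))"
      unfolding piece_amp_def Let_def C_pred_self[OF assms] lst[OF r] E[OF r] by simp
  qed
  also have "\<dots> = (\<Prod>j\<in>set ?D. piece_amp n K A k i j (v j))"
    by (rule prod.reindex_bij_betw[OF bij_betw_nth[OF dist refl refl], of "\<lambda>j. piece_amp n K A k i j (v j)"])
  finally show ?thesis by simp
qed

section \<open>Configurations\<close>

text \<open>The two circular intervals with ends \<open>k\<close> and \<open>l\<close> are the two
  arcs they cut out. A pair fits into neither arc exactly when its ends alternate with
  \<open>k\<close> and \<open>l\<close>, which in the linear order is the crossing pattern excluded
  by \<open>linking\<close>.\<close>

lemma configurations_iff:
  "K \<in> configurations n \<longleftrightarrow> K \<subseteq> {{i, j} |i j. i \<in> {1..n} \<and> j \<in> {1..n} \<and> i \<noteq> j} \<and>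
     (\<forall>a b c d. a < b \<longrightarrow> b < c \<longrightarrow> c < d \<longrightarrow> {a, c} \<in> K \<longrightarrow> {b, d} \<notin> K)" (is "_ \<longleftrightarrow> ?P \<and> ?Q")
proof
  assume K: "K \<in> configurations n"
  have "{b, d} \<notin> K" if "a < b" "b < c" "c < d" "{a, c} \<in> K" for a b c d
  proof
    assume "{b, d} \<in> K"
    then have "{a, c} \<subseteq> circ_interval n b d \<or> {a, c} \<subseteq> circ_interval n d b"
      using conjunct2[OF K[unfolded configurations_def mem_Collect_eq]] that(4) \<open>{b, d} \<in> K\<close>
      by (elim allE impE) assumption+
    then show False using that by (auto simp: circ_interval_def)
  qed
  then have "?Q" by (intro allI impI)
  moreover have "?P" using K unfolding configurations_def mem_Collect_eq by (rule conjunct1)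
  ultimately show "?P \<and> ?Q" by (rule conjI[rotated])
next
  assume K: "?P \<and> ?Q"
  have range: "i \<in> {1..n} \<and> j \<in> {1..n} \<and> i \<noteq> j" if e: "{i, j} \<in> K" for i j
  proof -
    obtain p q where "{i, j} = {p, q}" "p \<in> {1..n}" "q \<in> {1..n}" "p \<noteq> q"
      using subsetD[OF conjunct1[OF K] e] unfolding mem_Collect_eq by (elim exE conjE)
    then show ?thesis by (auto simp: doubleton_eq_iff)
  qed
  have nc: False if "a < b" "b < c" "c < d" "{a, c} \<in> K" "{b, d} \<in> K" for a b c d
    using conjunct2[OF K] that by (elim allE impE notE) assumption+
  have ordered: "{i, j} \<subseteq> circ_interval n k l \<or> {i, j} \<subseteq> circ_interval n l k"
    if ij: "{i, j} \<in> K" "i < j" and kl: "{k, l} \<in> K" "k < l" for i j k l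
  proof -
    have "\<not> (i < k \<and> k < j \<and> j < l)" "\<not> (k < i \<and> i < l \<and> l < j)"
      using nc[of i k j l, OF _ _ _ ij(1) kl(1)] nc[of k i l j, OF _ _ _ kl(1) ij(1)] by blast+
    then have "k \<le> i \<and> j \<le> l \<or> (j \<le> k \<or> l \<le> j) \<and> (i \<le> k \<or> l \<le> i)" using ij(2) by linarith
    then show ?thesis using range[OF ij(1)] ij(2) kl(2) by (auto simp: circ_interval_def)
  qed
  have "{i, j} \<subseteq> circ_interval n k l \<or> {i, j} \<subseteq> circ_interval n l k"
    if ij: "{i, j} \<in> K" and kl: "{k, l} \<in> K" for i j k l
  proof -
    have one: "{i, j} \<subseteq> circ_interval n k l \<or> {i, j} \<subseteq> circ_interval n l k"
      if "{k, l} \<in> K" "k < l" for k l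
      using ordered[of i j k l] ordered[of j i k l] ij that range[OF ij]
      by (metis insert_commute linorder_neqE_nat)
    show ?thesis using one[of k l] one[of l k] kl range[OF kl] by (metis insert_commute linorder_neqE_nat)
  qed
  then have "\<forall>i j k l. {i, j} \<in> K \<longrightarrow> {k, l} \<in> K \<longrightarrow>
        {i, j} \<subseteq> circ_interval n k l \<or> {i, j} \<subseteq> circ_interval n l k"
    by (intro allI impI)
  then show "K \<in> configurations n"
    unfolding configurations_def mem_Collect_eq by (rule conjI[OF conjunct1[OF K]])
qed

lemma configurations_edge:
  assumes "K \<in> configurations n" "{i, j} \<in> K"
  shows "i \<in> {1..n}" "j \<in> {1..n}" "i \<noteq> j"
proof -
  obtain p q where "{i, j} = {p, q}" "p \<in> {1..n}" "q \<in> {1..n}" "p \<noteq> q"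
    using subsetD[OF conjunct1[OF assms(1)[unfolded configurations_iff]] assms(2)]
    unfolding mem_Collect_eq by (elim exE conjE)
  then show "i \<in> {1..n}" "j \<in> {1..n}" "i \<noteq> j" by (auto simp: doubleton_eq_iff)
qed

definition link_support :: "(nat \<Rightarrow> nat \<Rightarrow> 'd list) \<Rightarrow> nat set set" where
  "link_support v = {{i, j} |i j. v i j \<noteq> []}"

lemma mem_link_support: "linking n v \<Longrightarrow> {i, j} \<in> link_support v \<longleftrightarrow> v i j \<noteq> []"
  unfolding link_support_def using linking_sym[of n v i j] by (auto simp: doubleton_eq_iff)

lemma link_support_configurations:
  assumes "linking n v"
  shows "link_support v \<in> configurations n"
  unfolding configurations_iff mem_link_support[OF assms]
proof (intro conjI allI impI)
  show "link_support v \<subseteq> {{i, j} |i j. i \<in> {1..n} \<and> j \<in> {1..n} \<and> i \<noteq> j}"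
    unfolding link_support_def using linking_support[OF assms] by blast
  show "\<not> v b d \<noteq> []" if "a < b" "b < c" "c < d" "v a c \<noteq> []" for a b c d
    using linking_noncrossing[OF assms that(1-3)] that(4) by blast
qed

definition edges :: "nat set set \<Rightarrow> (nat \<times> nat) set" where
  "edges K = {(i, j). {i, j} \<in> K \<and> i < j}"

lemma finite_edges: "K \<in> configurations n \<Longrightarrow> finite (edges K)"
  by (rule finite_subset[of _ "{1..n} \<times> {1..n}"]) (auto simp: edges_def dest: configurations_edge)

text \<open>Each unordered pair gives one factor to either end. Collecting the factors by ends
  brings together all pieces of one monomial, which the sum over its cuts requires.\<close>

lemma prod_edges:
  fixes h :: "nat \<Rightarrow> nat \<Rightarrow> complex"
  assumes K: "K \<in> configurations n"
  shows "(\<Prod>(i, j)\<in>edges K. h i j * h j i) = (\<Prod>i\<in>{1..n}. \<Prod>j\<in>set (nbrs n K i). h i j)"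
proof -
  have "(\<Prod>i\<in>{1..n}. \<Prod>j\<in>set (nbrs n K i). h i j) =
      (\<Prod>(i, j)\<in>Sigma {1..n} (\<lambda>i. set (nbrs n K i)). h i j)"
    by (rule prod.Sigma) auto
  also have "Sigma {1..n} (\<lambda>i. set (nbrs n K i)) = edges K \<union> prod.swap ` edges K"
  proof (intro set_eqI iffI)
    fix x assume "x \<in> Sigma {1..n} (\<lambda>i. set (nbrs n K i))"
    then obtain i j where x: "x = (i, j)" "{i, j} \<in> K" "i \<noteq> j" using set_nbrs[of _ n K] by blast
    then have "(i, j) \<in> edges K \<or> (j, i) \<in> edges K"
      unfolding edges_def by (auto simp: insert_commute)
    then show "x \<in> edges K \<union> prod.swap ` edges K" using x(1) by force
  next
    fix x assume "x \<in> edges K \<union> prod.swap ` edges K"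
    then obtain i j where x: "x = (i, j)" "{i, j} \<in> K"
      unfolding edges_def by (auto simp: insert_commute)
    then show "x \<in> Sigma {1..n} (\<lambda>i. set (nbrs n K i))"
      using configurations_edge[OF K x(2)] set_nbrs[of i n K] by auto
  qed
  also have "(\<Prod>(i, j)\<in>edges K \<union> prod.swap ` edges K. h i j) =
      (\<Prod>(i, j)\<in>edges K. h i j) * (\<Prod>(i, j)\<in>prod.swap ` edges K. h i j)"
    using finite_edges[OF K] by (intro prod.union_disjoint) (auto simp: edges_def)
  also have "(\<Prod>(i, j)\<in>prod.swap ` edges K. h i j) = (\<Prod>(i, j)\<in>edges K. h j i)"
    by (subst prod.reindex) (auto simp: case_prod_unfold)
  finally show ?thesis by (simp add: prod.distrib[symmetric] case_prod_unfold)
qed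

text \<open>The noncrossing condition concerns only which words are nonempty. A linking with support
  \<open>K\<close> is therefore a free choice of one nonempty word per edge, and the product of sums
  expands accordingly.\<close>

lemma prod_sum_linkings:
  fixes h :: "nat \<Rightarrow> nat \<Rightarrow> 'd::finite list \<Rightarrow> complex"
  assumes K: "K \<in> configurations n"
  shows "(\<Prod>(i, j)\<in>edges K. \<Sum>u\<in>words N - {[]}. h i j u) =
    (\<Sum>v\<in>{v \<in> linkings n N. link_support v = K}. \<Prod>(i, j)\<in>edges K. h i j (v j i))"
proof -
  let ?E = "edges K"
  \<comment> \<open>For an edge with \<open>i < j\<close> the chosen word is \<open>v j i\<close>,
    matching the role of \<open>u\<close> in \<open>T_term_eq_sum\<close>; the opposite direction
    carries its reversal.\<close>
  define V where "V g i j = (if (i, j) \<in> ?E then rev (g (i, j)) else if (j, i) \<in> ?E then g (j, i) else [])"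
    for g :: "nat \<times> nat \<Rightarrow> 'd list" and i j
  have asym: "(i, j) \<in> ?E \<Longrightarrow> (j, i) \<notin> ?E" for i j by (auto simp: edges_def)
  have edge: "{i, j} \<in> K \<longleftrightarrow> (i, j) \<in> ?E \<or> (j, i) \<in> ?E" for i j
    using configurations_edge(3)[OF K, of i j] by (auto simp: edges_def insert_commute)
  have V: "V g \<in> {v \<in> linkings n N. link_support v = K}" if g: "g \<in> Pi\<^sub>E ?E (\<lambda>_. words N - {[]})" for g
  proof -
    have ge: "g e \<noteq> []" "length (g e) \<le> N" if "e \<in> ?E" for e using PiE_mem[OF g that] by auto
    have ne: "V g i j \<noteq> [] \<longleftrightarrow> {i, j} \<in> K" for i j
      unfolding edge V_def using ge by simp
    have l: "linking n (V g)"
      unfolding linking_def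
    proof (intro conjI allI impI)
      fix i j
      show "i \<in> {1..n}" "j \<in> {1..n}" "i \<noteq> j" if "V g i j \<noteq> []"
        using that configurations_edge[OF K, of i j] unfolding ne by auto
      show "V g j i = rev (V g i j)" using asym[of i j] by (simp add: V_def)
    next
      fix a b c d :: nat assume "a < b" "b < c" "c < d"
      then have "\<not> ({a, c} \<in> K \<and> {b, d} \<in> K)" using K unfolding configurations_iff by blast
      then show "V g a c = [] \<or> V g b d = []" using ne by blast
    qed
    have "length (V g i j) \<le> N" for i j using ge by (simp add: V_def)
    moreover have "link_support (V g) = K"
    proof
      show "link_support (V g) \<subseteq> K" unfolding link_support_def ne by blast
      show "K \<subseteq> link_support (V g)"
      proof
        fix e assume e: "e \<in> K"
        then obtain i j where ij: "e = {i, j}" using K unfolding configurations_def by blast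
        have "{i, j} \<in> link_support (V g)" using e unfolding ij mem_link_support[OF l] ne .
        then show "e \<in> link_support (V g)" using ij by simp
      qed
    qed
    ultimately show ?thesis using l by (simp add: linkings_def)
  qed
  have "(\<Prod>(i, j)\<in>?E. \<Sum>u\<in>words N - {[]}. h i j u) =
      (\<Prod>e\<in>?E. \<Sum>u\<in>words N - {[]}. h (fst e) (snd e) u)"
    by (simp add: case_prod_unfold)
  also have "\<dots> = (\<Sum>g\<in>Pi\<^sub>E ?E (\<lambda>_. words N - {[]}). \<Prod>e\<in>?E. h (fst e) (snd e) (g e))"
    by (rule prod_sum_PiE) (auto simp: finite_edges[OF K])
  also have "\<dots> = (\<Sum>v\<in>{v \<in> linkings n N. link_support v = K}. \<Prod>(i, j)\<in>?E. h i j (v j i))"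
  proof (rule sum.reindex_bij_witness[where j = V and i = "\<lambda>v. restrict (\<lambda>(i, j). v j i) ?E"])
    fix g :: "nat \<times> nat \<Rightarrow> 'd list" assume g: "g \<in> Pi\<^sub>E ?E (\<lambda>_. words N - {[]})"
    have Vg: "V g j i = g (i, j)" if "(i, j) \<in> ?E" for i j using that asym[OF that] by (simp add: V_def)
    have "restrict (\<lambda>(i, j). V g j i) ?E = restrict g ?E" by (rule restrict_ext) (auto simp: Vg)
    then show "restrict (\<lambda>(i, j). V g j i) ?E = g" using g by (simp add: PiE_restrict)
    show "V g \<in> {v \<in> linkings n N. link_support v = K}" by (rule V[OF g])
    show "(\<Prod>(i, j)\<in>?E. h i j (V g j i)) = (\<Prod>e\<in>?E. h (fst e) (snd e) (g e))"
      by (rule prod.cong) (auto simp: Vg)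
  next
    fix v :: "nat \<Rightarrow> nat \<Rightarrow> 'd list" assume "v \<in> {v \<in> linkings n N. link_support v = K}"
    then have l: "linking n v" and len: "\<And>i j. length (v i j) \<le> N" and s: "link_support v = K"
      by (auto simp: linkings_def)
    have ne: "v i j \<noteq> [] \<longleftrightarrow> (i, j) \<in> ?E \<or> (j, i) \<in> ?E" for i j
      using mem_link_support[OF l, of i j] unfolding s edge by simp
    show "V (restrict (\<lambda>(i, j). v j i) ?E) = v"
    proof (intro ext)
      fix i j
      show "V (restrict (\<lambda>(i, j). v j i) ?E) i j = v i j"
        using ne[of i j] linking_rev[OF l, of i j] unfolding V_def by auto
    qed
    show "restrict (\<lambda>(i, j). v j i) ?E \<in> Pi\<^sub>E ?E (\<lambda>_. words N - {[]})"
      using ne len by (intro restrict_PiE_iff[THEN iffD2]) auto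
  qed
  finally show ?thesis .
qed

section \<open>Factorization of the sum over the cuts\<close>

lemma index_families_eq:
  "index_families n K A = {k \<in> extensional (Sigma {1..n} (\<lambda>i. set (butlast (nbrs n K i)))).
     \<forall>i\<in>{1..n}. (\<lambda>j\<in>set (butlast (nbrs n K i)). k (i, j)) \<in> cuts 0 (butlast (nbrs n K i)) (length (A i))}"
proof -
  have I: "{(i, j). i \<in> {1..n} \<and> j \<in> set (cyc_Css n K i)} = Sigma {1..n} (\<lambda>i. set (butlast (nbrs n K i)))"
    by (auto simp: cyc_Css_eq)
  have c: "(cyc_Css n K i \<noteq> [] \<longrightarrow>
       sorted_wrt (<) ([0] @ map (\<lambda>j. k (i, j)) (cyc_Css n K i) @ [length (A i)])) \<longleftrightarrow>
     (\<lambda>j\<in>set (butlast (nbrs n K i)). k (i, j)) \<in> cuts 0 (butlast (nbrs n K i)) (length (A i))"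
    if i: "i \<in> {1..n}" for i and k :: "nat \<times> nat \<Rightarrow> nat"
  proof -
    have m: "map (\<lambda>j\<in>set E. k (i, j)) E = map (\<lambda>j. k (i, j)) E" for E by simp
    show ?thesis unfolding cyc_Css_eq[OF i] cuts_def mem_Collect_eq m by simp
  qed
  show ?thesis unfolding index_families_def I using c by (intro Collect_cong) blast
qed

text \<open>The inequalities link only cuts of the same monomial, so an index family is an
  independent choice of an element of \<open>cuts\<close> for each \<open>i\<close>.\<close>

lemma sum_index_families:
  fixes H :: "nat \<Rightarrow> (nat \<Rightarrow> nat) \<Rightarrow> complex"
  shows "(\<Sum>k\<in>index_families n K A. \<Prod>i\<in>{1..n}. H i (\<lambda>j\<in>set (butlast (nbrs n K i)). k (i, j))) =
    (\<Prod>i\<in>{1..n}. \<Sum>f\<in>cuts 0 (butlast (nbrs n K i)) (length (A i)). H i f)"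
proof -
  let ?B = "\<lambda>i. set (butlast (nbrs n K i))"
  let ?C = "\<lambda>i. cuts 0 (butlast (nbrs n K i)) (length (A i))"
  let ?I = "Sigma {1..n} ?B"
  have "(\<Prod>i\<in>{1..n}. \<Sum>f\<in>?C i. H i f) = (\<Sum>g\<in>Pi\<^sub>E {1..n} ?C. \<Prod>i\<in>{1..n}. H i (g i))"
    by (rule prod_sum_PiE) (auto simp: finite_cuts)
  also have "\<dots> = (\<Sum>k\<in>index_families n K A. \<Prod>i\<in>{1..n}. H i (\<lambda>j\<in>?B i. k (i, j)))"
  proof (rule sum.reindex_bij_witness[where j = "\<lambda>g. restrict (\<lambda>(i, j). g i j) ?I"
        and i = "\<lambda>k. \<lambda>i\<in>{1..n}. \<lambda>j\<in>?B i. k (i, j)"])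
    fix g assume g: "g \<in> Pi\<^sub>E {1..n} ?C"
    let ?k = "restrict (\<lambda>(i, j). g i j) ?I"
    have gi: "(\<lambda>j\<in>?B i. ?k (i, j)) = g i" if i: "i \<in> {1..n}" for i
    proof -
      have "g i \<in> extensional (?B i)" using PiE_mem[OF g i] by (simp add: cuts_def)
      then have "restrict (g i) (?B i) = g i" by (rule extensional_restrict)
      moreover have "(\<lambda>j\<in>?B i. ?k (i, j)) = restrict (g i) (?B i)"
        using i by (intro restrict_ext) simp
      ultimately show ?thesis by simp
    qed
    have "(\<lambda>i\<in>{1..n}. \<lambda>j\<in>?B i. ?k (i, j)) = restrict g {1..n}" using gi by (rule restrict_ext)
    then show "(\<lambda>i\<in>{1..n}. \<lambda>j\<in>?B i. ?k (i, j)) = g" using g by (simp add: PiE_restrict)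
    show "?k \<in> index_families n K A"
      unfolding index_families_eq using gi PiE_mem[OF g] by simp
    show "(\<Prod>i\<in>{1..n}. H i (\<lambda>j\<in>?B i. ?k (i, j))) = (\<Prod>i\<in>{1..n}. H i (g i))"
      by (rule prod.cong[OF refl]) (simp only: gi)
  next
    fix k assume k: "k \<in> index_families n K A"
    then have ext: "k \<in> extensional ?I" by (simp add: index_families_eq)
    have "restrict (\<lambda>(i, j). (\<lambda>i\<in>{1..n}. \<lambda>j\<in>?B i. k (i, j)) i j) ?I = restrict k ?I"
      by (rule restrict_ext) auto
    then show "restrict (\<lambda>(i, j). (\<lambda>i\<in>{1..n}. \<lambda>j\<in>?B i. k (i, j)) i j) ?I = k"
      using extensional_restrict[OF ext] by simp
    show "(\<lambda>i\<in>{1..n}. \<lambda>j\<in>?B i. k (i, j)) \<in> Pi\<^sub>E {1..n} ?C"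
      using k unfolding index_families_eq by (intro restrict_PiE_iff[THEN iffD2]) blast
  qed
  finally show ?thesis by simp
qed

lemma index_family_bounds:
  assumes k: "k \<in> index_families n K A" and i: "i \<in> {1..n}" and j: "j \<in> set (nbrs n K i)"
  shows "extend_index n K A k i j \<le> length (A i)"
    and "j \<noteq> C_pred n K i i \<Longrightarrow> extend_index n K A k i (C_pred n K i j) < extend_index n K A k i j"
proof -
  let ?D = "nbrs n K i"
  have ne: "?D \<noteq> []" using j by auto
  note E = extend_index_eq[OF i ne, of A k]
  have iD: "i \<notin> set ?D" using set_nbrs[OF i] by simp
  obtain r where r: "r < length ?D" "j = ?D ! r" using j by (metis in_set_conv_nth)
  have dist: "distinct ?D" by (rule distinct_nbrs)
  have lst: "?D ! s = last ?D \<longleftrightarrow> Suc s = length ?D" if "s < length ?D" for s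
    using that dist ne by (auto simp: last_conv_nth nth_eq_iff_index_eq)
  \<comment> \<open>All cut positions of \<open>A i\<close> in order, both ends included: the piece
    for the neighbour numbered \<open>s\<close> runs from \<open>S ! s\<close> to
    \<open>S ! Suc s\<close>.\<close>
  define S where "S = [0] @ map (\<lambda>j. k (i, j)) (butlast ?D) @ [length (A i)]"
  have lenS: "length S = Suc (length ?D)" using ne by (simp add: S_def)
  have S0: "S ! 0 = 0" by (simp add: S_def)
  have SE: "S ! Suc s = extend_index n K A k i (?D ! s)" if "s < length ?D" for s
  proof -
    have "?D ! s \<noteq> i" using that iD nth_mem by metis
    then show ?thesis using that ne lst[OF that] by (auto simp: S_def E nth_append nth_butlast)
  qed
  have Sp: "S ! s = extend_index n K A k i (C_pred n K i (?D ! s))" if s: "s < length ?D" for s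
    using SE[of "s - 1"] s S0 unfolding C_pred_nth[OF i s] by (cases s) (auto simp: E)
  have sorted: "sorted_wrt (<) S" if "butlast ?D \<noteq> []"
    using k i that unfolding S_def index_families_def by (simp add: cyc_Css_eq)
  show "extend_index n K A k i j \<le> length (A i)"
  proof (cases "Suc r = length ?D")
    case True
    then have "j = last ?D" using lst[OF r(1)] r(2) by blast
    moreover have "j \<noteq> i" using iD j by blast
    ultimately show ?thesis by (simp add: E)
  next
    case False
    then have "butlast ?D \<noteq> []" using r by (cases ?D) auto
    then have "S ! Suc r < S ! length ?D"
      using sorted_wrt_nth_less[OF sorted, of "Suc r" "length ?D"] r False lenS by simp
    moreover have "S ! length ?D = last S" using lenS by (subst last_conv_nth) auto
    moreover have "last S = length (A i)" by (simp add: S_def)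
    ultimately show ?thesis using SE[OF r(1)] r(2) by simp
  qed
  show "extend_index n K A k i (C_pred n K i j) < extend_index n K A k i j" if "j \<noteq> C_pred n K i i"
  proof -
    have "Suc r \<noteq> length ?D" using that lst[OF r(1)] r(2) C_pred_self[OF i ne] by simp
    then have "butlast ?D \<noteq> []" using r by (cases ?D) auto
    then have "S ! r < S ! Suc r" using sorted_wrt_nth_less[OF sorted, of r "Suc r"] r lenS by simp
    then show ?thesis using SE[OF r(1)] Sp[OF r(1)] r(2) by simp
  qed
qed

lemma cat_eq_nbrs:
  assumes "linking n v" "link_support v = K"
  shows "cat n v i = concat (map (v i) (nbrs n K i))"
proof -
  have "concat (map (v i) D) = concat (map (v i) (filter (\<lambda>j. {i, j} \<in> K) D))" for D
    using mem_link_support[OF assms(1), of i] unfolding assms(2) by (induction D) auto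
  then show ?thesis unfolding cat_def nbrs_def .
qed

text \<open>For a fixed linking, each monomial with neighbours contributes its full coefficient by
  \<open>sum_cutprod\<close>. A monomial without neighbours has the empty word, so its vacuum
  coefficient is of the same form.\<close>

lemma sum_index_families_amp:
  fixes A :: "nat \<Rightarrow> 'd::finite monomial"
  assumes K: "K \<in> configurations n" and l: "linking n v" and s: "link_support v = K"
  shows "(\<Sum>k\<in>index_families n K A. (\<Prod>i\<in>unpaired n K. wick (A i) []) *
       (\<Prod>(i, j)\<in>edges K. piece_amp n K A k i j (v i j) * piece_amp n K A k j i (v j i))) =
    (\<Prod>i\<in>{1..n}. wick (A i) (cat n v i))"
proof -
  let ?D = "nbrs n K"
  have unp: "i \<in> unpaired n K \<longleftrightarrow> ?D i = []" if i: "i \<in> {1..n}" for i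
  proof -
    have "i \<notin> \<Union>K \<longleftrightarrow> (\<forall>j. {i, j} \<notin> K)"
    proof
      assume *: "\<forall>j. {i, j} \<notin> K"
      show "i \<notin> \<Union>K"
      proof
        assume "i \<in> \<Union>K"
        then obtain e where e: "e \<in> K" "i \<in> e" by blast
        moreover obtain p q where "e = {p, q}"
          using subsetD[OF conjunct1[OF K[unfolded configurations_iff]] e(1)]
          unfolding mem_Collect_eq by (elim exE conjE)
        ultimately show False using * by (auto simp: insert_commute)
      qed
    qed auto
    also have "\<dots> \<longleftrightarrow> set (?D i) = {}"
    proof -
      have "j \<in> set (?D i) \<longleftrightarrow> {i, j} \<in> K" for j
        using configurations_edge[OF K, of i j] by (auto simp: set_nbrs[OF i])
      then show ?thesis by (simp only: set_eq_iff empty_iff simp_thms)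
    qed
    finally show ?thesis using i by (simp add: unpaired_def)
  qed
  have usub: "unpaired n K \<subseteq> {1..n}" by (auto simp: unpaired_def)
  have amp: "(\<Prod>(i, j)\<in>edges K. piece_amp n K A k i j (v i j) * piece_amp n K A k j i (v j i)) =
      (\<Prod>i\<in>{1..n}. cutprod (A i) (\<lambda>j\<in>set (butlast (?D i)). k (i, j)) (v i) 0 (?D i))" for k
    unfolding prod_edges[OF K, of "\<lambda>i j. piece_amp n K A k i j (v i j)"]
  proof (rule prod.cong[OF refl])
    fix i assume i: "i \<in> {1..n}"
    show "(\<Prod>j\<in>set (?D i). piece_amp n K A k i j (v i j)) =
        cutprod (A i) (\<lambda>j\<in>set (butlast (?D i)). k (i, j)) (v i) 0 (?D i)"
      using prod_piece_amp[OF i, of K A k "v i"] by (cases "?D i = []") auto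
  qed
  have cut: "(\<Sum>f\<in>cuts 0 (butlast (?D i)) (length (A i)). cutprod (A i) f (v i) 0 (?D i)) =
      (if ?D i = [] then 1 else wick (A i) (cat n v i))" if i: "i \<in> {1..n}" for i
  proof (cases "?D i = []")
    case True
    have "cuts 0 [] (length (A i)) = {\<lambda>_. undefined}" by (auto simp: cuts_def)
    then show ?thesis using True by simp
  next
    case False
    have "v i j \<noteq> []" if "j \<in> set (?D i)" for j
      using that set_nbrs[OF i] mem_link_support[OF l, of i j] s by simp
    then show ?thesis
      using False sum_cutprod[OF distinct_nbrs False, of "v i" 0 "A i"]
      by (simp add: cat_eq_nbrs[OF l s])
  qed
  have factor: "(\<Sum>k\<in>index_families n K A. (\<Prod>i\<in>unpaired n K. wick (A i) []) *
       (\<Prod>(i, j)\<in>edges K. piece_amp n K A k i j (v i j) * piece_amp n K A k j i (v j i))) =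
     (\<Prod>i\<in>unpaired n K. wick (A i) []) *
     (\<Prod>i\<in>{1..n}. if ?D i = [] then 1 else wick (A i) (cat n v i))"
    unfolding amp sum_distrib_left[symmetric]
      sum_index_families[of "\<lambda>i f. cutprod (A i) f (v i) 0 (?D i)"]
    by (intro arg_cong2[of _ _ _ _ "(*)"] prod.cong refl cut)
  have unpaired: "(\<Prod>i\<in>unpaired n K. wick (A i) []) = (\<Prod>i\<in>{1..n}. if ?D i = [] then wick (A i) (cat n v i) else 1)"
    by (rule prod.mono_neutral_cong_left) (use usub unp cat_eq_nbrs[OF l s] in auto)
  show ?thesis
    unfolding factor unfolding unpaired prod.distrib[symmetric] by (rule prod.cong) auto
qed

lemma prod_kappa_edges:
  fixes v :: "nat \<Rightarrow> nat \<Rightarrow> 'd list"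
  assumes l: "linking n v" and s: "link_support v = K"
  shows "(\<Prod>(i, j)\<in>edges K. \<kappa> {i, j} ^ length (v i j)) = link_weight n \<kappa> v"
  unfolding link_weight_def
proof (rule prod.mono_neutral_left)
  have m: "{i, j} \<in> K \<longleftrightarrow> v i j \<noteq> []" for i j using mem_link_support[OF l] s by blast
  show "finite {(i, j). i \<in> {1..n} \<and> j \<in> {1..n} \<and> i < j}"
    by (rule finite_subset[of _ "{1..n} \<times> {1..n}"]) auto
  show "edges K \<subseteq> {(i, j). i \<in> {1..n} \<and> j \<in> {1..n} \<and> i < j}"
    unfolding edges_def m using linking_support[OF l] by blast
  show "\<forall>e\<in>{(i, j). i \<in> {1..n} \<and> j \<in> {1..n} \<and> i < j} - edges K.
      (case e of (i, j) \<Rightarrow> \<kappa> {i, j} ^ length (v i j)) = 1"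
    unfolding edges_def m by auto
qed

text \<open>Positivity on \<open>a + b\<close> and on \<open>a - b\<close>, together with
  traciality, makes both \<open>2 + 2 * \<tau> (a * b)\<close> and
  \<open>2 - 2 * \<tau> (a * b)\<close> nonnegative reals. The covariance is thus real and lies
  between -1 and 1, which ensures the convergence of \<open>Delta\<close>.\<close>

lemma abs_covariance_le_1:
  fixes \<tau> :: "'a::cstar_algebra \<Rightarrow> complex"
  assumes \<tau>: "tracial_state \<tau>" and "star a = a" "star b = b" "\<tau> (a * a) = 1" "\<tau> (b * b) = 1"
  shows "cmod (\<tau> (a * b)) \<le> 1"
proof -
  have add: "\<tau> (x + y) = \<tau> x + \<tau> y" and scale: "\<tau> (c *\<^sub>C x) = c * \<tau> x"
    and pos: "\<tau> (star x * x) \<in> \<real>\<^sub>\<ge>\<^sub>0" and comm: "\<tau> (x * y) = \<tau> (y * x)" for x y c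
    using \<tau> unfolding tracial_state_def by blast+
  have val: "\<tau> (star (a + c *\<^sub>C b) * (a + c *\<^sub>C b)) = 1 + c * \<tau> (a * b) + cnj c * \<tau> (a * b) + cnj c * c" for c
    using assms comm[of b a]
    by (simp add: star_add star_scaleC distrib_left distrib_right scaleC_mult_left scaleC_mult_right
        add scale algebra_simps)
  have "Re (\<tau> (a * b)) \<le> 1" "- 1 \<le> Re (\<tau> (a * b))" "Im (\<tau> (a * b)) = 0"
    using pos[of "a + 1 *\<^sub>C b"] pos[of "a + (-1) *\<^sub>C b"] unfolding val by (auto simp: complex_nonneg_Reals_iff)
  then show ?thesis by (simp add: cmod_def abs_le_iff)
qed

text \<open>For fixed \<open>K\<close> the product of the factors is expanded over the linkings with
  support \<open>K\<close>. The weights do not involve the cuts, so the two sums can be exchanged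
  and the cuts summed first; grouping linkings by their support then accounts for all
  configurations.\<close>

lemma sum_configurations_eq_sum_linkings:
  fixes A :: "nat \<Rightarrow> 'd::finite monomial"
  assumes \<kappa>: "\<And>i j. i \<in> {1..n} \<Longrightarrow> j \<in> {1..n} \<Longrightarrow> cmod (\<kappa> {i, j}) \<le> 1"
    and N: "\<And>i. i \<in> {1..n} \<Longrightarrow> length (A i) \<le> N"
  shows "(\<Sum>K\<in>configurations n. \<Sum>k\<in>index_families n K A.
      (\<Prod>i\<in>unpaired n K. wick (A i) []) * (\<Prod>(i, j)\<in>edges K. T_term n K A \<kappa> k i j)) =
    (\<Sum>v\<in>linkings n N. link_weight n \<kappa> v * (\<Prod>i\<in>{1..n}. wick (A i) (cat n v i)))"
proof -
  have "(\<Sum>k\<in>index_families n K A.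
      (\<Prod>i\<in>unpaired n K. wick (A i) []) * (\<Prod>(i, j)\<in>edges K. T_term n K A \<kappa> k i j)) =
    (\<Sum>v\<in>{v \<in> linkings n N. link_support v = K}.
      link_weight n \<kappa> v * (\<Prod>i\<in>{1..n}. wick (A i) (cat n v i)))"
    if K: "K \<in> configurations n" for K
  proof -
    let ?U = "\<Prod>i\<in>unpaired n K. wick (A i) []"
    let ?V = "{v \<in> linkings n N. link_support v = K} :: (nat \<Rightarrow> nat \<Rightarrow> 'd list) set"
    let ?a = "\<lambda>k i j. piece_amp n K A k i j"
    have T: "T_term n K A \<kappa> k i j =
        (\<Sum>u\<in>words N - {[]}. \<kappa> {i, j} ^ length u * (?a k i j (rev u) * ?a k j i u))"
      if k: "k \<in> index_families n K A" and e: "(i, j) \<in> edges K" for k i j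
    proof -
      have ij: "{i, j} \<in> K" using e by (simp add: edges_def)
      note r = configurations_edge[OF K ij]
      have nb: "j \<in> set (nbrs n K i)" "i \<in> set (nbrs n K j)"
        using r ij set_nbrs[of i n K] set_nbrs[of j n K] by (auto simp: insert_commute)
      note b = index_family_bounds[OF k r(1) nb(1)] index_family_bounds[OF k r(2) nb(2)]
      show ?thesis
        using b N[OF r(1)] N[OF r(2)] by (intro T_term_eq_sum \<kappa> r) auto
    qed
    have prod: "(\<Prod>(i, j)\<in>edges K. T_term n K A \<kappa> k i j) = (\<Sum>v\<in>?V. link_weight n \<kappa> v *
        (\<Prod>(i, j)\<in>edges K. ?a k i j (v i j) * ?a k j i (v j i)))"
      if k: "k \<in> index_families n K A" for k
    proof -
      have "(\<Prod>(i, j)\<in>edges K. T_term n K A \<kappa> k i j) = (\<Prod>(i, j)\<in>edges K.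
          \<Sum>u\<in>words N - {[]}. \<kappa> {i, j} ^ length u * (?a k i j (rev u) * ?a k j i u))"
        by (rule prod.cong) (auto simp: T[OF k])
      also have "\<dots> = (\<Sum>v\<in>?V. \<Prod>(i, j)\<in>edges K.
          \<kappa> {i, j} ^ length (v j i) * (?a k i j (rev (v j i)) * ?a k j i (v j i)))"
        by (rule prod_sum_linkings[OF K])
      also have "\<dots> = (\<Sum>v\<in>?V. link_weight n \<kappa> v *
        (\<Prod>(i, j)\<in>edges K. ?a k i j (v i j) * ?a k j i (v j i)))"
      proof (rule sum.cong[OF refl])
        fix v :: "nat \<Rightarrow> nat \<Rightarrow> 'd list" assume "v \<in> ?V"
        then have v: "linking n v" "link_support v = K" by (auto simp: linkings_def)
        have r: "rev (v j i) = v i j" "length (v j i) = length (v i j)" for i j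
          using linking_rev[OF v(1), of i j] by simp_all
        show "(\<Prod>(i, j)\<in>edges K. \<kappa> {i, j} ^ length (v j i) * (?a k i j (rev (v j i)) * ?a k j i (v j i))) =
            link_weight n \<kappa> v * (\<Prod>(i, j)\<in>edges K. ?a k i j (v i j) * ?a k j i (v j i))"
          unfolding r(1) prod_kappa_edges[OF v, of \<kappa>, symmetric] prod.distrib[symmetric]
          by (rule prod.cong) (auto simp: r(2))
      qed
      finally show ?thesis .
    qed
    have "(\<Sum>k\<in>index_families n K A. ?U * (\<Prod>(i, j)\<in>edges K. T_term n K A \<kappa> k i j)) =
        (\<Sum>k\<in>index_families n K A. \<Sum>v\<in>?V. link_weight n \<kappa> v *
          (?U * (\<Prod>(i, j)\<in>edges K. ?a k i j (v i j) * ?a k j i (v j i))))"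
      by (rule sum.cong[OF refl]) (simp only: prod sum_distrib_left mult.left_commute)
    also have "\<dots> = (\<Sum>v\<in>?V. link_weight n \<kappa> v * (\<Sum>k\<in>index_families n K A.
          ?U * (\<Prod>(i, j)\<in>edges K. ?a k i j (v i j) * ?a k j i (v j i))))"
      unfolding sum_distrib_left by (rule sum.swap)
    also have "\<dots> = (\<Sum>v\<in>?V. link_weight n \<kappa> v * (\<Prod>i\<in>{1..n}. wick (A i) (cat n v i)))"
    proof (rule sum.cong[OF refl])
      fix v :: "nat \<Rightarrow> nat \<Rightarrow> 'd list" assume "v \<in> ?V"
      then have v: "linking n v" "link_support v = K" by (auto simp: linkings_def)
      show "link_weight n \<kappa> v * (\<Sum>k\<in>index_families n K A.
          ?U * (\<Prod>(i, j)\<in>edges K. ?a k i j (v i j) * ?a k j i (v j i))) =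
          link_weight n \<kappa> v * (\<Prod>i\<in>{1..n}. wick (A i) (cat n v i))"
        unfolding sum_index_families_amp[OF K v] ..
    qed
    finally show ?thesis .
  qed
  then have "(\<Sum>K\<in>configurations n. \<Sum>k\<in>index_families n K A.
      (\<Prod>i\<in>unpaired n K. wick (A i) []) * (\<Prod>(i, j)\<in>edges K. T_term n K A \<kappa> k i j)) =
    (\<Sum>K\<in>configurations n. \<Sum>v\<in>{v \<in> linkings n N. link_support v = K}.
      link_weight n \<kappa> v * (\<Prod>i\<in>{1..n}. wick (A i) (cat n v i)))"
    by (rule sum.cong[OF refl])
  also have "\<dots> = (\<Sum>v\<in>linkings n N. link_weight n \<kappa> v * (\<Prod>i\<in>{1..n}. wick (A i) (cat n v i)))"
  proof (rule sum.group[OF finite_linkings finite_configurations], rule image_subsetI)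
    fix v :: "nat \<Rightarrow> nat \<Rightarrow> 'd list" assume "v \<in> linkings n N"
    then show "link_support v \<in> configurations n"
      by (intro link_support_configurations) (simp add: linkings_def)
  qed
  finally show ?thesis .
qed

theorem proposition3p3:
  fixes \<tau> :: "'a::cstar_algebra \<Rightarrow> complex"
    and n :: nat
    and A :: "nat \<Rightarrow> ('d::finite) monomial"
    and x :: "nat \<Rightarrow> 'd \<Rightarrow> 'a"
    and \<kappa> :: "nat set \<Rightarrow> complex"
  assumes "tracial_state \<tau>"
    and "jointly_semicircular \<tau> {x i u |i u. i \<in> {1..n}}"
    and "\<And>u v i j. i \<in> {1..n} \<Longrightarrow> j \<in> {1..n} \<Longrightarrow>
           \<tau> (x i u * x j v) = (if u = v then \<kappa> {i, j} else 0)"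
    and "\<And>i. i \<in> {1..n} \<Longrightarrow> \<kappa> {i, i} = 1"
  shows "\<tau> (prod_list (map (\<lambda>i. eval_alg (x i) (A i)) [1..<n + 1])) =
           (\<Sum>K\<in>configurations n. \<Sum>k\<in>index_families n K A.
              (\<Prod>i\<in>unpaired n K. vac_state (eval_fock (A i))) *
              (\<Prod>(i, j)\<in>{(i, j). {i, j} \<in> K \<and> i < j}. T_term n K A \<kappa> k i j))
    \<and> (\<forall>(A :: 'd monomial) B l. 1 \<le> l \<longrightarrow>
         vac_state (eval_fock A \<circ> level_proj l \<circ> eval_fock B) =
           vac_state (eval_fock B \<circ> level_proj l \<circ> eval_fock A)
         \<and> (A \<noteq> [] \<longrightarrow>
              vac_state (eval_fock (butlast A) \<circ> lannihilate (last A) \<circ> level_proj l \<circ> eval_fock B) =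
              vac_state (eval_fock B \<circ> level_proj l \<circ> rcreate (last A) \<circ> eval_fock (butlast A)))
         \<and> (B \<noteq> [] \<longrightarrow>
              vac_state (eval_fock A \<circ> level_proj l \<circ> rcreate (last B) \<circ> eval_fock (butlast B)) =
              vac_state (eval_fock (butlast B) \<circ> lannihilate (last B) \<circ> level_proj l \<circ> eval_fock A))
         \<and> (A \<noteq> [] \<longrightarrow> B \<noteq> [] \<longrightarrow>
              vac_state (eval_fock (butlast A) \<circ> lannihilate (last A) \<circ> level_proj l \<circ>
                rcreate (last B) \<circ> eval_fock (butlast B)) =
              vac_state (eval_fock (butlast B) \<circ> lannihilate (last B) \<circ> level_proj l \<circ>
                rcreate (last A) \<circ> eval_fock (butlast A))))"
proof (rule conjI)
  \<comment> \<open>The total degree, chosen only as a common bound for all the degrees.\<close>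
  define N where "N = (\<Sum>i\<in>{1..n}. length (A i))"
  have N: "length (A i) \<le> N" if "i \<in> {1..n}" for i
    unfolding N_def using that by (intro member_le_sum) auto
  have \<kappa>: "cmod (\<kappa> {i, j}) \<le> 1" if ij: "i \<in> {1..n}" "j \<in> {1..n}" for i j
  proof -
    \<comment> \<open>Every covariance is attained by some pair of variables, since the type of
      letters is nonempty: any letter will do.\<close>
    fix u :: 'd
    have "star (x i u) = x i u" if "i \<in> {1..n}" for i
      using assms(2) that unfolding jointly_semicircular_def by blast
    moreover have "\<tau> (x i u * x i u) = 1" if "i \<in> {1..n}" for i
      using assms(3)[OF that that, of u u] assms(4)[OF that] by simp
    ultimately have "cmod (\<tau> (x i u * x j u)) \<le> 1"
      using abs_covariance_le_1[OF assms(1), of "x i u" "x j u"] ij by simp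
    then show ?thesis using assms(3)[OF ij, of u u] by simp
  qed
  have "\<tau> (prod_list (map (\<lambda>i. eval_alg (x i) (A i)) [1..<n + 1])) =
      stk (cov \<kappa>) [] (concat (map (\<lambda>i. map (Pair i) (A i)) [1..<Suc n]))"
    using assms(2,3) by (rule prod_list_eq_stk)
  also have "\<dots> = (\<Sum>v\<in>linkings n N. link_weight n \<kappa> v * (\<Prod>i\<in>{1..n}. wick (A i) (cat n v i)))"
    using assms(4) N by (intro stk_eq_sum_linkings) auto
  also have "\<dots> = (\<Sum>K\<in>configurations n. \<Sum>k\<in>index_families n K A.
      (\<Prod>i\<in>unpaired n K. wick (A i) []) * (\<Prod>(i, j)\<in>edges K. T_term n K A \<kappa> k i j))"
    using \<kappa> N by (rule sum_configurations_eq_sum_linkings[symmetric])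
  finally show "\<tau> (prod_list (map (\<lambda>i. eval_alg (x i) (A i)) [1..<n + 1])) =
           (\<Sum>K\<in>configurations n. \<Sum>k\<in>index_families n K A.
              (\<Prod>i\<in>unpaired n K. vac_state (eval_fock (A i))) *
              (\<Prod>(i, j)\<in>{(i, j). {i, j} \<in> K \<and> i < j}. T_term n K A \<kappa> k i j))"
    unfolding edges_def vac_state_coord coord_eval_fock_vacuum .
\<comment> \<open>The third identity is the second with \<open>A\<close> and \<open>B\<close>
  exchanged, read from right to left.\<close>
qed (intro allI impI conjI trace_identities trace_identities(2)[symmetric]; assumption)

end
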